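(* Let $R$ be a commutative noetherian ring. Every two-term cosilting complex in $\mathsf{D}(R)$ is cotilting.
   Context: $\mathsf{D}(R)$ is the unbounded derived category of $\mathsf{Mod}(R)$. For an object $C$ of $\mathsf{D}(R)$ and $J\subseteq\mathbb{Z}$, let ${}^{\perp_J}C=\{Z\in\mathsf{D}(R)\colon\operatorname{Hom}_{\mathsf{D}(R)}(Z,C[k])=0\ \forall k\in J\}$. A $t$-structure is a pair $(\mathcal{U},\mathcal{V})$ of full subcategories with $\operatorname{Hom}(\mathcal{U},\mathcal{V})=0$, $\mathcal{U}[1]\subseteq\mathcal{U}$, and such that every object $X$ fits in a triangle $U\to X\to V\to U[1]$ with $U\in\mathcal{U}$, $V\in\mathcal{V}$. An object $C$ is cosilting if $({}^{\perp_{\leq0}}C,{}^{\perp_{>0}}C)$ is a $t$-structure in $\mathsf{D}(R)$; a cosilting object $C$ is cotilting if moreover $C^I$ lies in ${}^{\perp_{\neq0}}C$ for every set $I$. A cosilting complex is two-term if it is isomorphic in $\mathsf{D}(R)$ to a complex of injective $R$-modules concentrated in two consecutive degrees. *)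

theory Defs
  imports "HOL-Algebra.Ring_Divisibility" "HOL-Algebra.Module" "HOL-Library.Equipollence"
begin

text \<open>
  The derived category of \<open>R\<close>-modules, formed inside a Grothendieck universe.  The universe is a
  type \<open>'u\<close> whose cardinality is strongly inaccessible.  A set (over any type) is small, i.e. has
  the size of a member of the universe, iff it is strictly smaller than \<open>'u\<close>.  Every small set is
  in bijection with a subset of \<open>'u\<close>, so the modules with small carrier contained in \<open>'u\<close> form a
  category equivalent to that of all small modules.
\<close>

definition grothendieck_universe :: "'u itself \<Rightarrow> bool" where
  "grothendieck_universe _ \<longleftrightarrow>
     (UNIV :: nat set) \<prec> (UNIV :: 'u set) \<and>
     (\<forall>A :: 'u set. A \<prec> (UNIV :: 'u set) \<longrightarrow> Pow A \<prec> (UNIV :: 'u set)) \<and>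
     (\<forall>(I :: 'u set) (F :: 'u \<Rightarrow> 'u set).
        I \<prec> (UNIV :: 'u set) \<and> (\<forall>i\<in>I. F i \<prec> (UNIV :: 'u set))
          \<longrightarrow> (\<Union>i\<in>I. F i) \<prec> (UNIV :: 'u set))"


section \<open>Modules\<close>

definition small_module :: "'r ring \<Rightarrow> ('r, 'u) module \<Rightarrow> bool" where
  "small_module R M \<longleftrightarrow> module R M \<and> carrier M \<prec> (UNIV :: 'u set)"

definition mod_hom :: "'r ring \<Rightarrow> ('r, 'u) module \<Rightarrow> ('r, 'u) module \<Rightarrow> ('u \<Rightarrow> 'u) set" where
  "mod_hom R M N = {f. f \<in> carrier M \<rightarrow> carrier N \<and>
     (\<forall>x\<in>carrier M. \<forall>y\<in>carrier M. f (x \<oplus>\<^bsub>M\<^esub> y) = f x \<oplus>\<^bsub>N\<^esub> f y) \<and>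
     (\<forall>a\<in>carrier R. \<forall>x\<in>carrier M. f (a \<odot>\<^bsub>M\<^esub> x) = a \<odot>\<^bsub>N\<^esub> f x)}"

definition injective_module :: "'r ring \<Rightarrow> ('r, 'u) module \<Rightarrow> bool" where
  "injective_module R E \<longleftrightarrow> small_module R E \<and>
     (\<forall>A B i f. small_module R A \<and> small_module R B \<and>
        i \<in> mod_hom R A B \<and> inj_on i (carrier A) \<and> f \<in> mod_hom R A E
          \<longrightarrow> (\<exists>g \<in> mod_hom R B E. \<forall>x\<in>carrier A. g (i x) = f x))"

text \<open>
  Direct sums of two modules have to be carried by \<open>'u\<close> again, so pairs are coded by a fixed
  injection, which exists as soon as \<open>'u\<close> is infinite.
\<close>

definition upair :: "'u \<times> 'u \<Rightarrow> 'u" where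
  "upair = (SOME p. inj p)"

definition ufst :: "'u \<Rightarrow> 'u" where "ufst z = fst (inv_into UNIV upair z)"
definition usnd :: "'u \<Rightarrow> 'u" where "usnd z = snd (inv_into UNIV upair z)"

lemma inj_upair:
  assumes "infinite (UNIV :: 'u set)"
  shows "inj (upair :: 'u \<times> 'u \<Rightarrow> 'u)"
proof -
  have "(UNIV :: 'u set) \<times> (UNIV :: 'u set) \<approx> (UNIV :: 'u set)"
    using card_of_Times_same_infinite[OF assms] by (simp add: eqpoll_iff_card_of_ordIso)
  then obtain p :: "'u \<times> 'u \<Rightarrow> 'u" where "bij_betw p (UNIV \<times> UNIV) UNIV"
    unfolding eqpoll_def by blast
  then have "inj p" by (simp add: bij_betw_def)
  then show ?thesis unfolding upair_def by (rule someI[of inj])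
qed

lemma ufst_usnd_upair:
  fixes x y :: 'u
  assumes "infinite (UNIV :: 'u set)"
  shows "ufst (upair (x, y)) = x" "usnd (upair (x, y)) = y"
  by (simp_all add: ufst_def usnd_def inv_f_f[OF inj_upair[OF assms]])

definition direct_sum :: "('r, 'u) module \<Rightarrow> ('r, 'u) module \<Rightarrow> ('r, 'u) module" where
  "direct_sum M N =
     \<lparr> carrier = upair ` (carrier M \<times> carrier N),
       monoid.mult = undefined, one = undefined,
       ring.zero = upair (\<zero>\<^bsub>M\<^esub>, \<zero>\<^bsub>N\<^esub>),
       add = (\<lambda>x y. upair (ufst x \<oplus>\<^bsub>M\<^esub> ufst y, usnd x \<oplus>\<^bsub>N\<^esub> usnd y)),
       smult = (\<lambda>a x. upair (a \<odot>\<^bsub>M\<^esub> ufst x, a \<odot>\<^bsub>N\<^esub> usnd x)) \<rparr>"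


section \<open>Cochain complexes\<close>

record ('r, 'u) cochain =
  obj :: "int \<Rightarrow> ('r, 'u) module"
  diff :: "int \<Rightarrow> 'u \<Rightarrow> 'u"

definition complexes :: "'r ring \<Rightarrow> ('r, 'u) cochain set" where
  "complexes R = {X. \<forall>n. small_module R (obj X n) \<and>
     diff X n \<in> mod_hom R (obj X n) (obj X (n + 1)) \<and>
     (\<forall>x\<in>carrier (obj X n). diff X (n + 1) (diff X n x) = \<zero>\<^bsub>obj X (n + 2)\<^esub>)}"

definition shift :: "int \<Rightarrow> ('r, 'u) cochain \<Rightarrow> ('r, 'u) cochain" where
  "shift k X = \<lparr> obj = (\<lambda>n. obj X (n + k)),
     diff = (\<lambda>n x. if even k then diff X (n + k) x
                    else \<ominus>\<^bsub>obj X (n + k + 1)\<^esub> diff X (n + k) x) \<rparr>"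

definition chain_maps ::
  "'r ring \<Rightarrow> ('r, 'u) cochain \<Rightarrow> ('r, 'u) cochain \<Rightarrow> (int \<Rightarrow> 'u \<Rightarrow> 'u) set" where
  "chain_maps R X Y = {f. \<forall>n. f n \<in> mod_hom R (obj X n) (obj Y n) \<and>
     (\<forall>x\<in>carrier (obj X n). f (n + 1) (diff X n x) = diff Y n (f n x))}"

definition id_map :: "int \<Rightarrow> 'u \<Rightarrow> 'u" where
  "id_map = (\<lambda>n x. x)"

definition zero_map :: "('r, 'u) cochain \<Rightarrow> int \<Rightarrow> 'u \<Rightarrow> 'u" where
  "zero_map Y = (\<lambda>n x. \<zero>\<^bsub>obj Y n\<^esub>)"

definition comp_map :: "(int \<Rightarrow> 'u \<Rightarrow> 'u) \<Rightarrow> (int \<Rightarrow> 'u \<Rightarrow> 'u) \<Rightarrow> int \<Rightarrow> 'u \<Rightarrow> 'u" where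
  "comp_map g f = (\<lambda>n x. g n (f n x))"

definition shift_map :: "int \<Rightarrow> (int \<Rightarrow> 'u \<Rightarrow> 'u) \<Rightarrow> int \<Rightarrow> 'u \<Rightarrow> 'u" where
  "shift_map k f = (\<lambda>n. f (n + k))"

definition homotopic ::
  "'r ring \<Rightarrow> ('r, 'u) cochain \<Rightarrow> ('r, 'u) cochain \<Rightarrow>
   (int \<Rightarrow> 'u \<Rightarrow> 'u) \<Rightarrow> (int \<Rightarrow> 'u \<Rightarrow> 'u) \<Rightarrow> bool" where
  "homotopic R X Y f g \<longleftrightarrow>
     (\<exists>h. (\<forall>n. h n \<in> mod_hom R (obj X n) (obj Y (n - 1))) \<and>
          (\<forall>n. \<forall>x\<in>carrier (obj X n).
             f n x \<ominus>\<^bsub>obj Y n\<^esub> g n x =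
             diff Y (n - 1) (h n x) \<oplus>\<^bsub>obj Y n\<^esub> h (n + 1) (diff X n x)))"

definition cocycles :: "('r, 'u) cochain \<Rightarrow> int \<Rightarrow> 'u set" where
  "cocycles X n = {x \<in> carrier (obj X n). diff X n x = \<zero>\<^bsub>obj X (n + 1)\<^esub>}"

definition coboundaries :: "('r, 'u) cochain \<Rightarrow> int \<Rightarrow> 'u set" where
  "coboundaries X n = diff X (n - 1) ` carrier (obj X (n - 1))"

definition cohomology :: "('r, 'u) cochain \<Rightarrow> int \<Rightarrow> 'u set set" where
  "cohomology X n = (\<lambda>z. coboundaries X n +>\<^bsub>obj X n\<^esub> z) ` cocycles X n"

text \<open>
  The map induced by \<open>f\<close> on cohomology sends the coset \<open>c = B(X) + z\<close> to \<open>B(Y) + f(c)\<close>, which is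
  the coset \<open>B(Y) + f(z)\<close>.
\<close>

definition quasi_iso ::
  "'r ring \<Rightarrow> ('r, 'u) cochain \<Rightarrow> ('r, 'u) cochain \<Rightarrow> (int \<Rightarrow> 'u \<Rightarrow> 'u) \<Rightarrow> bool" where
  "quasi_iso R X Y f \<longleftrightarrow> f \<in> chain_maps R X Y \<and>
     (\<forall>n. bij_betw (\<lambda>c. coboundaries Y n <+>\<^bsub>obj Y n\<^esub> (f n ` c)) (cohomology X n) (cohomology Y n))"


section \<open>The derived category\<close>

text \<open>
  The objects are the complexes, and the morphisms are obtained from the homotopy category by
  inverting quasi-isomorphisms: a morphism from \<open>X\<close> to \<open>Y\<close> is an equivalence class of roofs
  \<open>(W, s, f)\<close>, that is \<open>X \<leftarrow> W \<rightarrow> Y\<close> with left leg \<open>s\<close> a quasi-isomorphism and right leg \<open>f\<close>.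
\<close>

type_synonym ('r, 'u) roof = "('r, 'u) cochain \<times> (int \<Rightarrow> 'u \<Rightarrow> 'u) \<times> (int \<Rightarrow> 'u \<Rightarrow> 'u)"

definition roofs :: "'r ring \<Rightarrow> ('r, 'u) cochain \<Rightarrow> ('r, 'u) cochain \<Rightarrow> ('r, 'u) roof set" where
  "roofs R X Y = {(W, s, f). W \<in> complexes R \<and> quasi_iso R W X s \<and> f \<in> chain_maps R W Y}"

definition roof_eq ::
  "'r ring \<Rightarrow> ('r, 'u) cochain \<Rightarrow> ('r, 'u) cochain \<Rightarrow> (('r, 'u) roof \<times> ('r, 'u) roof) set" where
  "roof_eq R X Y = {((W, s, f), (W', s', f')).
     (W, s, f) \<in> roofs R X Y \<and> (W', s', f') \<in> roofs R X Y \<and>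
     (\<exists>V a b. V \<in> complexes R \<and> a \<in> chain_maps R V W \<and> b \<in> chain_maps R V W' \<and>
        quasi_iso R V X (comp_map s a) \<and>
        homotopic R V X (comp_map s a) (comp_map s' b) \<and>
        homotopic R V Y (comp_map f a) (comp_map f' b))}"

type_synonym ('r, 'u) mor = "('r, 'u) roof set"

definition Hom_D :: "'r ring \<Rightarrow> ('r, 'u) cochain \<Rightarrow> ('r, 'u) cochain \<Rightarrow> ('r, 'u) mor set" where
  "Hom_D R X Y = roofs R X Y // roof_eq R X Y"

definition of_map ::
  "'r ring \<Rightarrow> ('r, 'u) cochain \<Rightarrow> ('r, 'u) cochain \<Rightarrow> (int \<Rightarrow> 'u \<Rightarrow> 'u) \<Rightarrow> ('r, 'u) mor" where
  "of_map R X Y f = roof_eq R X Y `` {(X, id_map, f)}"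

definition id_D :: "'r ring \<Rightarrow> ('r, 'u) cochain \<Rightarrow> ('r, 'u) mor" where
  "id_D R X = of_map R X X id_map"

definition zero_D :: "'r ring \<Rightarrow> ('r, 'u) cochain \<Rightarrow> ('r, 'u) cochain \<Rightarrow> ('r, 'u) mor" where
  "zero_D R X Y = of_map R X Y (zero_map Y)"

text \<open>
  \<open>comp_D R X Y Z \<psi> \<phi>\<close> is the composite of \<open>\<phi> : X \<rightarrow> Y\<close> and \<open>\<psi> : Y \<rightarrow> Z\<close>.  Roofs \<open>(W, s, f)\<close> and
  \<open>(W', t, g)\<close> representing them compose via any \<open>V\<close> with a quasi-isomorphism \<open>a : V \<rightarrow> W\<close> and a
  chain map \<open>b : V \<rightarrow> W'\<close> such that \<open>f a\<close> and \<open>t b\<close> are homotopic.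
\<close>

definition comp_D ::
  "'r ring \<Rightarrow> ('r, 'u) cochain \<Rightarrow> ('r, 'u) cochain \<Rightarrow> ('r, 'u) cochain \<Rightarrow>
   ('r, 'u) mor \<Rightarrow> ('r, 'u) mor \<Rightarrow> ('r, 'u) mor" where
  "comp_D R X Y Z \<psi> \<phi> = {r. \<exists>W s f W' t g V a b.
     (W, s, f) \<in> \<phi> \<and> (W', t, g) \<in> \<psi> \<and>
     V \<in> complexes R \<and> quasi_iso R V W a \<and> b \<in> chain_maps R V W' \<and>
     homotopic R V Y (comp_map f a) (comp_map t b) \<and>
     ((V, comp_map s a, comp_map g b), r) \<in> roof_eq R X Z}"

definition shift_D ::
  "'r ring \<Rightarrow> int \<Rightarrow> ('r, 'u) cochain \<Rightarrow> ('r, 'u) cochain \<Rightarrow> ('r, 'u) mor \<Rightarrow> ('r, 'u) mor" where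
  "shift_D R k X Y \<phi> = {r. \<exists>W s f. (W, s, f) \<in> \<phi> \<and>
     ((shift k W, shift_map k s, shift_map k f), r) \<in> roof_eq R (shift k X) (shift k Y)}"

definition iso_mor_D ::
  "'r ring \<Rightarrow> ('r, 'u) cochain \<Rightarrow> ('r, 'u) cochain \<Rightarrow> ('r, 'u) mor \<Rightarrow> bool" where
  "iso_mor_D R X Y \<phi> \<longleftrightarrow> \<phi> \<in> Hom_D R X Y \<and>
     (\<exists>\<psi> \<in> Hom_D R Y X. comp_D R X Y X \<psi> \<phi> = id_D R X \<and> comp_D R Y X Y \<phi> \<psi> = id_D R Y)"

definition iso_D :: "'r ring \<Rightarrow> ('r, 'u) cochain \<Rightarrow> ('r, 'u) cochain \<Rightarrow> bool" where
  "iso_D R X Y \<longleftrightarrow> (\<exists>\<phi>. iso_mor_D R X Y \<phi>)"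


section \<open>Distinguished triangles\<close>

text \<open>
  Conventions: \<open>cone(f)\<close> is \<open>A[1] \<oplus> B\<close> with differential \<open>(a, b) \<mapsto> (- d a, f a + d b)\<close>, and the
  standard triangle of \<open>f : A \<rightarrow> B\<close> is \<open>A \<rightarrow> B \<rightarrow> cone(f) \<rightarrow> A[1]\<close>.
\<close>

definition cone ::
  "('r, 'u) cochain \<Rightarrow> ('r, 'u) cochain \<Rightarrow> (int \<Rightarrow> 'u \<Rightarrow> 'u) \<Rightarrow> ('r, 'u) cochain" where
  "cone A B f = \<lparr> obj = (\<lambda>n. direct_sum (obj A (n + 1)) (obj B n)),
     diff = (\<lambda>n x. upair (\<ominus>\<^bsub>obj A (n + 2)\<^esub> diff A (n + 1) (ufst x),
                           f (n + 1) (ufst x) \<oplus>\<^bsub>obj B (n + 1)\<^esub> diff B n (usnd x))) \<rparr>"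

definition cone_incl :: "('r, 'u) cochain \<Rightarrow> int \<Rightarrow> 'u \<Rightarrow> 'u" where
  "cone_incl A = (\<lambda>n y. upair (\<zero>\<^bsub>obj A (n + 1)\<^esub>, y))"

definition cone_proj :: "int \<Rightarrow> 'u \<Rightarrow> 'u" where
  "cone_proj = (\<lambda>n x. ufst x)"

definition distinguished_triangle ::
  "'r ring \<Rightarrow> ('r, 'u) cochain \<Rightarrow> ('r, 'u) cochain \<Rightarrow> ('r, 'u) cochain \<Rightarrow>
   ('r, 'u) mor \<Rightarrow> ('r, 'u) mor \<Rightarrow> ('r, 'u) mor \<Rightarrow> bool" where
  "distinguished_triangle R X Y Z u v w \<longleftrightarrow>
     u \<in> Hom_D R X Y \<and> v \<in> Hom_D R Y Z \<and> w \<in> Hom_D R Z (shift 1 X) \<and>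
     (\<exists>A B f \<alpha> \<beta> \<gamma>. A \<in> complexes R \<and> B \<in> complexes R \<and> f \<in> chain_maps R A B \<and>
        iso_mor_D R X A \<alpha> \<and> iso_mor_D R Y B \<beta> \<and> iso_mor_D R Z (cone A B f) \<gamma> \<and>
        comp_D R X Y B \<beta> u = comp_D R X A B (of_map R A B f) \<alpha> \<and>
        comp_D R Y Z (cone A B f) \<gamma> v =
          comp_D R Y B (cone A B f) (of_map R B (cone A B f) (cone_incl A)) \<beta> \<and>
        comp_D R Z (shift 1 X) (shift 1 A) (shift_D R 1 X A \<alpha>) w =
          comp_D R Z (cone A B f) (shift 1 A) (of_map R (cone A B f) (shift 1 A) cone_proj) \<gamma>)"


section \<open>Cosilting and cotilting objects\<close>

definition perp :: "'r ring \<Rightarrow> int set \<Rightarrow> ('r, 'u) cochain \<Rightarrow> ('r, 'u) cochain set" where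
  "perp R J C = {Z \<in> complexes R. \<forall>k\<in>J. Hom_D R Z (shift k C) = {zero_D R Z (shift k C)}}"

definition t_structure ::
  "'r ring \<Rightarrow> ('r, 'u) cochain set \<Rightarrow> ('r, 'u) cochain set \<Rightarrow> bool" where
  "t_structure R \<U> \<V> \<longleftrightarrow> \<U> \<subseteq> complexes R \<and> \<V> \<subseteq> complexes R \<and>
     (\<forall>U\<in>\<U>. \<forall>V\<in>\<V>. Hom_D R U V = {zero_D R U V}) \<and>
     (\<forall>U\<in>\<U>. shift 1 U \<in> \<U>) \<and>
     (\<forall>X\<in>complexes R. \<exists>U\<in>\<U>. \<exists>V\<in>\<V>. \<exists>u v w. distinguished_triangle R U X V u v w)"

definition cosilting :: "'r ring \<Rightarrow> ('r, 'u) cochain \<Rightarrow> bool" where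
  "cosilting R C \<longleftrightarrow> C \<in> complexes R \<and> t_structure R (perp R {..0} C) (perp R {0<..} C)"

text \<open>
  \<open>power_D R I C P p\<close>: the object \<open>P\<close> with projections \<open>p i : P \<rightarrow> C\<close> is a product in the derived
  category of copies of \<open>C\<close> indexed by \<open>I\<close>.
\<close>

definition power_D ::
  "'r ring \<Rightarrow> 'u set \<Rightarrow> ('r, 'u) cochain \<Rightarrow> ('r, 'u) cochain \<Rightarrow> ('u \<Rightarrow> ('r, 'u) mor) \<Rightarrow> bool" where
  "power_D R I C P p \<longleftrightarrow> P \<in> complexes R \<and> (\<forall>i\<in>I. p i \<in> Hom_D R P C) \<and>
     (\<forall>Z\<in>complexes R. \<forall>q. (\<forall>i\<in>I. q i \<in> Hom_D R Z C) \<longrightarrow>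
        (\<exists>!g. g \<in> Hom_D R Z P \<and> (\<forall>i\<in>I. comp_D R Z P C (p i) g = q i)))"

text \<open>
  Index sets are small sets; being in bijection with subsets of \<open>'u\<close>, they are taken there.
  Small powers exist, namely as degreewise products, and are unique up to isomorphism, so
  quantifying over all of them is the same as taking the one power of \<open>C\<close>.
\<close>

definition cotilting :: "'r ring \<Rightarrow> ('r, 'u) cochain \<Rightarrow> bool" where
  "cotilting R C \<longleftrightarrow> cosilting R C \<and>
     (\<forall>(I :: 'u set) P p. I \<prec> (UNIV :: 'u set) \<and> power_D R I C P p \<longrightarrow> P \<in> perp R (UNIV - {0}) C)"

definition two_term :: "'r ring \<Rightarrow> ('r, 'u) cochain \<Rightarrow> bool" where
  "two_term R C \<longleftrightarrow> (\<exists>E \<in> complexes R. \<exists>m :: int.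
     (\<forall>n. injective_module R (obj E n)) \<and>
     (\<forall>n. n \<noteq> m \<and> n \<noteq> m + 1 \<longrightarrow> carrier (obj E n) = {\<zero>\<^bsub>obj E n\<^esub>}) \<and>
     iso_D R C E)"

end

theory Submission
  imports Defs
begin


text \<open>
  The complex \<open>C\<close> is quasi-isomorphic to a complex \<open>E\<close> of injectives \<open>E\<^sup>m \<rightarrow> E\<^sup>m\<^sup>+\<^sup>1\<close>, with kernel \<open>K\<close> and
  cokernel \<open>L\<close>.  Maps from \<open>X\<close> to \<open>C[k]\<close> in the derived category are chain maps \<open>X \<rightarrow> E[k]\<close> up to
  homotopy (\<open>roof_eq_iff_represents\<close>), so membership in the two halves of the \<open>t\<close>-structure means that
  such chain maps are null homotopic (\<open>perp_iff\<close>).  Let \<open>P\<close> be a power of \<open>C\<close>; three ranges of shifts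
  have to be treated.

  For \<open>k > 0\<close>: whatever has no maps to \<open>C\<close> has no maps to \<open>P\<close>, so \<open>P\<close> is right orthogonal to the aisle
  and lies in the coaisle (\<open>power_in_coaisle\<close>).  For \<open>k \<le> -2\<close>: the cohomology of \<open>P\<close> vanishes above
  degree \<open>m + 1\<close> and \<open>C[k]\<close> lives in degrees at least \<open>m + 2\<close>.

  The remaining shift \<open>k = -1\<close> uses that \<open>R\<close> is commutative and noetherian.  A map \<open>P \<rightarrow> C[-1]\<close> is a
  homomorphism \<open>h : H\<^sup>m\<^sup>+\<^sup>1(P) \<rightarrow> K\<close>, where \<open>H\<^sup>m\<^sup>+\<^sup>1(P)\<close> is the corresponding power of \<open>L\<close>.  If \<open>h\<close> is not
  zero, pick \<open>y = h(v)\<close> such that \<open>ann(y)\<close> is a prime ideal \<open>\<pp>\<close>.  Some \<open>s\<close> outside \<open>\<pp>\<close> satisfies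
  \<open>s L = 0\<close> (\<open>cokernel_killed_outside_prime\<close>); then \<open>s\<close> kills every power of \<open>L\<close>, hence
  \<open>s y = h(s v) = 0\<close>, contradicting the choice of \<open>s\<close>.

  The element \<open>s\<close> is one whose annihilator is largest among all \<open>s\<close> outside \<open>\<pp>\<close>.  Then
  \<open>R / ann(s) \<cong> s R\<close> is the image of \<open>R\<close> in the localization \<open>R\<^sub>\<pp>\<close>.  Truncating the stalk complex
  \<open>s R[-m]\<close> by the \<open>t\<close>-structure gives a triangle \<open>A \<rightarrow> s R[-m] \<rightarrow> G\<close>.  Here \<open>H\<^sup>m(A)\<close> embeds into \<open>s R\<close>,
  because the coaisle has no cohomology below degree \<open>m\<close> (\<open>coaisle_low_acyclic\<close>), and \<open>H\<^sup>m(A)\<close> has no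
  nonzero map to \<open>K\<close>, because \<open>A\<close> is in the aisle (\<open>cohomology_map_zero\<close>).  A nonzero ideal inside \<open>s R\<close>
  is not killed by any element outside \<open>\<pp>\<close>, so by Nakayama's lemma at \<open>\<pp>\<close> it has a nonzero map to
  \<open>R y \<subseteq> K\<close> (\<open>nonzero_map_to_cyclic\<close>); hence \<open>H\<^sup>m(A) = 0\<close>.  It follows that \<open>s R[-m]\<close> has no nonzero
  maps to \<open>C[1]\<close>, that is, every homomorphism \<open>s R \<rightarrow> E\<^sup>m\<^sup>+\<^sup>1\<close> lifts to \<open>E\<^sup>m\<close>.  Applied to \<open>x \<mapsto> x e\<close> this
  says that \<open>s e\<close> is in the image of \<open>E\<^sup>m\<close>, for every \<open>e\<close> in \<open>E\<^sup>m\<^sup>+\<^sup>1\<close>.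
\<close>

section \<open>Abelian groups and module homomorphisms\<close>

lemma (in abelian_group) a_inv_zero [simp]: "\<ominus> \<zero> = \<zero>"
  by (metis a_inv_closed r_neg l_zero zero_closed)

text \<open>
  Registered for the method \<open>algebra\<close>, these rules decide equations between integer linear
  combinations in an abelian group, which is what most verifications on chains come down to.
\<close>

lemmas (in abelian_group) ab_simprules
  [algebra abgrp "zero G" "add G" "a_inv G" "a_minus G"] =
  a_closed zero_closed a_inv_closed minus_closed
  a_assoc l_zero l_neg a_comm minus_eq
  r_zero r_neg r_neg2 r_neg1 minus_add minus_minus a_inv_zero
  a_lcomm

lemma (in abelian_group) minus_eq_iff:
  "\<lbrakk>x \<in> carrier G; y \<in> carrier G; z \<in> carrier G\<rbrakk> \<Longrightarrow> x \<ominus> y = z \<longleftrightarrow> x = z \<oplus> y"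
  by (metis a_assoc l_neg minus_eq r_neg r_zero a_inv_closed)

lemma (in abelian_group) minus_eq_zero_iff:
  "\<lbrakk>x \<in> carrier G; y \<in> carrier G\<rbrakk> \<Longrightarrow> x \<ominus> y = \<zero> \<longleftrightarrow> x = y"
  by (simp add: minus_eq_iff)

lemma (in abelian_group) add_eq_zero_iff:
  "\<lbrakk>x \<in> carrier G; y \<in> carrier G\<rbrakk> \<Longrightarrow> x \<oplus> y = \<zero> \<longleftrightarrow> x = \<ominus> y"
  by (metis a_inv_closed local.minus_minus minus_eq minus_eq_zero_iff)

lemma mod_hom_closed: "f \<in> mod_hom R M N \<Longrightarrow> x \<in> carrier M \<Longrightarrow> f x \<in> carrier N"
  by (auto simp: mod_hom_def)

lemma mod_hom_add: "f \<in> mod_hom R M N \<Longrightarrow> x \<in> carrier M \<Longrightarrow> y \<in> carrier M \<Longrightarrow>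
    f (x \<oplus>\<^bsub>M\<^esub> y) = f x \<oplus>\<^bsub>N\<^esub> f y"
  by (auto simp: mod_hom_def)

lemma mod_hom_smult: "f \<in> mod_hom R M N \<Longrightarrow> a \<in> carrier R \<Longrightarrow> x \<in> carrier M \<Longrightarrow>
    f (a \<odot>\<^bsub>M\<^esub> x) = a \<odot>\<^bsub>N\<^esub> f x"
  by (auto simp: mod_hom_def)

lemma mod_homI:
  assumes "\<And>x. x \<in> carrier M \<Longrightarrow> f x \<in> carrier N"
    and "\<And>x y. x \<in> carrier M \<Longrightarrow> y \<in> carrier M \<Longrightarrow> f (x \<oplus>\<^bsub>M\<^esub> y) = f x \<oplus>\<^bsub>N\<^esub> f y"
    and "\<And>a x. a \<in> carrier R \<Longrightarrow> x \<in> carrier M \<Longrightarrow> f (a \<odot>\<^bsub>M\<^esub> x) = a \<odot>\<^bsub>N\<^esub> f x"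
  shows "f \<in> mod_hom R M N"
  using assms by (auto simp: mod_hom_def)

lemma module_abelian_group: "module R M \<Longrightarrow> abelian_group M"
  by (simp add: module_def)

lemma mod_hom_zero:
  assumes "f \<in> mod_hom R M N" "abelian_group M" "abelian_group N"
  shows "f \<zero>\<^bsub>M\<^esub> = \<zero>\<^bsub>N\<^esub>"
proof -
  interpret M: abelian_group M by fact
  interpret N: abelian_group N by fact
  have c: "f \<zero>\<^bsub>M\<^esub> \<in> carrier N" using assms(1) by (simp add: mod_hom_closed)
  have "f \<zero>\<^bsub>M\<^esub> \<oplus>\<^bsub>N\<^esub> f \<zero>\<^bsub>M\<^esub> = f \<zero>\<^bsub>M\<^esub>"
    using mod_hom_add[OF assms(1), of "\<zero>\<^bsub>M\<^esub>" "\<zero>\<^bsub>M\<^esub>"] by simp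
  then show ?thesis using c by (metis N.add.r_cancel_one)
qed

lemma mod_hom_uminus:
  assumes "f \<in> mod_hom R M N" "abelian_group M" "abelian_group N" "x \<in> carrier M"
  shows "f (\<ominus>\<^bsub>M\<^esub> x) = \<ominus>\<^bsub>N\<^esub> f x"
proof -
  interpret M: abelian_group M by fact
  interpret N: abelian_group N by fact
  have "f (\<ominus>\<^bsub>M\<^esub> x) \<oplus>\<^bsub>N\<^esub> f x = \<zero>\<^bsub>N\<^esub>"
    using mod_hom_add[OF assms(1), of "\<ominus>\<^bsub>M\<^esub> x" x] assms(4) mod_hom_zero[OF assms(1-3)]
    by (simp add: M.l_neg)
  then show ?thesis using assms by (simp add: N.add_eq_zero_iff mod_hom_closed)
qed

lemma mod_hom_minus:
  assumes "f \<in> mod_hom R M N" "abelian_group M" "abelian_group N" "x \<in> carrier M" "y \<in> carrier M"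
  shows "f (x \<ominus>\<^bsub>M\<^esub> y) = f x \<ominus>\<^bsub>N\<^esub> f y"
  using assms
  by (simp add: a_minus_def mod_hom_add mod_hom_uminus abelian_group.a_inv_closed)

lemma mod_hom_id: "(\<lambda>x. x) \<in> mod_hom R M M"
  by (rule mod_homI) auto

lemma mod_hom_comp:
  assumes "f \<in> mod_hom R L M" "g \<in> mod_hom R M N"
  shows "(\<lambda>x. g (f x)) \<in> mod_hom R L N"
  using assms by (intro mod_homI) (simp_all add: mod_hom_closed mod_hom_add mod_hom_smult)

lemma mod_hom_const_zero:
  assumes "module R N"
  shows "(\<lambda>x. \<zero>\<^bsub>N\<^esub>) \<in> mod_hom R M N"
proof -
  interpret module R N by fact
  show ?thesis by (intro mod_homI) simp_all
qed

lemma mod_hom_plus: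
  assumes "f \<in> mod_hom R M N" "g \<in> mod_hom R M N" "module R N"
  shows "(\<lambda>x. f x \<oplus>\<^bsub>N\<^esub> g x) \<in> mod_hom R M N"
proof -
  interpret N: module R N by fact
  have c: "f x \<in> carrier N" "g x \<in> carrier N" if "x \<in> carrier M" for x
    using that assms by (auto intro: mod_hom_closed)
  show ?thesis using assms(1,2)
    by (intro mod_homI)
      (simp_all add: c mod_hom_add mod_hom_smult N.smult_r_distr N.M.a_ac)
qed

lemma mod_hom_neg:
  assumes "f \<in> mod_hom R M N" "module R N"
  shows "(\<lambda>x. \<ominus>\<^bsub>N\<^esub> f x) \<in> mod_hom R M N"
proof -
  interpret N: module R N by fact
  show ?thesis using assms(1)
    by (intro mod_homI)
      (simp_all add: mod_hom_closed mod_hom_add mod_hom_smult N.smult_r_minus N.M.minus_add)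
qed

lemma mod_hom_diff:
  assumes "f \<in> mod_hom R M N" "g \<in> mod_hom R M N" "module R N"
  shows "(\<lambda>x. f x \<ominus>\<^bsub>N\<^esub> g x) \<in> mod_hom R M N"
  using mod_hom_plus[OF assms(1) mod_hom_neg[OF assms(2,3)] assms(3)] by (simp add: a_minus_def)

lemma module_carrier_update:
  assumes "submodule H R M" "module R M"
  shows "module R (M\<lparr>carrier := H\<rparr>)"
proof -
  interpret M: module R M by fact
  note E = M.submoduleE[OF assms(1)]
  have z: "\<zero>\<^bsub>M\<^esub> \<in> H"
  proof -
    obtain x where "x \<in> H" using E(2) by blast
    then have "x \<oplus>\<^bsub>M\<^esub> \<ominus>\<^bsub>M\<^esub> x \<in> H" using E(3,5) by blast
    then show ?thesis using E(1) \<open>x \<in> H\<close> by (metis M.M.r_neg subsetD)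
  qed
  have s: "x \<in> carrier M" if "x \<in> H" for x using E(1) that by blast
  show ?thesis
  proof (rule moduleI)
    show "abelian_group (M\<lparr>carrier := H\<rparr>)"
    proof (rule abelian_groupI)
      fix x assume "x \<in> carrier (M\<lparr>carrier := H\<rparr>)"
      then show "\<exists>y\<in>carrier (M\<lparr>carrier := H\<rparr>). y \<oplus>\<^bsub>M\<lparr>carrier := H\<rparr>\<^esub> x = \<zero>\<^bsub>M\<lparr>carrier := H\<rparr>\<^esub>"
        using s E(3) M.M.l_neg by auto
    qed (use z s E in \<open>auto simp: M.M.a_ac\<close>)
  qed (use s E(4) in \<open>auto simp: M.smult_l_distr M.smult_r_distr M.smult_assoc1 intro: M.R.cring_axioms\<close>)
qed

lemma submodule_image:
  assumes "f \<in> mod_hom R M N" "module R M" "module R N"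
  shows "submodule (f ` carrier M) R N"
proof -
  interpret M: module R M by fact
  interpret N: module R N by fact
  note ag = M.M.abelian_group_axioms N.M.abelian_group_axioms
  show ?thesis
  proof (rule N.submoduleI)
    show "f ` carrier M \<subseteq> carrier N" using mod_hom_closed[OF assms(1)] by blast
    show "\<zero>\<^bsub>N\<^esub> \<in> f ` carrier M"
      using mod_hom_zero[OF assms(1) ag, symmetric] M.M.zero_closed by (rule image_eqI)
    fix a assume "a \<in> f ` carrier M"
    then obtain x where x: "x \<in> carrier M" "a = f x" by blast
    then have "\<ominus>\<^bsub>N\<^esub> a = f (\<ominus>\<^bsub>M\<^esub> x)" by (simp add: mod_hom_uminus[OF assms(1) ag])
    then show "\<ominus>\<^bsub>N\<^esub> a \<in> f ` carrier M" using x by blast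
    show "a \<oplus>\<^bsub>N\<^esub> b \<in> f ` carrier M" if "b \<in> f ` carrier M" for b
    proof -
      from that obtain y where y: "y \<in> carrier M" "b = f y" by blast
      then have "a \<oplus>\<^bsub>N\<^esub> b = f (x \<oplus>\<^bsub>M\<^esub> y)" using x by (simp add: mod_hom_add[OF assms(1)])
      then show ?thesis using x y by blast
    qed
    show "r \<odot>\<^bsub>N\<^esub> a \<in> f ` carrier M" if "r \<in> carrier R" for r
    proof -
      have "r \<odot>\<^bsub>N\<^esub> a = f (r \<odot>\<^bsub>M\<^esub> x)" using x that by (simp add: mod_hom_smult[OF assms(1)])
      then show ?thesis using x that by blast
    qed
  qed
qed

text \<open>
  Since \<open>f\<close> kills \<open>ker d\<close>, it factors over the submodule \<open>d(A)\<close> of \<open>B\<close>, and injectivity extends it from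
  there.  With \<open>d\<close> a differential, this is how chain maps and homotopies into complexes of injectives
  are built degree by degree.
\<close>

lemma injective_extend:
  fixes E :: "('r, 'u) module"
  assumes E: "injective_module R E"
    and A: "small_module R A" and B: "small_module R B"
    and d: "d \<in> mod_hom R A B" and f: "f \<in> mod_hom R A E"
    and ker: "\<And>x. x \<in> carrier A \<Longrightarrow> d x = \<zero>\<^bsub>B\<^esub> \<Longrightarrow> f x = \<zero>\<^bsub>E\<^esub>"
  obtains h where "h \<in> mod_hom R B E" "\<And>x. x \<in> carrier A \<Longrightarrow> h (d x) = f x"
proof -
  have mod: "module R A" "module R B" "module R E"
    using A B E by (auto simp: small_module_def injective_module_def)
  interpret A: module R A by fact
  interpret B: module R B by fact
  interpret E: module R E by fact
  note ag = A.M.abelian_group_axioms B.M.abelian_group_axioms E.M.abelian_group_axioms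
  define I where "I = B\<lparr>carrier := d ` carrier A\<rparr>"
  have modI: "small_module R I"
    unfolding small_module_def I_def
    using module_carrier_update[OF submodule_image[OF d mod(1,2)] mod(2)] A
    by (auto simp: small_module_def intro: lesspoll_trans1[OF image_lepoll])
  define f' where "f' = (\<lambda>y. f (SOME x. x \<in> carrier A \<and> d x = y))"
  have f': "f' (d x) = f x" if "x \<in> carrier A" for x
  proof -
    define x' where "x' = (SOME x'. x' \<in> carrier A \<and> d x' = d x)"
    have x': "x' \<in> carrier A" "d x' = d x"
      using someI[of "\<lambda>x'. x' \<in> carrier A \<and> d x' = d x" x] that unfolding x'_def by auto
    have "d (x' \<ominus>\<^bsub>A\<^esub> x) = \<zero>\<^bsub>B\<^esub>"
      using x' that d mod_hom_closed[OF d that]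
      by (simp add: mod_hom_minus[OF d ag(1,2)] B.M.minus_eq_zero_iff)
    then have "f (x' \<ominus>\<^bsub>A\<^esub> x) = \<zero>\<^bsub>E\<^esub>" using ker x' that by simp
    then have "f x' = f x"
      using x' that f by (simp add: mod_hom_minus[OF f ag(1,3)] E.M.minus_eq_zero_iff mod_hom_closed)
    then show ?thesis unfolding f'_def x'_def by simp
  qed
  have "f' \<in> mod_hom R I E"
  proof (rule mod_homI)
    fix x assume "x \<in> carrier I"
    then show "f' x \<in> carrier E" using f' f by (auto simp: I_def mod_hom_closed)
  next
    fix x y assume "x \<in> carrier I" "y \<in> carrier I"
    then obtain a b where ab: "a \<in> carrier A" "b \<in> carrier A" "x = d a" "y = d b"
      by (auto simp: I_def)
    have "f' (d (a \<oplus>\<^bsub>A\<^esub> b)) = f' x \<oplus>\<^bsub>E\<^esub> f' y"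
      using f' f ab by (simp add: mod_hom_add)
    then show "f' (x \<oplus>\<^bsub>I\<^esub> y) = f' x \<oplus>\<^bsub>E\<^esub> f' y"
      using ab d by (simp add: I_def mod_hom_add)
  next
    fix r x assume "r \<in> carrier R" "x \<in> carrier I"
    then obtain a where a: "a \<in> carrier A" "x = d a" "r \<in> carrier R" by (auto simp: I_def)
    have "f' (d (r \<odot>\<^bsub>A\<^esub> a)) = r \<odot>\<^bsub>E\<^esub> f' x"
      using f' f a by (simp add: mod_hom_smult)
    then show "f' (r \<odot>\<^bsub>I\<^esub> x) = r \<odot>\<^bsub>E\<^esub> f' x"
      using a d by (simp add: I_def mod_hom_smult)
  qed
  moreover have "(\<lambda>x. x) \<in> mod_hom R I B"
    using d by (auto intro!: mod_homI simp: I_def mod_hom_closed)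
  ultimately obtain g where g: "g \<in> mod_hom R B E" "\<forall>x\<in>carrier I. g x = f' x"
    using E modI B unfolding injective_module_def by fastforce
  show ?thesis
  proof (rule that[OF g(1)])
    fix x assume "x \<in> carrier A"
    then show "g (d x) = f x" using g(2) f' by (simp add: I_def)
  qed
qed


section \<open>Complexes, chain maps and homotopies\<close>

lemma complexesI:
  assumes "\<And>n. small_module R (obj X n)"
    and "\<And>n. diff X n \<in> mod_hom R (obj X n) (obj X (n + 1))"
    and "\<And>n x. x \<in> carrier (obj X n) \<Longrightarrow> diff X (n + 1) (diff X n x) = \<zero>\<^bsub>obj X (n + 2)\<^esub>"
  shows "X \<in> complexes R"
  using assms by (simp add: complexes_def)

lemma complexes_small_module: "X \<in> complexes R \<Longrightarrow> small_module R (obj X n)"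
  by (simp add: complexes_def)

lemma complexes_module: "X \<in> complexes R \<Longrightarrow> module R (obj X n)"
  by (simp add: complexes_def small_module_def)

lemma complexes_group: "X \<in> complexes R \<Longrightarrow> abelian_group (obj X n)"
  using complexes_module module_abelian_group by blast

lemma diff_hom: "X \<in> complexes R \<Longrightarrow> m = n + 1 \<Longrightarrow> diff X n \<in> mod_hom R (obj X n) (obj X m)"
  by (simp add: complexes_def)

lemma diff_closed [simp]:
  "X \<in> complexes R \<Longrightarrow> m = n + 1 \<Longrightarrow> x \<in> carrier (obj X n) \<Longrightarrow> diff X n x \<in> carrier (obj X m)"
  using diff_hom mod_hom_closed by metis

lemma diff_add:
  "X \<in> complexes R \<Longrightarrow> x \<in> carrier (obj X n) \<Longrightarrow> y \<in> carrier (obj X n) \<Longrightarrow>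
    diff X n (x \<oplus>\<^bsub>obj X n\<^esub> y) = diff X n x \<oplus>\<^bsub>obj X (n + 1)\<^esub> diff X n y"
  using diff_hom mod_hom_add by metis

lemma diff_uminus:
  "X \<in> complexes R \<Longrightarrow> x \<in> carrier (obj X n) \<Longrightarrow>
    diff X n (\<ominus>\<^bsub>obj X n\<^esub> x) = \<ominus>\<^bsub>obj X (n + 1)\<^esub> diff X n x"
  using diff_hom mod_hom_uminus complexes_group by metis

lemma diff_minus:
  "X \<in> complexes R \<Longrightarrow> x \<in> carrier (obj X n) \<Longrightarrow> y \<in> carrier (obj X n) \<Longrightarrow>
    diff X n (x \<ominus>\<^bsub>obj X n\<^esub> y) = diff X n x \<ominus>\<^bsub>obj X (n + 1)\<^esub> diff X n y"
  using diff_hom mod_hom_minus complexes_group by metis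

lemma diff_smult:
  "X \<in> complexes R \<Longrightarrow> a \<in> carrier R \<Longrightarrow> x \<in> carrier (obj X n) \<Longrightarrow>
    diff X n (a \<odot>\<^bsub>obj X n\<^esub> x) = a \<odot>\<^bsub>obj X (n + 1)\<^esub> diff X n x"
  using diff_hom mod_hom_smult by metis

lemma diff_zero:
  "X \<in> complexes R \<Longrightarrow> diff X n \<zero>\<^bsub>obj X n\<^esub> = \<zero>\<^bsub>obj X (n + 1)\<^esub>"
  using diff_hom mod_hom_zero complexes_group by metis

lemma diff_diff:
  "X \<in> complexes R \<Longrightarrow> m = n + 1 \<Longrightarrow> k = n + 2 \<Longrightarrow> x \<in> carrier (obj X n) \<Longrightarrow>
    diff X m (diff X n x) = \<zero>\<^bsub>obj X k\<^esub>"
  by (simp add: complexes_def)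

lemma zero_obj_closed [simp]: "X \<in> complexes R \<Longrightarrow> \<zero>\<^bsub>obj X n\<^esub> \<in> carrier (obj X n)"
  by (meson abelian_groupE(2) complexes_group)

lemma add_obj_closed [simp]:
  "X \<in> complexes R \<Longrightarrow> x \<in> carrier (obj X n) \<Longrightarrow> y \<in> carrier (obj X n) \<Longrightarrow>
    x \<oplus>\<^bsub>obj X n\<^esub> y \<in> carrier (obj X n)"
  by (meson abelian_groupE(1) complexes_group)

lemma uminus_obj_closed [simp]:
  "X \<in> complexes R \<Longrightarrow> x \<in> carrier (obj X n) \<Longrightarrow> \<ominus>\<^bsub>obj X n\<^esub> x \<in> carrier (obj X n)"
  by (meson abelian_group.a_inv_closed complexes_group)

lemma minus_obj_closed [simp]:
  "X \<in> complexes R \<Longrightarrow> x \<in> carrier (obj X n) \<Longrightarrow> y \<in> carrier (obj X n) \<Longrightarrow>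
    x \<ominus>\<^bsub>obj X n\<^esub> y \<in> carrier (obj X n)"
  by (simp add: a_minus_def)

lemma smult_obj_closed [simp]:
  "X \<in> complexes R \<Longrightarrow> a \<in> carrier R \<Longrightarrow> x \<in> carrier (obj X n) \<Longrightarrow>
    a \<odot>\<^bsub>obj X n\<^esub> x \<in> carrier (obj X n)"
  by (meson complexes_module module.smult_closed)

lemma chain_map_hom: "f \<in> chain_maps R X Y \<Longrightarrow> f n \<in> mod_hom R (obj X n) (obj Y n)"
  by (simp add: chain_maps_def)

lemma chain_map_closed [simp]:
  "f \<in> chain_maps R X Y \<Longrightarrow> x \<in> carrier (obj X n) \<Longrightarrow> f n x \<in> carrier (obj Y n)"
  by (meson chain_map_hom mod_hom_closed)

lemma chain_map_add:
  "f \<in> chain_maps R X Y \<Longrightarrow> x \<in> carrier (obj X n) \<Longrightarrow> y \<in> carrier (obj X n) \<Longrightarrow>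
    f n (x \<oplus>\<^bsub>obj X n\<^esub> y) = f n x \<oplus>\<^bsub>obj Y n\<^esub> f n y"
  by (meson chain_map_hom mod_hom_add)

lemma chain_map_smult:
  "f \<in> chain_maps R X Y \<Longrightarrow> a \<in> carrier R \<Longrightarrow> x \<in> carrier (obj X n) \<Longrightarrow>
    f n (a \<odot>\<^bsub>obj X n\<^esub> x) = a \<odot>\<^bsub>obj Y n\<^esub> f n x"
  by (meson chain_map_hom mod_hom_smult)

lemma chain_map_zero:
  "f \<in> chain_maps R X Y \<Longrightarrow> X \<in> complexes R \<Longrightarrow> Y \<in> complexes R \<Longrightarrow>
    f n \<zero>\<^bsub>obj X n\<^esub> = \<zero>\<^bsub>obj Y n\<^esub>"
  by (meson chain_map_hom mod_hom_zero complexes_group)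

lemma chain_map_uminus:
  "f \<in> chain_maps R X Y \<Longrightarrow> X \<in> complexes R \<Longrightarrow> Y \<in> complexes R \<Longrightarrow> x \<in> carrier (obj X n) \<Longrightarrow>
    f n (\<ominus>\<^bsub>obj X n\<^esub> x) = \<ominus>\<^bsub>obj Y n\<^esub> f n x"
  by (meson chain_map_hom mod_hom_uminus complexes_group)

lemma chain_map_minus:
  "f \<in> chain_maps R X Y \<Longrightarrow> X \<in> complexes R \<Longrightarrow> Y \<in> complexes R \<Longrightarrow> x \<in> carrier (obj X n) \<Longrightarrow>
    y \<in> carrier (obj X n) \<Longrightarrow> f n (x \<ominus>\<^bsub>obj X n\<^esub> y) = f n x \<ominus>\<^bsub>obj Y n\<^esub> f n y"
  by (meson chain_map_hom mod_hom_minus complexes_group)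

lemma chain_map_diff:
  "f \<in> chain_maps R X Y \<Longrightarrow> m = n + 1 \<Longrightarrow> x \<in> carrier (obj X n) \<Longrightarrow>
    f m (diff X n x) = diff Y n (f n x)"
  by (simp add: chain_maps_def)

lemma chain_mapsI:
  assumes "\<And>n. f n \<in> mod_hom R (obj X n) (obj Y n)"
    and "\<And>n x. x \<in> carrier (obj X n) \<Longrightarrow> f (n + 1) (diff X n x) = diff Y n (f n x)"
  shows "f \<in> chain_maps R X Y"
  using assms by (auto simp: chain_maps_def)

lemma chain_map_comp [simp]:
  assumes "f \<in> chain_maps R X Y" "g \<in> chain_maps R Y Z"
  shows "comp_map g f \<in> chain_maps R X Z"
  using assms
  by (intro chain_mapsI)
     (auto simp: comp_map_def chain_map_diff intro: mod_hom_comp chain_map_hom)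

lemma chain_map_id [simp]: "id_map \<in> chain_maps R X X"
  by (intro chain_mapsI) (auto simp: id_map_def mod_hom_id)

lemma chain_map_zero_map [simp]:
  "Y \<in> complexes R \<Longrightarrow> zero_map Y \<in> chain_maps R X Y"
  by (intro chain_mapsI) (auto simp: zero_map_def mod_hom_const_zero complexes_module diff_zero)

lemma comp_map_assoc: "comp_map h (comp_map g f) = comp_map (comp_map h g) f"
  by (simp add: comp_map_def)

lemma comp_id_map [simp]: "comp_map f id_map = f" "comp_map id_map f = f"
  by (simp_all add: comp_map_def id_map_def)

lemma comp_zero_map [simp]: "comp_map (zero_map Z) f = zero_map Z"
  by (simp add: comp_map_def zero_map_def)

text \<open>
  Moving \<open>g\<close> to the other side of the defining equation removes the subtraction, so that verifying a
  homotopy is rearranging a sum.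
\<close>

lemma homotopicI:
  assumes Y: "Y \<in> complexes R" and X: "X \<in> complexes R"
    and f: "f \<in> chain_maps R X Y" and g: "g \<in> chain_maps R X Y"
    and h: "\<And>n. h n \<in> mod_hom R (obj X n) (obj Y (n - 1))"
    and eq: "\<And>n x. x \<in> carrier (obj X n) \<Longrightarrow>
      f n x = (diff Y (n - 1) (h n x) \<oplus>\<^bsub>obj Y n\<^esub> h (n + 1) (diff X n x)) \<oplus>\<^bsub>obj Y n\<^esub> g n x"
  shows "homotopic R X Y f g"
  unfolding homotopic_def
proof (intro exI[of _ h] conjI allI ballI h)
  fix n x assume x: "x \<in> carrier (obj X n)"
  interpret Y: abelian_group "obj Y n" using Y by (rule complexes_group)
  have "h (n + 1) (diff X n x) \<in> carrier (obj Y n)"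
    using mod_hom_closed[OF h[of "n+1"], of "diff X n x"] X x by simp
  moreover have "diff Y (n - 1) (h n x) \<in> carrier (obj Y n)"
    using mod_hom_closed[OF h x] Y by auto
  ultimately show "f n x \<ominus>\<^bsub>obj Y n\<^esub> g n x =
             diff Y (n - 1) (h n x) \<oplus>\<^bsub>obj Y n\<^esub> h (n + 1) (diff X n x)"
    using x f g eq[OF x] by (subst Y.minus_eq_iff) auto
qed

lemma homotopicE:
  assumes "homotopic R X Y f g" and Y: "Y \<in> complexes R" and X: "X \<in> complexes R"
    and f: "f \<in> chain_maps R X Y" and g: "g \<in> chain_maps R X Y"
  obtains h where "\<And>n. h n \<in> mod_hom R (obj X n) (obj Y (n - 1))"
    and "\<And>n x. x \<in> carrier (obj X n) \<Longrightarrow> h n x \<in> carrier (obj Y (n - 1))"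
    and "\<And>n x. x \<in> carrier (obj X n) \<Longrightarrow> h (n + 1) (diff X n x) \<in> carrier (obj Y n)"
    and "\<And>n x. x \<in> carrier (obj X n) \<Longrightarrow>
      f n x = (diff Y (n - 1) (h n x) \<oplus>\<^bsub>obj Y n\<^esub> h (n + 1) (diff X n x)) \<oplus>\<^bsub>obj Y n\<^esub> g n x"
proof -
  obtain h where h: "\<And>n. h n \<in> mod_hom R (obj X n) (obj Y (n - 1))"
    and eq: "\<And>n x. x \<in> carrier (obj X n) \<Longrightarrow> f n x \<ominus>\<^bsub>obj Y n\<^esub> g n x =
             diff Y (n - 1) (h n x) \<oplus>\<^bsub>obj Y n\<^esub> h (n + 1) (diff X n x)"
    using assms(1) unfolding homotopic_def by blast
  have c: "h n x \<in> carrier (obj Y (n - 1))" if "x \<in> carrier (obj X n)" for n x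
    using mod_hom_closed[OF h that] .
  have c': "h (n + 1) (diff X n x) \<in> carrier (obj Y n)" if "x \<in> carrier (obj X n)" for n x
    using c[of "diff X n x" "n+1"] X that by simp
  show thesis
  proof (rule that[OF h c c'])
    fix n x assume x: "x \<in> carrier (obj X n)"
    interpret Y: abelian_group "obj Y n" using Y by (rule complexes_group)
    have "diff Y (n - 1) (h n x) \<in> carrier (obj Y n)"
      using c[OF x] Y by auto
    then show "f n x = (diff Y (n - 1) (h n x) \<oplus>\<^bsub>obj Y n\<^esub> h (n + 1) (diff X n x)) \<oplus>\<^bsub>obj Y n\<^esub> g n x"
      using eq[OF x] x f g c'[OF x] by (subst (asm) Y.minus_eq_iff) auto
  qed
qed

lemma homotopic_cong:
  assumes "homotopic R X Y f g" "\<And>n x. x \<in> carrier (obj X n) \<Longrightarrow> f n x = f' n x"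
    "\<And>n x. x \<in> carrier (obj X n) \<Longrightarrow> g n x = g' n x"
  shows "homotopic R X Y f' g'"
  using assms unfolding homotopic_def by simp

lemma homotopic_refl:
  assumes "X \<in> complexes R" "Y \<in> complexes R" "f \<in> chain_maps R X Y"
  shows "homotopic R X Y f f"
proof (rule homotopicI[where h = "\<lambda>n x. \<zero>\<^bsub>obj Y (n - 1)\<^esub>"])
  fix n x assume x: "x \<in> carrier (obj X n)"
  interpret Y: abelian_group "obj Y n" using assms by (auto intro: complexes_group)
  show "f n x = diff Y (n - 1) \<zero>\<^bsub>obj Y (n - 1)\<^esub> \<oplus>\<^bsub>obj Y n\<^esub> \<zero>\<^bsub>obj Y (n + 1 - 1)\<^esub> \<oplus>\<^bsub>obj Y n\<^esub> f n x"
    using assms x diff_zero[of Y R "n - 1"] by simp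
qed (use assms in \<open>auto intro: mod_hom_const_zero complexes_module\<close>)

lemma homotopic_sym:
  assumes "homotopic R X Y f g" "X \<in> complexes R" "Y \<in> complexes R"
    "f \<in> chain_maps R X Y" "g \<in> chain_maps R X Y"
  shows "homotopic R X Y g f"
proof -
  obtain h where h: "\<And>n. h n \<in> mod_hom R (obj X n) (obj Y (n - 1))"
    and c: "\<And>n x. x \<in> carrier (obj X n) \<Longrightarrow> h n x \<in> carrier (obj Y (n - 1))"
    and c': "\<And>n x. x \<in> carrier (obj X n) \<Longrightarrow> h (n + 1) (diff X n x) \<in> carrier (obj Y n)"
    and eq: "\<And>n x. x \<in> carrier (obj X n) \<Longrightarrow>
      f n x = (diff Y (n - 1) (h n x) \<oplus>\<^bsub>obj Y n\<^esub> h (n + 1) (diff X n x)) \<oplus>\<^bsub>obj Y n\<^esub> g n x"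
    using homotopicE[OF assms(1,3,2,4,5)] by blast
  show ?thesis
  proof (rule homotopicI[where h = "\<lambda>n x. \<ominus>\<^bsub>obj Y (n - 1)\<^esub> h n x"])
    fix n x assume x: "x \<in> carrier (obj X n)"
    interpret Y: abelian_group "obj Y n" using assms by (auto intro: complexes_group)
    have d: "diff Y (n - 1) (h n x) \<in> carrier (obj Y n)" using c[OF x] assms by auto
    have g: "g n x \<in> carrier (obj Y n)" using assms x by auto
    have "g n x = (\<ominus>\<^bsub>obj Y n\<^esub> diff Y (n - 1) (h n x) \<oplus>\<^bsub>obj Y n\<^esub> \<ominus>\<^bsub>obj Y n\<^esub> h (n + 1) (diff X n x)) \<oplus>\<^bsub>obj Y n\<^esub> f n x"
      unfolding eq[OF x] using d g c'[OF x] by algebra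
    then show "g n x = (diff Y (n - 1) (\<ominus>\<^bsub>obj Y (n - 1)\<^esub> h n x) \<oplus>\<^bsub>obj Y n\<^esub> \<ominus>\<^bsub>obj Y (n + 1 - 1)\<^esub> h (n + 1) (diff X n x)) \<oplus>\<^bsub>obj Y n\<^esub> f n x"
      using diff_uminus[OF assms(3) c[OF x]] by simp
  qed (use assms h in \<open>auto intro: mod_hom_neg complexes_module\<close>)
qed

lemma homotopic_trans:
  assumes "homotopic R X Y f g" "homotopic R X Y g e" "X \<in> complexes R" "Y \<in> complexes R"
    "f \<in> chain_maps R X Y" "g \<in> chain_maps R X Y" "e \<in> chain_maps R X Y"
  shows "homotopic R X Y f e"
proof -
  obtain h where h: "\<And>n. h n \<in> mod_hom R (obj X n) (obj Y (n - 1))"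
    and c: "\<And>n x. x \<in> carrier (obj X n) \<Longrightarrow> h n x \<in> carrier (obj Y (n - 1))"
    and c': "\<And>n x. x \<in> carrier (obj X n) \<Longrightarrow> h (n + 1) (diff X n x) \<in> carrier (obj Y n)"
    and eq: "\<And>n x. x \<in> carrier (obj X n) \<Longrightarrow>
      f n x = (diff Y (n - 1) (h n x) \<oplus>\<^bsub>obj Y n\<^esub> h (n + 1) (diff X n x)) \<oplus>\<^bsub>obj Y n\<^esub> g n x"
    using homotopicE[OF assms(1,4,3,5,6)] by blast
  obtain k where k: "\<And>n. k n \<in> mod_hom R (obj X n) (obj Y (n - 1))"
    and kc: "\<And>n x. x \<in> carrier (obj X n) \<Longrightarrow> k n x \<in> carrier (obj Y (n - 1))"
    and kc': "\<And>n x. x \<in> carrier (obj X n) \<Longrightarrow> k (n + 1) (diff X n x) \<in> carrier (obj Y n)"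
    and keq: "\<And>n x. x \<in> carrier (obj X n) \<Longrightarrow>
      g n x = (diff Y (n - 1) (k n x) \<oplus>\<^bsub>obj Y n\<^esub> k (n + 1) (diff X n x)) \<oplus>\<^bsub>obj Y n\<^esub> e n x"
    using homotopicE[OF assms(2,4,3,6,7)] by blast
  show ?thesis
  proof (rule homotopicI[where h = "\<lambda>n x. h n x \<oplus>\<^bsub>obj Y (n - 1)\<^esub> k n x"])
    fix n x assume x: "x \<in> carrier (obj X n)"
    interpret Y: abelian_group "obj Y n" using assms by (auto intro: complexes_group)
    have d: "diff Y (n - 1) (h n x) \<in> carrier (obj Y n)" "diff Y (n - 1) (k n x) \<in> carrier (obj Y n)"
      using c[OF x] kc[OF x] assms by auto
    have e: "e n x \<in> carrier (obj Y n)" using assms x by auto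
    show "f n x = (diff Y (n - 1) (h n x \<oplus>\<^bsub>obj Y (n - 1)\<^esub> k n x) \<oplus>\<^bsub>obj Y n\<^esub>
        (h (n + 1) (diff X n x) \<oplus>\<^bsub>obj Y (n + 1 - 1)\<^esub> k (n + 1) (diff X n x))) \<oplus>\<^bsub>obj Y n\<^esub> e n x"
      unfolding eq[OF x] keq[OF x]
      using diff_add[OF assms(4) c[OF x] kc[OF x]] d e c'[OF x] kc'[OF x] by (simp add: Y.a_ac)
  qed (use assms h k in \<open>auto intro: mod_hom_plus complexes_module\<close>)
qed

lemma homotopic_comp_left:
  assumes "homotopic R X Y f g" "X \<in> complexes R" "Y \<in> complexes R" "Z \<in> complexes R"
    "f \<in> chain_maps R X Y" "g \<in> chain_maps R X Y" and e: "e \<in> chain_maps R Y Z"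
  shows "homotopic R X Z (comp_map e f) (comp_map e g)"
proof -
  obtain h where h: "\<And>n. h n \<in> mod_hom R (obj X n) (obj Y (n - 1))"
    and c: "\<And>n x. x \<in> carrier (obj X n) \<Longrightarrow> h n x \<in> carrier (obj Y (n - 1))"
    and c': "\<And>n x. x \<in> carrier (obj X n) \<Longrightarrow> h (n + 1) (diff X n x) \<in> carrier (obj Y n)"
    and eq: "\<And>n x. x \<in> carrier (obj X n) \<Longrightarrow>
      f n x = (diff Y (n - 1) (h n x) \<oplus>\<^bsub>obj Y n\<^esub> h (n + 1) (diff X n x)) \<oplus>\<^bsub>obj Y n\<^esub> g n x"
    using homotopicE[OF assms(1,3,2,5,6)] by blast
  show ?thesis
  proof (rule homotopicI[where h = "\<lambda>n x. e (n - 1) (h n x)"])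
    fix n x assume x: "x \<in> carrier (obj X n)"
    have d: "diff Y (n - 1) (h n x) \<in> carrier (obj Y n)" using c[OF x] assms by auto
    have g: "g n x \<in> carrier (obj Y n)" using assms x by auto
    show "comp_map e f n x = (diff Z (n - 1) (e (n - 1) (h n x)) \<oplus>\<^bsub>obj Z n\<^esub>
        e (n + 1 - 1) (h (n + 1) (diff X n x))) \<oplus>\<^bsub>obj Z n\<^esub> comp_map e g n x"
      unfolding comp_map_def eq[OF x]
      using d g c'[OF x] assms(3) chain_map_diff[OF e _ c[OF x], of n]
      by (simp add: chain_map_add[OF e])
  qed (use assms in \<open>auto intro: mod_hom_comp[OF h chain_map_hom[OF e]]\<close>)
qed

lemma homotopic_comp_right:
  assumes "homotopic R X Y f g" "X \<in> complexes R" "Y \<in> complexes R" "W \<in> complexes R"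
    "f \<in> chain_maps R X Y" "g \<in> chain_maps R X Y" and e: "e \<in> chain_maps R W X"
  shows "homotopic R W Y (comp_map f e) (comp_map g e)"
proof -
  obtain h where h: "\<And>n. h n \<in> mod_hom R (obj X n) (obj Y (n - 1))"
    and "\<And>n x. x \<in> carrier (obj X n) \<Longrightarrow> h n x \<in> carrier (obj Y (n - 1))"
    and "\<And>n x. x \<in> carrier (obj X n) \<Longrightarrow> h (n + 1) (diff X n x) \<in> carrier (obj Y n)"
    and eq: "\<And>n x. x \<in> carrier (obj X n) \<Longrightarrow>
      f n x = (diff Y (n - 1) (h n x) \<oplus>\<^bsub>obj Y n\<^esub> h (n + 1) (diff X n x)) \<oplus>\<^bsub>obj Y n\<^esub> g n x"
    using homotopicE[OF assms(1,3,2,5,6)] by blast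
  show ?thesis
  proof (rule homotopicI[where h = "\<lambda>n x. h n (e n x)"])
    fix n x assume x: "x \<in> carrier (obj W n)"
    show "comp_map f e n x = (diff Y (n - 1) (h n (e n x)) \<oplus>\<^bsub>obj Y n\<^esub>
        h (n + 1) (e (n + 1) (diff W n x))) \<oplus>\<^bsub>obj Y n\<^esub> comp_map g e n x"
      unfolding comp_map_def eq[OF chain_map_closed[OF e x]] chain_map_diff[OF e refl x] ..
    next
    fix n show "(\<lambda>x. h n (e n x)) \<in> mod_hom R (obj W n) (obj Y (n - 1))"
      by (rule mod_hom_comp[OF chain_map_hom[OF e] h])
  next
    show "comp_map f e \<in> chain_maps R W Y" "comp_map g e \<in> chain_maps R W Y"
      by (rule chain_map_comp[OF e assms(5)], rule chain_map_comp[OF e assms(6)])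
  qed (use assms in simp_all)
qed


section \<open>Cohomology\<close>

lemma cocyclesI: "x \<in> carrier (obj X n) \<Longrightarrow> diff X n x = \<zero>\<^bsub>obj X (n + 1)\<^esub> \<Longrightarrow> x \<in> cocycles X n"
  by (simp add: cocycles_def)

lemma cocycles_closed [simp]: "z \<in> cocycles X n \<Longrightarrow> z \<in> carrier (obj X n)"
  by (simp add: cocycles_def)

lemma cocycles_diff: "z \<in> cocycles X n \<Longrightarrow> diff X n z = \<zero>\<^bsub>obj X (n + 1)\<^esub>"
  unfolding cocycles_def by blast

lemma coboundariesI: "w \<in> carrier (obj X m) \<Longrightarrow> n = m + 1 \<Longrightarrow> diff X m w \<in> coboundaries X n"
  by (auto simp: coboundaries_def)

lemma coboundariesE:
  assumes "b \<in> coboundaries X n" "n = m + 1"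
  obtains w where "w \<in> carrier (obj X m)" "b = diff X m w"
  using assms by (auto simp: coboundaries_def)

lemma coboundaries_cocycles: "X \<in> complexes R \<Longrightarrow> b \<in> coboundaries X n \<Longrightarrow> b \<in> cocycles X n"
  by (auto simp: coboundaries_def intro!: cocyclesI diff_diff)

lemma coboundaries_closed: "X \<in> complexes R \<Longrightarrow> b \<in> coboundaries X n \<Longrightarrow> b \<in> carrier (obj X n)"
  by (rule cocycles_closed[OF coboundaries_cocycles])

context
  fixes R :: "'r ring" and X :: "('r, 'u) cochain"
  assumes X: "X \<in> complexes R"
begin

lemma cocycles_add: "x \<in> cocycles X n \<Longrightarrow> y \<in> cocycles X n \<Longrightarrow> x \<oplus>\<^bsub>obj X n\<^esub> y \<in> cocycles X n"
  using X complexes_group[OF X, of "n + 1"]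
  by (auto intro!: cocyclesI simp: diff_add cocycles_diff abelian_groupE(5))

lemma cocycles_uminus: "x \<in> cocycles X n \<Longrightarrow> \<ominus>\<^bsub>obj X n\<^esub> x \<in> cocycles X n"
proof -
  assume x: "x \<in> cocycles X n"
  interpret abelian_group "obj X (n + 1)" using X by (rule complexes_group)
  show ?thesis using X x by (auto intro!: cocyclesI simp: diff_uminus cocycles_diff)
qed

lemma cocycles_minus: "x \<in> cocycles X n \<Longrightarrow> y \<in> cocycles X n \<Longrightarrow> x \<ominus>\<^bsub>obj X n\<^esub> y \<in> cocycles X n"
  by (simp add: a_minus_def cocycles_add cocycles_uminus)

lemma cocycles_smult:
  assumes "a \<in> carrier R" "x \<in> cocycles X n" shows "a \<odot>\<^bsub>obj X n\<^esub> x \<in> cocycles X n"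
proof -
  interpret module R "obj X (n + 1)" using X by (rule complexes_module)
  show ?thesis using X assms by (auto intro!: cocyclesI simp: diff_smult cocycles_diff)
qed

lemma coboundaries_zero: "\<zero>\<^bsub>obj X n\<^esub> \<in> coboundaries X n"
  using coboundariesI[of "\<zero>\<^bsub>obj X (n - 1)\<^esub>" X "n - 1" n] X diff_zero[OF X, of "n - 1"] by simp

lemma coboundaries_add:
  assumes "x \<in> coboundaries X n" "y \<in> coboundaries X n"
  shows "x \<oplus>\<^bsub>obj X n\<^esub> y \<in> coboundaries X n"
proof -
  have n: "n = n - 1 + 1" by simp
  obtain a b where "a \<in> carrier (obj X (n - 1))" "x = diff X (n - 1) a"
    "b \<in> carrier (obj X (n - 1))" "y = diff X (n - 1) b"
    using coboundariesE[OF assms(1) n] coboundariesE[OF assms(2) n] by metis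
  then show ?thesis
    using coboundariesI[of "a \<oplus>\<^bsub>obj X (n - 1)\<^esub> b" X "n - 1" n] X diff_add[OF X, of a "n - 1" b] by simp
qed

lemma coboundaries_smult:
  assumes "r \<in> carrier R" "x \<in> coboundaries X n"
  shows "r \<odot>\<^bsub>obj X n\<^esub> x \<in> coboundaries X n"
proof -
  have n: "n = n - 1 + 1" by simp
  obtain a where "a \<in> carrier (obj X (n - 1))" "x = diff X (n - 1) a"
    using coboundariesE[OF assms(2) n] by metis
  then show ?thesis
    using coboundariesI[of "r \<odot>\<^bsub>obj X (n - 1)\<^esub> a" X "n - 1" n] X assms diff_smult[OF X, of r a "n - 1"]
    by simp
qed

lemma coboundaries_uminus:
  assumes "x \<in> coboundaries X n"
  shows "\<ominus>\<^bsub>obj X n\<^esub> x \<in> coboundaries X n"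
proof -
  have n: "n = n - 1 + 1" by simp
  obtain a where "a \<in> carrier (obj X (n - 1))" "x = diff X (n - 1) a"
    using coboundariesE[OF assms n] by metis
  then show ?thesis
    using coboundariesI[of "\<ominus>\<^bsub>obj X (n - 1)\<^esub> a" X "n - 1" n] X assms diff_uminus[OF X, of a "n - 1"]
    by simp
qed

lemma coboundaries_minus:
  "x \<in> coboundaries X n \<Longrightarrow> y \<in> coboundaries X n \<Longrightarrow> x \<ominus>\<^bsub>obj X n\<^esub> y \<in> coboundaries X n"
  by (simp add: a_minus_def coboundaries_add coboundaries_uminus)

end

lemma chain_map_cocycles:
  assumes "f \<in> chain_maps R X Y" "X \<in> complexes R" "Y \<in> complexes R" "z \<in> cocycles X n"
  shows "f n z \<in> cocycles Y n"
proof (rule cocyclesI)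
  have "diff Y n (f n z) = f (n + 1) (diff X n z)"
    using assms by (simp add: chain_map_diff)
  then show "diff Y n (f n z) = \<zero>\<^bsub>obj Y (n + 1)\<^esub>"
    using assms by (simp add: cocycles_diff chain_map_zero[OF assms(1-3)])
qed (use assms in auto)

lemma chain_map_coboundaries:
  assumes "f \<in> chain_maps R X Y" "b \<in> coboundaries X n"
  shows "f n b \<in> coboundaries Y n"
proof -
  have n: "n = n - 1 + 1" by simp
  obtain w where w: "w \<in> carrier (obj X (n - 1))" "b = diff X (n - 1) w"
    using coboundariesE[OF assms(2) n] by metis
  then have "f n b = diff Y (n - 1) (f (n - 1) w)" using chain_map_diff[OF assms(1) n w(1)] by simp
  then show ?thesis using coboundariesI[of "f (n - 1) w" Y "n - 1" n] w assms(1) by auto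
qed

text \<open>
  Injectivity and surjectivity on cohomology, expressed with representatives.  They are kept apart
  because in a composite that is bijective on cohomology each factor inherits one of the two.
\<close>

definition coh_inj :: "('r, 'u) cochain \<Rightarrow> ('r, 'u) cochain \<Rightarrow> (int \<Rightarrow> 'u \<Rightarrow> 'u) \<Rightarrow> bool" where
  "coh_inj X Y f \<longleftrightarrow> (\<forall>n. \<forall>z\<in>cocycles X n. f n z \<in> coboundaries Y n \<longrightarrow> z \<in> coboundaries X n)"

definition coh_surj :: "('r, 'u) cochain \<Rightarrow> ('r, 'u) cochain \<Rightarrow> (int \<Rightarrow> 'u \<Rightarrow> 'u) \<Rightarrow> bool" where
  "coh_surj X Y f \<longleftrightarrow>
     (\<forall>n. \<forall>y\<in>cocycles Y n. \<exists>z\<in>cocycles X n. y \<ominus>\<^bsub>obj Y n\<^esub> f n z \<in> coboundaries Y n)"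

lemma (in abelian_group) coset_eq_iff:
  assumes B: "B \<subseteq> carrier G" "\<zero> \<in> B" "\<And>x y. x \<in> B \<Longrightarrow> y \<in> B \<Longrightarrow> x \<oplus> y \<in> B"
      "\<And>x. x \<in> B \<Longrightarrow> \<ominus> x \<in> B"
    and z: "z \<in> carrier G" "z' \<in> carrier G"
  shows "B +> z = B +> z' \<longleftrightarrow> z \<ominus> z' \<in> B"
proof
  assume "B +> z = B +> z'"
  moreover have "\<zero> \<oplus> z \<in> B +> z" using B(2) by (auto simp: a_r_coset_def')
  ultimately obtain b where b: "b \<in> B" "z = b \<oplus> z'" using z by (auto simp: a_r_coset_def')
  then have "z \<ominus> z' = b" using z B(1) by (subst minus_eq_iff) auto
  then show "z \<ominus> z' \<in> B" using b by simp
next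
  have sub: "B +> x \<subseteq> B +> y" if "x \<ominus> y \<in> B" "x \<in> carrier G" "y \<in> carrier G" for x y
  proof
    fix c assume "c \<in> B +> x"
    then obtain b where b: "b \<in> B" "c = b \<oplus> x" by (auto simp: a_r_coset_def')
    have bc: "b \<in> carrier G" using b B by auto
    have "c = (b \<oplus> (x \<ominus> y)) \<oplus> y"
      unfolding b(2) using that(2,3) bc by algebra
    then show "c \<in> B +> y" using B(3)[OF b(1) that(1)] by (auto simp: a_r_coset_def')
  qed
  assume *: "z \<ominus> z' \<in> B"
  have "z' \<ominus> z = \<ominus> (z \<ominus> z')" using z by algebra
  then have "z' \<ominus> z \<in> B" using B(4)[OF *] by simp
  then show "B +> z = B +> z'" using sub * z by blast
qed

lemma cohomology_coset_eq:
  assumes X: "X \<in> complexes R" and "z \<in> carrier (obj X n)" "z' \<in> carrier (obj X n)"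
  shows "coboundaries X n +>\<^bsub>obj X n\<^esub> z = coboundaries X n +>\<^bsub>obj X n\<^esub> z' \<longleftrightarrow>
    z \<ominus>\<^bsub>obj X n\<^esub> z' \<in> coboundaries X n"
  using X assms(2,3) coboundaries_closed[OF X]
  by (intro abelian_group.coset_eq_iff[OF complexes_group[OF X]])
     (auto intro: coboundaries_zero coboundaries_add coboundaries_uminus)

lemma cohomology_map_coset:
  assumes X: "X \<in> complexes R" and Y: "Y \<in> complexes R" and f: "f \<in> chain_maps R X Y"
    and z: "z \<in> cocycles X n"
  shows "coboundaries Y n <+>\<^bsub>obj Y n\<^esub> (f n ` (coboundaries X n +>\<^bsub>obj X n\<^esub> z))
    = coboundaries Y n +>\<^bsub>obj Y n\<^esub> f n z"
proof -
  interpret Y: abelian_group "obj Y n" using Y by (rule complexes_group)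
  have fz: "f n z \<in> carrier (obj Y n)" using f z by auto
  have add: "f n (b \<oplus>\<^bsub>obj X n\<^esub> z) = f n b \<oplus>\<^bsub>obj Y n\<^esub> f n z" if "b \<in> coboundaries X n" for b
    using that z coboundaries_closed[OF X that] by (simp add: chain_map_add[OF f])
  show ?thesis
  proof (intro equalityI subsetI)
    fix y assume "y \<in> coboundaries Y n <+>\<^bsub>obj Y n\<^esub> (f n ` (coboundaries X n +>\<^bsub>obj X n\<^esub> z))"
    then obtain c b where cb: "c \<in> coboundaries Y n" "b \<in> coboundaries X n"
      "y = c \<oplus>\<^bsub>obj Y n\<^esub> f n (b \<oplus>\<^bsub>obj X n\<^esub> z)"
      by (auto simp: set_add_def' a_r_coset_def')
    then have "y = (c \<oplus>\<^bsub>obj Y n\<^esub> f n b) \<oplus>\<^bsub>obj Y n\<^esub> f n z"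
      using fz coboundaries_closed[OF Y] chain_map_coboundaries[OF f cb(2)]
      by (simp add: add Y.a_assoc)
    then show "y \<in> coboundaries Y n +>\<^bsub>obj Y n\<^esub> f n z"
      using coboundaries_add[OF Y cb(1) chain_map_coboundaries[OF f cb(2)]] by (auto simp: a_r_coset_def')
  next
    fix y assume "y \<in> coboundaries Y n +>\<^bsub>obj Y n\<^esub> f n z"
    then obtain c where c: "c \<in> coboundaries Y n" "y = c \<oplus>\<^bsub>obj Y n\<^esub> f n z"
      by (auto simp: a_r_coset_def')
    interpret X: abelian_group "obj X n" using X by (rule complexes_group)
    have "z = \<zero>\<^bsub>obj X n\<^esub> \<oplus>\<^bsub>obj X n\<^esub> z" using z by simp
    then have "z \<in> coboundaries X n +>\<^bsub>obj X n\<^esub> z"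
      unfolding a_r_coset_def' using coboundaries_zero[OF X, of n] by blast
    then show "y \<in> coboundaries Y n <+>\<^bsub>obj Y n\<^esub> (f n ` (coboundaries X n +>\<^bsub>obj X n\<^esub> z))"
      unfolding set_add_def' using c by blast
  qed
qed

text \<open>
  The coset \<open>B(X) + z\<close> goes to \<open>B(Y) + f z\<close>, and two cosets agree iff their representatives differ by
  a coboundary.  So bijectivity on cosets translates into the two conditions on representatives.
\<close>

lemma quasi_iso_iff:
  assumes X: "X \<in> complexes R" and Y: "Y \<in> complexes R"
  shows "quasi_iso R X Y f \<longleftrightarrow> f \<in> chain_maps R X Y \<and> coh_inj X Y f \<and> coh_surj X Y f"
proof (cases "f \<in> chain_maps R X Y")
  case f: True
  let ?F = "\<lambda>n c. coboundaries Y n <+>\<^bsub>obj Y n\<^esub> (f n ` c)"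
  let ?cX = "\<lambda>n z. coboundaries X n +>\<^bsub>obj X n\<^esub> z" and ?cY = "\<lambda>n z. coboundaries Y n +>\<^bsub>obj Y n\<^esub> z"
  note F = cohomology_map_coset[OF X Y f]
  have fz: "f n z \<in> cocycles Y n" if "z \<in> cocycles X n" for n z
    using chain_map_cocycles[OF f X Y that] .
  have "inj_on (?F n) (cohomology X n) \<longleftrightarrow>
      (\<forall>z\<in>cocycles X n. f n z \<in> coboundaries Y n \<longrightarrow> z \<in> coboundaries X n)" for n
  proof -
    interpret X: abelian_group "obj X n" using X by (rule complexes_group)
    interpret Y: abelian_group "obj Y n" using Y by (rule complexes_group)
    have "inj_on (?F n) (cohomology X n) \<longleftrightarrow>
       (\<forall>z\<in>cocycles X n. \<forall>z'\<in>cocycles X n. ?cY n (f n z) = ?cY n (f n z') \<longrightarrow> ?cX n z = ?cX n z')"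
      unfolding inj_on_def cohomology_def by (simp add: F)
    also have "\<dots> \<longleftrightarrow> (\<forall>z\<in>cocycles X n. \<forall>z'\<in>cocycles X n.
       f n (z \<ominus>\<^bsub>obj X n\<^esub> z') \<in> coboundaries Y n \<longrightarrow> z \<ominus>\<^bsub>obj X n\<^esub> z' \<in> coboundaries X n)"
      using f by (simp add: cohomology_coset_eq[OF X] cohomology_coset_eq[OF Y] chain_map_closed
          chain_map_minus[OF f X Y])
    also have "\<dots> \<longleftrightarrow> (\<forall>z\<in>cocycles X n. f n z \<in> coboundaries Y n \<longrightarrow> z \<in> coboundaries X n)"
    proof (intro iffI ballI impI)
      fix z assume *: "\<forall>z\<in>cocycles X n. \<forall>z'\<in>cocycles X n.
        f n (z \<ominus>\<^bsub>obj X n\<^esub> z') \<in> coboundaries Y n \<longrightarrow> z \<ominus>\<^bsub>obj X n\<^esub> z' \<in> coboundaries X n"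
        and z: "z \<in> cocycles X n" "f n z \<in> coboundaries Y n"
      have "z \<ominus>\<^bsub>obj X n\<^esub> \<zero>\<^bsub>obj X n\<^esub> = z" using z by (simp add: X.minus_eq)
      then show "z \<in> coboundaries X n"
        using *[rule_format, OF z(1) coboundaries_cocycles[OF X coboundaries_zero[OF X]]] z(2) by simp
    qed (auto intro: cocycles_minus[OF X])
    finally show ?thesis .
  qed
  then have inj: "(\<forall>n. inj_on (?F n) (cohomology X n)) \<longleftrightarrow> coh_inj X Y f"
    by (simp add: coh_inj_def)
  have "?F n ` cohomology X n = cohomology Y n \<longleftrightarrow>
      (\<forall>y\<in>cocycles Y n. \<exists>z\<in>cocycles X n. y \<ominus>\<^bsub>obj Y n\<^esub> f n z \<in> coboundaries Y n)" for n
  proof -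
    have im: "?F n ` cohomology X n = (\<lambda>z. ?cY n (f n z)) ` cocycles X n"
      unfolding cohomology_def image_image by (rule image_cong) (simp_all add: F)
    have "?F n ` cohomology X n = cohomology Y n \<longleftrightarrow>
       (\<forall>y\<in>cocycles Y n. \<exists>z\<in>cocycles X n. ?cY n y = ?cY n (f n z))"
    proof
      assume "?F n ` cohomology X n = cohomology Y n"
      then have "?cY n y \<in> (\<lambda>z. ?cY n (f n z)) ` cocycles X n" if "y \<in> cocycles Y n" for y
        using that unfolding im unfolding cohomology_def by blast
      then show "\<forall>y\<in>cocycles Y n. \<exists>z\<in>cocycles X n. ?cY n y = ?cY n (f n z)" by blast
    next
      assume "\<forall>y\<in>cocycles Y n. \<exists>z\<in>cocycles X n. ?cY n y = ?cY n (f n z)"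
      then show "?F n ` cohomology X n = cohomology Y n"
        unfolding im unfolding cohomology_def using fz by blast
    qed
    also have "\<dots> \<longleftrightarrow> (\<forall>y\<in>cocycles Y n. \<exists>z\<in>cocycles X n. y \<ominus>\<^bsub>obj Y n\<^esub> f n z \<in> coboundaries Y n)"
      using f by (simp add: cohomology_coset_eq[OF Y] chain_map_closed)
    finally show ?thesis .
  qed
  then have surj: "(\<forall>n. ?F n ` cohomology X n = cohomology Y n) \<longleftrightarrow> coh_surj X Y f"
    by (simp add: coh_surj_def)
  show ?thesis
    unfolding quasi_iso_def bij_betw_def using f inj surj by blast
qed (simp add: quasi_iso_def)

lemma quasi_iso_chain_map: "quasi_iso R X Y f \<Longrightarrow> f \<in> chain_maps R X Y"
  by (simp add: quasi_iso_def)

lemma coh_inj_comp: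
  assumes "coh_inj X Y f" "coh_inj Y Z g" "f \<in> chain_maps R X Y" "X \<in> complexes R" "Y \<in> complexes R"
  shows "coh_inj X Z (comp_map g f)"
  using assms chain_map_cocycles[OF assms(3-5)] unfolding coh_inj_def comp_map_def by blast

lemma coh_inj_cancel:
  assumes "coh_inj X Z (comp_map g f)" "g \<in> chain_maps R Y Z"
  shows "coh_inj X Y f"
  using assms chain_map_coboundaries[OF assms(2)] unfolding coh_inj_def comp_map_def by blast

lemma coh_surj_comp:
  assumes "coh_surj X Y f" "coh_surj Y Z g" "f \<in> chain_maps R X Y" "g \<in> chain_maps R Y Z"
    "X \<in> complexes R" "Y \<in> complexes R" "Z \<in> complexes R"
  shows "coh_surj X Z (comp_map g f)"
  unfolding coh_surj_def
proof (intro allI ballI)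
  fix n z assume z: "z \<in> cocycles Z n"
  interpret Z: abelian_group "obj Z n" using assms by (auto intro: complexes_group)
  obtain y where y: "y \<in> cocycles Y n" "z \<ominus>\<^bsub>obj Z n\<^esub> g n y \<in> coboundaries Z n"
    using assms(2) z unfolding coh_surj_def by blast
  obtain x where x: "x \<in> cocycles X n" "y \<ominus>\<^bsub>obj Y n\<^esub> f n x \<in> coboundaries Y n"
    using assms(1) y unfolding coh_surj_def by blast
  have c: "f n x \<in> carrier (obj Y n)" "g n y \<in> carrier (obj Z n)" "g n (f n x) \<in> carrier (obj Z n)"
    using assms x y by (auto intro!: chain_map_closed)
  have "z \<ominus>\<^bsub>obj Z n\<^esub> g n (f n x) =
      (z \<ominus>\<^bsub>obj Z n\<^esub> g n y) \<oplus>\<^bsub>obj Z n\<^esub> (g n y \<ominus>\<^bsub>obj Z n\<^esub> g n (f n x))"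
    using c cocycles_closed[OF z] by algebra
  moreover have "g n y \<ominus>\<^bsub>obj Z n\<^esub> g n (f n x) \<in> coboundaries Z n"
    using chain_map_coboundaries[OF assms(4) x(2)] c y by (simp add: chain_map_minus[OF assms(4,6,7)])
  ultimately have "z \<ominus>\<^bsub>obj Z n\<^esub> g n (f n x) \<in> coboundaries Z n"
    using y coboundaries_add[OF assms(7)] by simp
  then show "\<exists>x\<in>cocycles X n. z \<ominus>\<^bsub>obj Z n\<^esub> comp_map g f n x \<in> coboundaries Z n"
    using x by (auto simp: comp_map_def)
qed

lemma coh_surj_cancel:
  assumes "coh_surj X Z (comp_map g f)" "f \<in> chain_maps R X Y" "X \<in> complexes R" "Y \<in> complexes R"
  shows "coh_surj Y Z g"
  using assms chain_map_cocycles[OF assms(2-4)] unfolding coh_surj_def comp_map_def by blast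

lemma homotopic_cocycles:
  assumes "homotopic R X Y f g" "X \<in> complexes R" "Y \<in> complexes R" "z \<in> cocycles X n"
    "f \<in> chain_maps R X Y" "g \<in> chain_maps R X Y"
  shows "f n z \<ominus>\<^bsub>obj Y n\<^esub> g n z \<in> coboundaries Y n"
proof -
  obtain h where h: "\<And>n. h n \<in> mod_hom R (obj X n) (obj Y (n - 1))"
    and eq: "\<And>n x. x \<in> carrier (obj X n) \<Longrightarrow> f n x \<ominus>\<^bsub>obj Y n\<^esub> g n x =
             diff Y (n - 1) (h n x) \<oplus>\<^bsub>obj Y n\<^esub> h (n + 1) (diff X n x)"
    using assms(1) unfolding homotopic_def by blast
  interpret Y: abelian_group "obj Y n" using assms by (auto intro: complexes_group)
  have c: "h n z \<in> carrier (obj Y (n - 1))" using mod_hom_closed[OF h] assms(4) by simp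
  have "h (n + 1) (diff X n z) = \<zero>\<^bsub>obj Y n\<^esub>"
    using mod_hom_zero[OF h complexes_group complexes_group, OF assms(2,3), of "n + 1"] assms(4)
    by (simp add: cocycles_diff)
  then have "f n z \<ominus>\<^bsub>obj Y n\<^esub> g n z = diff Y (n - 1) (h n z)"
    using eq[of z n] assms(3,4) c by simp
  then show ?thesis using coboundariesI[OF c, of n] by simp
qed

lemma homotopic_coboundaries_iff:
  assumes "homotopic R X Y f g" "X \<in> complexes R" "Y \<in> complexes R" "z \<in> cocycles X n"
    "f \<in> chain_maps R X Y" "g \<in> chain_maps R X Y"
  shows "f n z \<in> coboundaries Y n \<longleftrightarrow> g n z \<in> coboundaries Y n"
proof -
  interpret Y: abelian_group "obj Y n" using assms by (auto intro: complexes_group)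
  note d = homotopic_cocycles[OF assms]
  have c: "f n z \<in> carrier (obj Y n)" "g n z \<in> carrier (obj Y n)"
    using assms by (auto intro!: chain_map_closed)
  have "f n z = (f n z \<ominus>\<^bsub>obj Y n\<^esub> g n z) \<oplus>\<^bsub>obj Y n\<^esub> g n z"
    "g n z = f n z \<ominus>\<^bsub>obj Y n\<^esub> (f n z \<ominus>\<^bsub>obj Y n\<^esub> g n z)"
    using c by algebra+
  then show ?thesis using d coboundaries_add[OF assms(3)] coboundaries_minus[OF assms(3)] by metis
qed

lemma coh_inj_homotopic:
  assumes "coh_inj X Y f" "homotopic R X Y f g" "X \<in> complexes R" "Y \<in> complexes R"
    "f \<in> chain_maps R X Y" "g \<in> chain_maps R X Y"
  shows "coh_inj X Y g"
  using assms(1) homotopic_coboundaries_iff[OF assms(2-4) _ assms(5,6)] unfolding coh_inj_def by blast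

lemma coh_surj_homotopic:
  assumes "coh_surj X Y f" "homotopic R X Y f g" "X \<in> complexes R" "Y \<in> complexes R"
    "f \<in> chain_maps R X Y" "g \<in> chain_maps R X Y"
  shows "coh_surj X Y g"
  unfolding coh_surj_def
proof (intro allI ballI)
  fix n y assume y: "y \<in> cocycles Y n"
  interpret Y: abelian_group "obj Y n" using assms by (auto intro: complexes_group)
  obtain x where x: "x \<in> cocycles X n" "y \<ominus>\<^bsub>obj Y n\<^esub> f n x \<in> coboundaries Y n"
    using assms(1) y unfolding coh_surj_def by blast
  have c: "f n x \<in> carrier (obj Y n)" "g n x \<in> carrier (obj Y n)" "y \<in> carrier (obj Y n)"
    using assms x y by (auto intro!: chain_map_closed)
  have "y \<ominus>\<^bsub>obj Y n\<^esub> g n x = (y \<ominus>\<^bsub>obj Y n\<^esub> f n x) \<oplus>\<^bsub>obj Y n\<^esub> (f n x \<ominus>\<^bsub>obj Y n\<^esub> g n x)"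
    using c by algebra
  then have "y \<ominus>\<^bsub>obj Y n\<^esub> g n x \<in> coboundaries Y n"
    using x(2) homotopic_cocycles[OF assms(2-4) x(1) assms(5,6)] coboundaries_add[OF assms(4)] by simp
  then show "\<exists>x\<in>cocycles X n. y \<ominus>\<^bsub>obj Y n\<^esub> g n x \<in> coboundaries Y n" using x by blast
qed

lemma quasi_iso_id:
  assumes "X \<in> complexes R" shows "quasi_iso R X X id_map"
proof -
  have "y \<ominus>\<^bsub>obj X n\<^esub> y \<in> coboundaries X n" if "y \<in> cocycles X n" for n y
  proof -
    interpret X: abelian_group "obj X n" using assms by (auto intro: complexes_group)
    show ?thesis using that coboundaries_zero[OF assms, of n] by (simp add: X.minus_eq X.r_neg)
  qed
  then show ?thesis
    unfolding quasi_iso_iff[OF assms assms] coh_inj_def coh_surj_def id_map_def[of]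
    using chain_map_id[of R X] by (auto simp: id_map_def)
qed

lemma quasi_iso_comp:
  assumes "quasi_iso R X Y f" "quasi_iso R Y Z g" "X \<in> complexes R" "Y \<in> complexes R" "Z \<in> complexes R"
  shows "quasi_iso R X Z (comp_map g f)"
proof -
  have f: "f \<in> chain_maps R X Y" "coh_inj X Y f" "coh_surj X Y f"
    using assms(1) unfolding quasi_iso_iff[OF assms(3,4)] by auto
  have g: "g \<in> chain_maps R Y Z" "coh_inj Y Z g" "coh_surj Y Z g"
    using assms(2) unfolding quasi_iso_iff[OF assms(4,5)] by auto
  show ?thesis unfolding quasi_iso_iff[OF assms(3,5)]
    using coh_inj_comp[OF f(2) g(2) f(1) assms(3,4)] coh_surj_comp[OF f(3) g(3) f(1) g(1) assms(3-5)]
      chain_map_comp[OF f(1) g(1)] by blast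
qed

lemma quasi_iso_cancel:
  assumes "quasi_iso R X Z (comp_map g f)" "quasi_iso R Y Z g" "f \<in> chain_maps R X Y"
    "X \<in> complexes R" "Y \<in> complexes R" "Z \<in> complexes R"
  shows "quasi_iso R X Y f"
proof -
  have g: "g \<in> chain_maps R Y Z" "coh_inj Y Z g" "coh_surj Y Z g"
    using assms(2) unfolding quasi_iso_iff[OF assms(5,6)] by auto
  have gf: "coh_inj X Z (comp_map g f)" "coh_surj X Z (comp_map g f)"
    using assms(1) unfolding quasi_iso_iff[OF assms(4,6)] by auto
  have "coh_surj X Y f"
    unfolding coh_surj_def
  proof (intro allI ballI)
    fix n y assume y: "y \<in> cocycles Y n"
    obtain x where x: "x \<in> cocycles X n" "g n y \<ominus>\<^bsub>obj Z n\<^esub> g n (f n x) \<in> coboundaries Z n"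
      using gf(2) chain_map_cocycles[OF g(1) assms(5,6) y] unfolding coh_surj_def comp_map_def by blast
    note fx = chain_map_cocycles[OF assms(3,4,5) x(1)]
    have "g n (y \<ominus>\<^bsub>obj Y n\<^esub> f n x) \<in> coboundaries Z n"
      using x(2) y fx by (simp add: chain_map_minus[OF g(1) assms(5,6)])
    then have "y \<ominus>\<^bsub>obj Y n\<^esub> f n x \<in> coboundaries Y n"
      using g(2) cocycles_minus[OF assms(5) y fx] unfolding coh_inj_def by blast
    then show "\<exists>x\<in>cocycles X n. y \<ominus>\<^bsub>obj Y n\<^esub> f n x \<in> coboundaries Y n" using x by blast
  qed
  then show ?thesis unfolding quasi_iso_iff[OF assms(4,5)]
    using coh_inj_cancel[OF gf(1) g(1)] assms(3) by blast
qed

lemma quasi_iso_homotopic: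
  assumes "quasi_iso R X Y f" "homotopic R X Y f g" "g \<in> chain_maps R X Y"
    "X \<in> complexes R" "Y \<in> complexes R"
  shows "quasi_iso R X Y g"
  using assms(1) coh_inj_homotopic[OF _ assms(2,4,5) _ assms(3)] coh_surj_homotopic[OF _ assms(2,4,5) _ assms(3)]
    assms(3)
  unfolding quasi_iso_iff[OF assms(4,5)] by blast


section \<open>Shifts\<close>

lemma shift_obj [simp]: "obj (shift k X) n = obj X (n + k)"
  by (simp add: shift_def)

lemma shift_diff: "diff (shift k X) n x =
    (if even k then diff X (n + k) x else \<ominus>\<^bsub>obj X (n + k + 1)\<^esub> diff X (n + k) x)"
  by (simp add: shift_def)

lemma shift_0 [simp]: "shift 0 X = X"
  by (simp add: shift_def)

lemma shift_complexes [simp]: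
  assumes X: "X \<in> complexes R" shows "shift k X \<in> complexes R"
proof -
  have ac: "n + 1 + k = n + k + 1" "n + 2 + k = n + k + 2" "2 + (n + k) = n + k + 2" for n by simp_all
  have h: "diff (shift k X) n \<in> mod_hom R (obj X (n + k)) (obj X (n + k + 1))" for n
  proof (cases "even k")
    case True
    then have "diff (shift k X) n = diff X (n + k)" by (simp add: shift_def)
    then show ?thesis using diff_hom[OF X refl] by simp
  next
    case False
    then have "diff (shift k X) n = (\<lambda>x. \<ominus>\<^bsub>obj X (n + k + 1)\<^esub> diff X (n + k) x)"
      by (simp add: shift_def)
    then show ?thesis using mod_hom_neg[OF diff_hom[OF X refl] complexes_module[OF X]] by simp
  qed
  have d: "diff (shift k X) (n + 1) (diff (shift k X) n x) = \<zero>\<^bsub>obj X (n + k + 2)\<^esub>"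
    if "x \<in> carrier (obj X (n + k))" for n x
  proof -
    interpret abelian_group "obj X (n + k + 2)" using X by (rule complexes_group)
    have "diff X (n + k + 1) (\<ominus>\<^bsub>obj X (n + k + 1)\<^esub> diff X (n + k) x) =
      \<ominus>\<^bsub>obj X (n + k + 2)\<^esub> diff X (n + k + 1) (diff X (n + k) x)"
      using diff_uminus[OF X, of "diff X (n + k) x" "n + k + 1"] X that
      by (simp add: add.commute[of 2])
    then show ?thesis using diff_diff[OF X refl refl that] by (simp add: shift_diff ac)
  qed
  show ?thesis
    unfolding complexes_def using h d complexes_small_module[OF X] by (simp add: ac)
qed

text \<open>
  The sign in the differential of a shift changes neither the cocycles nor, coboundaries being closed
  under negation, the coboundaries.
\<close>

lemma shift_cocycles:
  assumes X: "X \<in> complexes R" shows "cocycles (shift k X) n = cocycles X (n + k)"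
proof -
  have ac: "n + 1 + k = n + k + 1" by simp
  interpret abelian_group "obj X (n + k + 1)" using X by (rule complexes_group)
  have "\<ominus>\<^bsub>obj X (n + k + 1)\<^esub> diff X (n + k) x = \<zero>\<^bsub>obj X (n + k + 1)\<^esub> \<longleftrightarrow>
    diff X (n + k) x = \<zero>\<^bsub>obj X (n + k + 1)\<^esub>" if "x \<in> carrier (obj X (n + k))" for x
    using X that minus_minus[of "diff X (n + k) x"] by auto
  then show ?thesis unfolding cocycles_def by (auto simp: shift_diff ac)
qed

lemma shift_coboundaries:
  assumes X: "X \<in> complexes R" shows "coboundaries (shift k X) n = coboundaries X (n + k)"
proof -
  have ac: "n - 1 + k = n + k - 1" by simp
  show ?thesis
  proof (cases "even k")
    case True
    then show ?thesis unfolding coboundaries_def by (simp add: shift_diff ac)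
  next
    case False
    have "coboundaries (shift k X) n =
        (\<lambda>x. \<ominus>\<^bsub>obj X (n + k)\<^esub> diff X (n + k - 1) x) ` carrier (obj X (n + k - 1))"
      using False unfolding coboundaries_def by (simp add: shift_diff ac)
    also have "\<dots> = (\<lambda>x. \<ominus>\<^bsub>obj X (n + k)\<^esub> x) ` coboundaries X (n + k)"
      unfolding coboundaries_def by (simp add: image_image)
    also have "\<dots> = coboundaries X (n + k)"
    proof -
      interpret abelian_group "obj X (n + k)" using X by (rule complexes_group)
      have "x = \<ominus>\<^bsub>obj X (n + k)\<^esub> (\<ominus>\<^bsub>obj X (n + k)\<^esub> x)" if "x \<in> coboundaries X (n + k)" for x
        using coboundaries_closed[OF X that] by simp
      then show ?thesis using coboundaries_uminus[OF X] by (auto simp: image_iff)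
    qed
    finally show ?thesis .
  qed
qed

lemma shift_chain_map:
  assumes X: "X \<in> complexes R" and Y: "Y \<in> complexes R" and f: "f \<in> chain_maps R X Y"
  shows "shift_map k f \<in> chain_maps R (shift k X) (shift k Y)"
proof (rule chain_mapsI)
  fix n x assume x: "x \<in> carrier (obj (shift k X) n)"
  have ac: "n + 1 + k = n + k + 1" by simp
  show "shift_map k f (n + 1) (diff (shift k X) n x) = diff (shift k Y) n (shift_map k f n x)"
    using x X chain_map_diff[OF f refl, of x "n + k"]
    by (simp add: shift_map_def shift_diff ac chain_map_uminus[OF f X Y])
qed (simp add: shift_map_def chain_map_hom[OF f])

lemma shift_quasi_iso:
  assumes X: "X \<in> complexes R" and Y: "Y \<in> complexes R" and f: "quasi_iso R X Y f"
  shows "quasi_iso R (shift k X) (shift k Y) (shift_map k f)"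
  using f shift_chain_map[OF X Y quasi_iso_chain_map[OF f]]
  unfolding quasi_iso_iff[OF X Y] quasi_iso_iff[OF shift_complexes[OF X] shift_complexes[OF Y]]
    coh_inj_def coh_surj_def shift_cocycles[OF X] shift_cocycles[OF Y]
    shift_coboundaries[OF X] shift_coboundaries[OF Y]
  by (simp add: shift_map_def)


section \<open>Maps into two-term complexes of injectives\<close>

definition two_term_injective :: "'r ring \<Rightarrow> ('r, 'u) cochain \<Rightarrow> int \<Rightarrow> bool" where
  "two_term_injective R E m \<longleftrightarrow> E \<in> complexes R \<and> (\<forall>n. injective_module R (obj E n)) \<and>
     (\<forall>n. n \<noteq> m \<and> n \<noteq> m + 1 \<longrightarrow> carrier (obj E n) = {\<zero>\<^bsub>obj E n\<^esub>})"

lemma two_term_injective_complexes: "two_term_injective R E m \<Longrightarrow> E \<in> complexes R"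
  by (simp add: two_term_injective_def)

lemma two_term_injective_zero:
  "two_term_injective R E m \<Longrightarrow> n \<noteq> m \<Longrightarrow> n \<noteq> m + 1 \<Longrightarrow> x \<in> carrier (obj E n) \<Longrightarrow> x = \<zero>\<^bsub>obj E n\<^esub>"
  unfolding two_term_injective_def by blast

lemma two_term_injective_shift:
  assumes "two_term_injective R E m" shows "two_term_injective R (shift k E) (m - k)"
  unfolding two_term_injective_def
proof (intro conjI allI impI)
  fix n assume "n \<noteq> m - k \<and> n \<noteq> m - k + 1"
  then have "n + k \<noteq> m \<and> n + k \<noteq> m + 1" by linarith
  then show "carrier (obj (shift k E) n) = {\<zero>\<^bsub>obj (shift k E) n\<^esub>}"
    using assms unfolding two_term_injective_def shift_obj by blast
qed (use assms in \<open>simp_all add: two_term_injective_def shift_complexes\<close>)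

lemma two_term_coboundaries:
  assumes E: "two_term_injective R E m" and b: "b \<in> coboundaries E m"
  shows "b = \<zero>\<^bsub>obj E m\<^esub>"
proof -
  obtain y where y: "y \<in> carrier (obj E (m - 1))" "b = diff E (m - 1) y"
    using b by (rule coboundariesE[of _ _ _ "m - 1"]) simp
  have "y = \<zero>\<^bsub>obj E (m - 1)\<^esub>" using two_term_injective_zero[OF E _ _ y(1)] by simp
  then show ?thesis using y(2) diff_zero[OF two_term_injective_complexes[OF E], of "m - 1"] by simp
qed

text \<open>
  A homotopy into \<open>E\<close> has just two components, \<open>h\<^sub>1\<close> on degree \<open>m + 1\<close> and \<open>h\<^sub>2\<close> on degree \<open>m + 2\<close>.  An \<open>h\<^sub>1\<close>
  with \<open>h\<^sub>1 d = f\<close> exists because \<open>f\<close> kills the cocycles in degree \<open>m\<close>; an \<open>h\<^sub>2\<close> with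
  \<open>h\<^sub>2 d = f - d h\<^sub>1\<close> exists because the cocycles in degree \<open>m + 1\<close> are coboundaries.  Acyclic complexes,
  complexes in the wrong degrees and truncations all satisfy the two hypotheses.
\<close>

lemma null_homotopic_two_term:
  assumes E: "two_term_injective R E m" and X: "X \<in> complexes R" and f: "f \<in> chain_maps R X E"
    and cyc: "\<And>z. z \<in> cocycles X m \<Longrightarrow> f m z = \<zero>\<^bsub>obj E m\<^esub>"
    and ex: "cocycles X (m + 1) \<subseteq> coboundaries X (m + 1)"
  shows "homotopic R X E f (zero_map E)"
proof -
  have EC: "E \<in> complexes R" and inj: "\<And>n. injective_module R (obj E n)"
    using E by (auto simp: two_term_injective_def)
  note zero = two_term_injective_zero[OF E]
  note sm = complexes_small_module[OF X]
  obtain h1 where h1: "h1 \<in> mod_hom R (obj X (m + 1)) (obj E m)"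
      "\<And>x. x \<in> carrier (obj X m) \<Longrightarrow> h1 (diff X m x) = f m x"
    using injective_extend[OF inj sm sm diff_hom[OF X refl] chain_map_hom[OF f]]
      cyc[OF cocyclesI] by metis
  have h1c: "h1 x \<in> carrier (obj E m)" if "x \<in> carrier (obj X (m + 1))" for x
    using mod_hom_closed[OF h1(1) that] .
  define g where "g = (\<lambda>x. f (m + 1) x \<ominus>\<^bsub>obj E (m + 1)\<^esub> diff E m (h1 x))"
  have g: "g \<in> mod_hom R (obj X (m + 1)) (obj E (m + 1))"
    unfolding g_def
    by (rule mod_hom_diff[OF chain_map_hom[OF f] mod_hom_comp[OF h1(1) diff_hom[OF EC refl]] complexes_module[OF EC]])
  have g0: "g x = \<zero>\<^bsub>obj E (m + 1)\<^esub>"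
    if x: "x \<in> carrier (obj X (m + 1))" "diff X (m + 1) x = \<zero>\<^bsub>obj X (m + 1 + 1)\<^esub>" for x
  proof -
    have "x \<in> coboundaries X (m + 1)" using ex cocyclesI[OF x] by (rule subsetD)
    then obtain w where w: "w \<in> carrier (obj X m)" "x = diff X m w" by (rule coboundariesE[OF _ refl])
    interpret abelian_group "obj E (m + 1)" using EC by (rule complexes_group)
    show ?thesis unfolding g_def w(2) h1(2)[OF w(1)] chain_map_diff[OF f refl w(1)]
      using EC f w(1) by (simp add: minus_eq_zero_iff)
  qed
  obtain h2 where h2: "h2 \<in> mod_hom R (obj X (m + 1 + 1)) (obj E (m + 1))"
      "\<And>x. x \<in> carrier (obj X (m + 1)) \<Longrightarrow> h2 (diff X (m + 1) x) = g x"
    using injective_extend[OF inj sm sm diff_hom[OF X refl] g g0] by metis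
  \<comment> \<open>The component \<open>h n\<close> goes from degree \<open>n\<close> to degree \<open>n - 1\<close>.\<close>
  define h where "h = (\<lambda>n. if n = m + 1 then h1 else if n = m + 2 then h2 else (\<lambda>x. \<zero>\<^bsub>obj E (n - 1)\<^esub>))"
  have hh: "h n \<in> mod_hom R (obj X n) (obj E (n - 1))" for n
  proof -
    have e: "m + 1 + 1 = m + 2" "m + 2 - 1 = m + 1" "m + 1 - 1 = m" by simp_all
    consider "n = m + 1" | "n = m + 2" | "n \<noteq> m + 1" "n \<noteq> m + 2" by blast
    then show ?thesis
    proof cases
      case 1 then show ?thesis using h1(1) by (simp add: h_def)
    next
      case 2 then show ?thesis using h2(1) unfolding h_def 2 e by simp
    next
      case 3 then show ?thesis using mod_hom_const_zero[OF complexes_module[OF EC]] by (simp add: h_def)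
    qed
  qed
  show ?thesis
  proof (rule homotopicI[OF EC X f _ hh])
    fix n x assume x: "x \<in> carrier (obj X n)"
    interpret abelian_group "obj E n" using EC by (rule complexes_group)
    have hx: "h n x \<in> carrier (obj E (n - 1))" using mod_hom_closed[OF hh x] .
    have c1: "diff E (n - 1) (h n x) \<in> carrier (obj E n)"
      using diff_closed[OF EC _ hx, of n] by simp
    have c2: "h (n + 1) (diff X n x) \<in> carrier (obj E n)"
      using mod_hom_closed[OF hh[of "n + 1"], of "diff X n x"] X x by simp
    have c3: "f n x \<in> carrier (obj E n)" using f x by auto
    consider "n = m" | "n = m + 1" | "n \<noteq> m" "n \<noteq> m + 1" by blast
    then show "f n x = diff E (n - 1) (h n x) \<oplus>\<^bsub>obj E n\<^esub> h (n + 1) (diff X n x)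
        \<oplus>\<^bsub>obj E n\<^esub> zero_map E n x"
    proof cases
      case 1
      have "h n x = \<zero>\<^bsub>obj E (n - 1)\<^esub>" using 1 by (simp add: h_def)
      then have "diff E (n - 1) (h n x) = \<zero>\<^bsub>obj E n\<^esub>" using diff_zero[OF EC, of "n - 1"] by simp
      moreover have "h (n + 1) (diff X n x) = f n x" using 1 x h1(2) by (simp add: h_def)
      ultimately show ?thesis using c3 by (simp add: zero_map_def)
    next
      case 2
      have "h n x = h1 x" "h (n + 1) (diff X n x) = g x"
        using 2 x h2(2) by (simp_all add: h_def)
      then have "diff E (n - 1) (h n x) \<oplus>\<^bsub>obj E n\<^esub> h (n + 1) (diff X n x)
        \<oplus>\<^bsub>obj E n\<^esub> zero_map E n x = diff E (n - 1) (h n x) \<oplus>\<^bsub>obj E n\<^esub>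
        (f n x \<ominus>\<^bsub>obj E n\<^esub> diff E (n - 1) (h n x)) \<oplus>\<^bsub>obj E n\<^esub> \<zero>\<^bsub>obj E n\<^esub>"
        using 2 by (simp add: g_def zero_map_def)
      also have "\<dots> = f n x" using c1 c3 by algebra
      finally show ?thesis ..
    next
      case 3
      have z: "y = \<zero>\<^bsub>obj E n\<^esub>" if "y \<in> carrier (obj E n)" for y using zero[OF 3 that] .
      show ?thesis using z[OF c1] z[OF c2] z[OF c3] by (simp add: zero_map_def)
    qed
  qed (use EC in auto)
qed


section \<open>Direct sums, cones and homotopy pullbacks\<close>

locale universe =
  fixes U :: "'u itself"
  assumes universe: "grothendieck_universe U"
begin

lemma infinite_universe: "infinite (UNIV :: 'u set)"
  using universe lesspoll_imp_lepoll unfolding grothendieck_universe_def infinite_le_lepoll by blast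

lemma finite_small: "finite A \<Longrightarrow> A \<prec> (UNIV :: 'u set)"
  using infinite_universe finite_lesspoll_infinite by blast

lemma ufst_upair [simp]: "ufst (upair (a, b :: 'u)) = a"
  and usnd_upair [simp]: "usnd (upair (a, b :: 'u)) = b"
  using ufst_usnd_upair[OF infinite_universe] by auto

lemma upair_eq [simp]: "upair (a, b :: 'u) = upair (c, d) \<longleftrightarrow> a = c \<and> b = d"
  by (metis ufst_upair usnd_upair)

text \<open>
  A product of two small sets is a small union of small sets.
\<close>

lemma small_pairs:
  assumes A: "(A :: 'u set) \<prec> (UNIV :: 'u set)" and B: "(B :: 'u set) \<prec> (UNIV :: 'u set)"
  shows "upair ` (A \<times> B) \<prec> (UNIV :: 'u set)"
proof -
  have "upair ` (A \<times> B) = (\<Union>a\<in>A. (\<lambda>b. upair (a, b)) ` B)" by auto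
  moreover have "(\<lambda>b. upair (a, b)) ` B \<prec> (UNIV :: 'u set)" for a
    using B image_lepoll lesspoll_trans1 by blast
  ultimately show ?thesis
    using universe A unfolding grothendieck_universe_def by simp
qed

lemma direct_sumE:
  assumes "x \<in> carrier (direct_sum M N)"
  obtains a b where "a \<in> carrier M" "b \<in> carrier N" "x = upair (a, b :: 'u)"
  using assms by (auto simp: direct_sum_def)

lemma direct_sum_mem [simp]:
  "upair (a, b :: 'u) \<in> carrier (direct_sum M N) \<longleftrightarrow> a \<in> carrier M \<and> b \<in> carrier N"
  by (auto simp: direct_sum_def)

lemma direct_sum_add [simp]:
  "upair (a, b :: 'u) \<oplus>\<^bsub>direct_sum M N\<^esub> upair (c, d) = upair (a \<oplus>\<^bsub>M\<^esub> c, b \<oplus>\<^bsub>N\<^esub> d)"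
  by (simp add: direct_sum_def)

lemma direct_sum_zero [simp]: "\<zero>\<^bsub>direct_sum M N\<^esub> = upair (\<zero>\<^bsub>M\<^esub>, \<zero>\<^bsub>N\<^esub> :: 'u)"
  by (simp add: direct_sum_def)

lemma direct_sum_smult [simp]:
  "r \<odot>\<^bsub>direct_sum M N\<^esub> upair (a, b :: 'u) = upair (r \<odot>\<^bsub>M\<^esub> a, r \<odot>\<^bsub>N\<^esub> b)"
  by (simp add: direct_sum_def)

lemma direct_sum_small_module:
  fixes M N :: "('r, 'u) module"
  assumes "small_module R M" "small_module R N"
  shows "small_module R (direct_sum M N)"
proof -
  interpret M: module R M using assms by (simp add: small_module_def)
  interpret N: module R N using assms by (simp add: small_module_def)
  have "abelian_group (direct_sum M N)"
  proof (rule abelian_groupI)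
    fix x assume "x \<in> carrier (direct_sum M N)"
    then obtain a b where "a \<in> carrier M" "b \<in> carrier N" "x = upair (a, b)" by (rule direct_sumE)
    then show "\<exists>y\<in>carrier (direct_sum M N). y \<oplus>\<^bsub>direct_sum M N\<^esub> x = \<zero>\<^bsub>direct_sum M N\<^esub>"
      by (intro bexI[of _ "upair (\<ominus>\<^bsub>M\<^esub> a, \<ominus>\<^bsub>N\<^esub> b)"]) (simp_all add: M.M.l_neg N.M.l_neg)
  qed (auto elim!: direct_sumE simp: M.M.a_ac N.M.a_ac)
  then have "module R (direct_sum M N)"
    by (intro moduleI)
      (auto elim!: direct_sumE simp: M.R.cring_axioms M.smult_l_distr M.smult_r_distr M.smult_assoc1
         N.smult_l_distr N.smult_r_distr N.smult_assoc1)
  moreover have "carrier (direct_sum M N) \<prec> (UNIV :: 'u set)"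
    using assms small_pairs by (simp add: small_module_def direct_sum_def)
  ultimately show ?thesis by (simp add: small_module_def)
qed

lemma direct_sum_uminus:
  fixes M N :: "('r, 'u) module"
  assumes "small_module R M" "small_module R N" and x: "a \<in> carrier M" "b \<in> carrier N"
  shows "\<ominus>\<^bsub>direct_sum M N\<^esub> upair (a, b) = upair (\<ominus>\<^bsub>M\<^esub> a, \<ominus>\<^bsub>N\<^esub> b)"
proof -
  interpret M: module R M using assms by (simp add: small_module_def)
  interpret N: module R N using assms by (simp add: small_module_def)
  interpret S: module R "direct_sum M N"
    using direct_sum_small_module[OF assms(1,2)] by (simp add: small_module_def)
  have "upair (\<ominus>\<^bsub>M\<^esub> a, \<ominus>\<^bsub>N\<^esub> b) \<oplus>\<^bsub>direct_sum M N\<^esub> upair (a, b) = \<zero>\<^bsub>direct_sum M N\<^esub>"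
    using x by (simp add: M.M.l_neg N.M.l_neg)
  then show ?thesis
    using S.M.add_eq_zero_iff[of "upair (\<ominus>\<^bsub>M\<^esub> a, \<ominus>\<^bsub>N\<^esub> b)" "upair (a, b)"] x by simp
qed

lemma mod_hom_pair:
  fixes f g :: "'u \<Rightarrow> 'u"
  assumes "f \<in> mod_hom R L M" "g \<in> mod_hom R L N"
  shows "(\<lambda>x. upair (f x, g x)) \<in> mod_hom R L (direct_sum M N)"
  using assms by (intro mod_homI) (simp_all add: mod_hom_closed mod_hom_add mod_hom_smult)

lemma mod_hom_ufst: "ufst \<in> mod_hom R (direct_sum M (N :: ('r, 'u) module)) M"
  by (rule mod_homI) (auto elim!: direct_sumE)

lemma mod_hom_usnd: "usnd \<in> mod_hom R (direct_sum M (N :: ('r, 'u) module)) N"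
  by (rule mod_homI) (auto elim!: direct_sumE)

lemma cone_obj [simp]: "obj (cone A B f) n = direct_sum (obj A (n + 1)) (obj B n)"
  by (simp add: cone_def)

lemma cone_diff [simp]: "diff (cone A B f) n (upair (a, b :: 'u)) =
    upair (\<ominus>\<^bsub>obj A (n + 2)\<^esub> diff A (n + 1) a, f (n + 1) a \<oplus>\<^bsub>obj B (n + 1)\<^esub> diff B n b)"
  by (simp add: cone_def)

lemma cone_complexes:
  fixes A B :: "('r, 'u) cochain"
  assumes A: "A \<in> complexes R" and B: "B \<in> complexes R" and f: "f \<in> chain_maps R A B"
  shows "cone A B f \<in> complexes R"
proof -
  have e: "n + 1 + 1 = n + 2" "n + 2 + 1 = n + 3" "n + 1 + 2 = n + 3" for n :: int by simp_all
  have d: "diff (cone A B f) n \<in> mod_hom R (obj (cone A B f) n) (obj (cone A B f) (n + 1))" for n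
    unfolding cone_obj unfolding cone_def cochain.simps e
    using A B f
    by (intro mod_hom_pair mod_hom_neg mod_hom_plus complexes_module
       mod_hom_comp[OF mod_hom_ufst diff_hom] mod_hom_comp[OF mod_hom_ufst chain_map_hom]
       mod_hom_comp[OF mod_hom_usnd diff_hom]) auto
  have dd: "diff (cone A B f) (n + 1) (diff (cone A B f) n x) = \<zero>\<^bsub>obj (cone A B f) (n + 2)\<^esub>"
    if "x \<in> carrier (obj (cone A B f) n)" for n x
  proof -
    obtain a b where ab: "a \<in> carrier (obj A (n + 1))" "b \<in> carrier (obj B n)" "x = upair (a, b)"
      using \<open>x \<in> carrier (obj (cone A B f) n)\<close> unfolding cone_obj by (rule direct_sumE)
    interpret A: abelian_group "obj A (n + 3)" using A by (rule complexes_group)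
    interpret B: abelian_group "obj B (n + 2)" using B by (rule complexes_group)
    have da: "diff A (n + 1) a \<in> carrier (obj A (n + 2))" using A ab by simp
    have fa: "f (n + 1) a \<in> carrier (obj B (n + 1))" "f (n + 2) (diff A (n + 1) a) \<in> carrier (obj B (n + 2))"
      using f ab da by (simp_all add: chain_map_closed[OF f])
    have 1: "diff A (n + 2) (\<ominus>\<^bsub>obj A (n + 2)\<^esub> diff A (n + 1) a) = \<zero>\<^bsub>obj A (n + 3)\<^esub>"
      using diff_uminus[OF A da] diff_diff[OF A _ _ ab(1), of "n + 2" "n + 3"] e by simp
    have 2: "f (n + 2) (\<ominus>\<^bsub>obj A (n + 2)\<^esub> diff A (n + 1) a) = \<ominus>\<^bsub>obj B (n + 2)\<^esub> f (n + 2) (diff A (n + 1) a)"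
      using chain_map_uminus[OF f A B da] .
    have 3: "diff B (n + 1) (f (n + 1) a \<oplus>\<^bsub>obj B (n + 1)\<^esub> diff B n b) = f (n + 2) (diff A (n + 1) a)"
      using diff_add[OF B fa(1), of "diff B n b"] diff_diff[OF B refl refl ab(2)] B ab(2) e fa(2)
        chain_map_diff[OF f _ ab(1), of "n + 2"] by simp
    have 4: "\<ominus>\<^bsub>obj B (n + 2)\<^esub> f (n + 2) (diff A (n + 1) a) \<oplus>\<^bsub>obj B (n + 2)\<^esub> f (n + 2) (diff A (n + 1) a)
        = \<zero>\<^bsub>obj B (n + 2)\<^esub>"
      using fa(2) by (rule B.l_neg)
    show ?thesis unfolding ab(3) cone_diff cone_obj e 1 2 3 4 by simp
  qed
  show ?thesis
    using direct_sum_small_module[OF complexes_small_module[OF A] complexes_small_module[OF B]] d dd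
    by (intro complexesI) (simp_all only: cone_obj)
qed

lemma cone_incl_chain_map:
  fixes A B :: "('r, 'u) cochain"
  assumes A: "A \<in> complexes R" and B: "B \<in> complexes R" and f: "f \<in> chain_maps R A B"
  shows "cone_incl A \<in> chain_maps R B (cone A B f)"
proof (rule chain_mapsI)
  fix n show "cone_incl A n \<in> mod_hom R (obj B n) (obj (cone A B f) n)"
    unfolding cone_incl_def cone_obj
    by (intro mod_hom_pair mod_hom_const_zero mod_hom_id complexes_module A)
next
  fix n x assume x: "x \<in> carrier (obj B n)"
  interpret A: abelian_group "obj A (n + 2)" using A by (rule complexes_group)
  interpret B: abelian_group "obj B (n + 1)" using B by (rule complexes_group)
  have "\<ominus>\<^bsub>obj A (n + 2)\<^esub> diff A (n + 1) \<zero>\<^bsub>obj A (n + 1)\<^esub> = \<zero>\<^bsub>obj A (n + 1 + 1)\<^esub>"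
    using diff_zero[OF A, of "n + 1"] by (simp add: add.commute[of 2])
  then show "cone_incl A (n + 1) (diff B n x) = diff (cone A B f) n (cone_incl A n x)"
    using x B by (simp add: cone_incl_def chain_map_zero[OF f A B])
qed

text \<open>
  Exactness of \<open>H\<^sup>n\<^sup>-\<^sup>1(cone f) \<rightarrow> H\<^sup>n(A) \<rightarrow> H\<^sup>n(B)\<close>: if \<open>f z = d b\<close>, then \<open>(z, -b)\<close> is a cocycle of the cone.
\<close>

lemma cone_coh_inj:
  fixes A B :: "('r, 'u) cochain"
  assumes A: "A \<in> complexes R" and B: "B \<in> complexes R" and f: "f \<in> chain_maps R A B"
    and ex: "cocycles (cone A B f) (n - 1) \<subseteq> coboundaries (cone A B f) (n - 1)"
    and z: "z \<in> cocycles A n" "f n z \<in> coboundaries B n"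
  shows "z \<in> coboundaries A n"
proof -
  have n: "n = n - 1 + 1" "n - 1 = n - 2 + 1" "n - 2 + 1 = n - 1" "n - 1 + 2 = n + 1" "n - 2 + 2 = n"
    by simp_all
  interpret A: abelian_group "obj A n" using A by (rule complexes_group)
  interpret A1: abelian_group "obj A (n + 1)" using A by (rule complexes_group)
  interpret B: abelian_group "obj B n" using B by (rule complexes_group)
  obtain b where b: "b \<in> carrier (obj B (n - 1))" "f n z = diff B (n - 1) b"
    using z(2) n(1) by (rule coboundariesE)
  have zc: "z \<in> carrier (obj A n)" using z by simp
  have db: "diff B (n - 1) b \<in> carrier (obj B n)" using B b by simp
  have "upair (z, \<ominus>\<^bsub>obj B (n - 1)\<^esub> b) \<in> cocycles (cone A B f) (n - 1)"
  proof (rule cocyclesI)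
    show "diff (cone A B f) (n - 1) (upair (z, \<ominus>\<^bsub>obj B (n - 1)\<^esub> b)) = \<zero>\<^bsub>obj (cone A B f) (n - 1 + 1)\<^esub>"
      using cocycles_diff[OF z(1)] b diff_uminus[OF B b(1)] db
      by (simp add: B.r_neg add.commute[of 1])
  qed (use zc b B in simp)
  then have "upair (z, \<ominus>\<^bsub>obj B (n - 1)\<^esub> b) \<in> coboundaries (cone A B f) (n - 1)" using ex by blast
  then obtain y where y: "y \<in> carrier (obj (cone A B f) (n - 2))"
      "upair (z, \<ominus>\<^bsub>obj B (n - 1)\<^esub> b) = diff (cone A B f) (n - 2) y"
    using n(2) by (rule coboundariesE)
  obtain a b' where ab: "a \<in> carrier (obj A (n - 2 + 1))" "y = upair (a, b')"
    using y(1) unfolding cone_obj by (rule direct_sumE)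
  have "z = \<ominus>\<^bsub>obj A n\<^esub> diff A (n - 1) a" using y(2) unfolding ab(2) cone_diff n(3-5) by simp
  moreover have "diff A (n - 1) a \<in> coboundaries A n"
    by (rule coboundariesI) (use ab(1) n(3) in simp_all)
  ultimately show ?thesis using coboundaries_uminus[OF A] by simp
qed

text \<open>
  For a cocycle \<open>(w, b)\<close> we have \<open>f w = d(-b)\<close>.  Injectivity on cohomology gives \<open>w = d w'\<close>, and
  surjectivity writes the cocycle \<open>f w' + b\<close> as \<open>f v + d c\<close>; then \<open>(v - w', c)\<close> is a primitive.
\<close>

lemma cone_acyclic:
  fixes A B :: "('r, 'u) cochain"
  assumes A: "A \<in> complexes R" and B: "B \<in> complexes R" and f: "quasi_iso R A B f"
  shows "cocycles (cone A B f) n \<subseteq> coboundaries (cone A B f) n"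
proof
  have fc: "f \<in> chain_maps R A B" and inj: "coh_inj A B f" and surj: "coh_surj A B f"
    using f unfolding quasi_iso_iff[OF A B] by auto
  have e: "n - 1 + 1 = n" "n - 1 + 2 = n + 1" by simp_all
  interpret B1: abelian_group "obj B (n + 1)" using B by (rule complexes_group)
  interpret A1: abelian_group "obj A (n + 1)" using A by (rule complexes_group)
  interpret A2: abelian_group "obj A (n + 2)" using A by (rule complexes_group)
  interpret B0: abelian_group "obj B n" using B by (rule complexes_group)
  fix x assume x: "x \<in> cocycles (cone A B f) n"
  then obtain w b where wb: "w \<in> carrier (obj A (n + 1))" "b \<in> carrier (obj B n)" "x = upair (w, b)"
    using cocycles_closed[OF x] unfolding cone_obj by (metis direct_sumE)
  have dw: "diff A (n + 1) w \<in> carrier (obj A (n + 2))" using A wb by simp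
  have db: "diff B n b \<in> carrier (obj B (n + 1))" using B wb by simp
  have fw: "f (n + 1) w \<in> carrier (obj B (n + 1))" using fc wb by simp
  have "\<ominus>\<^bsub>obj A (n + 2)\<^esub> diff A (n + 1) w = \<zero>\<^bsub>obj A (n + 1 + 1)\<^esub>"
    and 0: "f (n + 1) w \<oplus>\<^bsub>obj B (n + 1)\<^esub> diff B n b = \<zero>\<^bsub>obj B (n + 1)\<^esub>"
    using cocycles_diff[OF x] unfolding wb(3) cone_diff cone_obj by simp_all
  then have "diff A (n + 1) w = \<zero>\<^bsub>obj A (n + 1 + 1)\<^esub>"
    using dw A2.minus_minus[of "diff A (n + 1) w"] by (simp add: add.commute[of 2])
  then have w: "w \<in> cocycles A (n + 1)" using wb by (intro cocyclesI)
  have fw': "f (n + 1) w = \<ominus>\<^bsub>obj B (n + 1)\<^esub> diff B n b" using 0 fw db by (simp add: B1.add_eq_zero_iff)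
  then have "f (n + 1) w \<in> coboundaries B (n + 1)"
    using coboundaries_uminus[OF B coboundariesI[OF wb(2) refl]] by simp
  then have "w \<in> coboundaries A (n + 1)" using inj w unfolding coh_inj_def by blast
  then obtain w' where w': "w' \<in> carrier (obj A n)" "w = diff A n w'"
    by (rule coboundariesE[OF _ refl])
  have fw'c: "f n w' \<in> carrier (obj B n)" using fc w' by simp
  have "f n w' \<oplus>\<^bsub>obj B n\<^esub> b \<in> cocycles B n"
  proof (rule cocyclesI)
    have "diff B n (f n w') = f (n + 1) w" using chain_map_diff[OF fc refl w'(1)] w'(2) by simp
    then show "diff B n (f n w' \<oplus>\<^bsub>obj B n\<^esub> b) = \<zero>\<^bsub>obj B (n + 1)\<^esub>"
      using 0 diff_add[OF B fw'c wb(2)] by simp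
  qed (use fw'c wb in simp)
  then obtain v where v: "v \<in> cocycles A n"
      "(f n w' \<oplus>\<^bsub>obj B n\<^esub> b) \<ominus>\<^bsub>obj B n\<^esub> f n v \<in> coboundaries B n"
    using surj unfolding coh_surj_def by blast
  obtain c where c: "c \<in> carrier (obj B (n - 1))"
      "(f n w' \<oplus>\<^bsub>obj B n\<^esub> b) \<ominus>\<^bsub>obj B n\<^esub> f n v = diff B (n - 1) c"
    using v(2) by (rule coboundariesE[of _ _ _ "n - 1"]) simp
  have vc: "v \<in> carrier (obj A n)" using v by simp
  have fv: "f n v \<in> carrier (obj B n)" using fc vc by simp
  interpret A0: abelian_group "obj A n" using A by (rule complexes_group)
  have a: "v \<ominus>\<^bsub>obj A n\<^esub> w' \<in> carrier (obj A n)" using vc w' by simp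
  have "\<ominus>\<^bsub>obj A (n + 1)\<^esub> diff A n (v \<ominus>\<^bsub>obj A n\<^esub> w') = w"
    using diff_minus[OF A vc w'(1)] cocycles_diff[OF v(1)] w'(2) wb(1) by (simp add: A1.minus_eq)
  moreover have "f n (v \<ominus>\<^bsub>obj A n\<^esub> w') \<oplus>\<^bsub>obj B n\<^esub> diff B (n - 1) c = b"
    unfolding c(2)[symmetric] chain_map_minus[OF fc A B vc w'(1)] using fv fw'c wb(2) by algebra
  ultimately have d: "diff (cone A B f) (n - 1) (upair (v \<ominus>\<^bsub>obj A n\<^esub> w', c)) = x"
    unfolding wb(3) cone_diff e by simp
  have "upair (v \<ominus>\<^bsub>obj A n\<^esub> w', c) \<in> carrier (obj (cone A B f) (n - 1))"
    using a c by simp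
  from coboundariesI[OF this, of n] show "x \<in> coboundaries (cone A B f) n" unfolding d by simp
qed

text \<open>
  A null homotopy \<open>h\<close> of \<open>g f\<close> extends \<open>g\<close> to the chain map \<open>(a, b) \<mapsto> h a + g b\<close> on the cone.  If this
  extension is null homotopic, so is its restriction \<open>g\<close>.
\<close>

lemma null_homotopic_of_cone:
  fixes A B E :: "('r, 'u) cochain"
  assumes A: "A \<in> complexes R" and B: "B \<in> complexes R" and E: "E \<in> complexes R"
    and f: "f \<in> chain_maps R A B" and g: "g \<in> chain_maps R B E"
    and null: "homotopic R A E (comp_map g f) (zero_map E)"
    and cone: "\<And>p. p \<in> chain_maps R (cone A B f) E \<Longrightarrow> homotopic R (cone A B f) E p (zero_map E)"
  shows "homotopic R B E g (zero_map E)"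
proof -
  obtain h where h: "\<And>n. h n \<in> mod_hom R (obj A n) (obj E (n - 1))"
    and hc: "\<And>n x. x \<in> carrier (obj A n) \<Longrightarrow> h n x \<in> carrier (obj E (n - 1))"
    and hd: "\<And>n x. x \<in> carrier (obj A n) \<Longrightarrow> h (n + 1) (diff A n x) \<in> carrier (obj E n)"
    and eq: "\<And>n x. x \<in> carrier (obj A n) \<Longrightarrow> comp_map g f n x =
      (diff E (n - 1) (h n x) \<oplus>\<^bsub>obj E n\<^esub> h (n + 1) (diff A n x)) \<oplus>\<^bsub>obj E n\<^esub> zero_map E n x"
    using homotopicE[OF null E A chain_map_comp[OF f g] chain_map_zero_map[OF E]] by blast
  define p where "p = (\<lambda>n x. h (n + 1) (ufst x) \<oplus>\<^bsub>obj E n\<^esub> g n (usnd x))"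
  have h': "h (n + 1) \<in> mod_hom R (obj A (n + 1)) (obj E n)" for n
    using h[of "n + 1"] by simp
  have e: "n + 1 + 1 = n + 2" "n + 1 - 1 = n" for n :: int by simp_all
  have "p \<in> chain_maps R (cone A B f) E"
  proof (rule chain_mapsI)
    fix n show "p n \<in> mod_hom R (obj (cone A B f) n) (obj E n)"
      unfolding p_def cone_obj
      by (intro mod_hom_plus mod_hom_comp[OF mod_hom_ufst h']
          mod_hom_comp[OF mod_hom_usnd chain_map_hom[OF g]] complexes_module E)
  next
    fix n x assume "x \<in> carrier (obj (cone A B f) n)"
    then obtain a b where ab: "a \<in> carrier (obj A (n + 1))" "b \<in> carrier (obj B n)" "x = upair (a, b)"
      unfolding cone_obj by (rule direct_sumE)
    interpret E1: abelian_group "obj E (n + 1)" using E by (rule complexes_group)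
    have da: "diff A (n + 1) a \<in> carrier (obj A (n + 2))" using A ab by simp
    have fa: "f (n + 1) a \<in> carrier (obj B (n + 1))" using f ab by simp
    have db: "diff B n b \<in> carrier (obj B (n + 1))" using B ab by simp
    have ha: "h (n + 1) a \<in> carrier (obj E n)" using mod_hom_closed[OF h' ab(1)] .
    have hda: "h (n + 2) (diff A (n + 1) a) \<in> carrier (obj E (n + 1))"
      using hd[OF ab(1)] e by simp
    have dha: "diff E n (h (n + 1) a) \<in> carrier (obj E (n + 1))" using E ha by simp
    have gb: "g n b \<in> carrier (obj E n)" using g ab by simp
    have dgb: "diff E n (g n b) \<in> carrier (obj E (n + 1))" using E gb by simp
    have gfa: "g (n + 1) (f (n + 1) a) =
        diff E n (h (n + 1) a) \<oplus>\<^bsub>obj E (n + 1)\<^esub> h (n + 2) (diff A (n + 1) a)"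
      using eq[OF ab(1)] hda dha unfolding comp_map_def zero_map_def e by simp
    have hn: "h (n + 2) (\<ominus>\<^bsub>obj A (n + 2)\<^esub> diff A (n + 1) a) =
        \<ominus>\<^bsub>obj E (n + 1)\<^esub> h (n + 2) (diff A (n + 1) a)"
      using mod_hom_uminus[OF h'[of "n + 1"] complexes_group[OF A] complexes_group[OF E]] da
      unfolding e by blast
    have "p (n + 1) (diff (cone A B f) n x) = \<ominus>\<^bsub>obj E (n + 1)\<^esub> h (n + 2) (diff A (n + 1) a)
        \<oplus>\<^bsub>obj E (n + 1)\<^esub> (diff E n (h (n + 1) a) \<oplus>\<^bsub>obj E (n + 1)\<^esub> h (n + 2) (diff A (n + 1) a)
        \<oplus>\<^bsub>obj E (n + 1)\<^esub> diff E n (g n b))"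
      unfolding ab(3) p_def cone_diff ufst_upair usnd_upair e hn chain_map_add[OF g fa db] gfa
        chain_map_diff[OF g refl ab(2)] ..
    also have "\<dots> = diff E n (h (n + 1) a) \<oplus>\<^bsub>obj E (n + 1)\<^esub> diff E n (g n b)"
      using hda dha dgb by algebra
    also have "\<dots> = diff E n (p n x)"
      unfolding ab(3) p_def ufst_upair usnd_upair diff_add[OF E ha gb] ..
    finally show "p (n + 1) (diff (cone A B f) n x) = diff E n (p n x)" .
  qed
  note pc = this
  have incl: "cone_incl A \<in> chain_maps R B (cone A B f)" by (rule cone_incl_chain_map[OF A B f])
  have "homotopic R B E (comp_map p (cone_incl A)) (comp_map (zero_map E) (cone_incl A))"
    by (rule homotopic_comp_right[OF cone[OF pc] cone_complexes[OF A B f] E B pc _ incl]) (use E in simp)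
  then show ?thesis
  proof (rule homotopic_cong)
    fix n x assume x: "x \<in> carrier (obj B n)"
    interpret E0: abelian_group "obj E n" using E by (rule complexes_group)
    show "comp_map p (cone_incl A) n x = g n x"
      using x chain_map_closed[OF g x] mod_hom_zero[OF h'[of n] complexes_group[OF A] complexes_group[OF E]]
      by (simp add: comp_map_def p_def cone_incl_def)
  qed simp
qed

lemma quasi_iso_null_homotopic:
  fixes W X E :: "('r, 'u) cochain"
  assumes s: "quasi_iso R W X s" and W: "W \<in> complexes R" and X: "X \<in> complexes R"
    and E: "two_term_injective R E m" and g: "g \<in> chain_maps R X E"
    and null: "homotopic R W E (comp_map g s) (zero_map E)"
  shows "homotopic R X E g (zero_map E)"
proof (rule null_homotopic_of_cone[OF W X two_term_injective_complexes[OF E] quasi_iso_chain_map[OF s] g null])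
  fix p assume p: "p \<in> chain_maps R (cone W X s) E"
  have C: "cone W X s \<in> complexes R" by (rule cone_complexes[OF W X quasi_iso_chain_map[OF s]])
  show "homotopic R (cone W X s) E p (zero_map E)"
  proof (rule null_homotopic_two_term[OF E C p])
    fix z assume "z \<in> cocycles (cone W X s) m"
    then have "z \<in> coboundaries (cone W X s) m" using cone_acyclic[OF W X s] by blast
    then show "p m z = \<zero>\<^bsub>obj E m\<^esub>" by (intro two_term_coboundaries[OF E] chain_map_coboundaries[OF p])
  qed (rule cone_acyclic[OF W X s])
qed

end


context universe
begin

text \<open>
  The map \<open>(w, x) \<mapsto> f w\<close> from the cone of \<open>s\<close> to \<open>E[1]\<close> is null homotopic, because the cone is
  acyclic.  Restricted to \<open>X\<close>, the null homotopy is the extension \<open>g\<close> of \<open>f\<close>; restricted to \<open>W\<close>, it is up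
  to sign the homotopy between \<open>f\<close> and \<open>g s\<close>.
\<close>

lemma quasi_iso_extend:
  fixes W X E :: "('r, 'u) cochain"
  assumes s: "quasi_iso R W X s" and W: "W \<in> complexes R" and X: "X \<in> complexes R"
    and E: "two_term_injective R E m" and f: "f \<in> chain_maps R W E"
  obtains g where "g \<in> chain_maps R X E" "homotopic R W E f (comp_map g s)"
proof -
  note EC = two_term_injective_complexes[OF E]
  note sc = quasi_iso_chain_map[OF s]
  have C: "cone W X s \<in> complexes R" by (rule cone_complexes[OF W X sc])
  have e: "n + 1 + 1 = n + 2" "n - 1 + 1 = n" "n - 1 + 2 = n + 1" "n + 1 - 1 = n" for n :: int by simp_all
  define p where "p = (\<lambda>n x. f (n + 1) (ufst x))"
  have p: "p \<in> chain_maps R (cone W X s) (shift 1 E)"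
  proof (rule chain_mapsI)
    fix n show "p n \<in> mod_hom R (obj (cone W X s) n) (obj (shift 1 E) n)"
      unfolding p_def cone_obj shift_obj by (rule mod_hom_comp[OF mod_hom_ufst chain_map_hom[OF f]])
  next
    fix n x assume "x \<in> carrier (obj (cone W X s) n)"
    then obtain w y where wy: "w \<in> carrier (obj W (n + 1))" "y \<in> carrier (obj X n)" "x = upair (w, y)"
      unfolding cone_obj by (rule direct_sumE)
    have dw: "diff W (n + 1) w \<in> carrier (obj W (n + 2))" using W wy by simp
    show "p (n + 1) (diff (cone W X s) n x) = diff (shift 1 E) n (p n x)"
      using chain_map_diff[OF f _ wy(1), of "n + 2"]
      unfolding p_def wy(3) cone_diff ufst_upair e chain_map_uminus[OF f W EC dw] shift_diff by simp
  qed
  have E1: "two_term_injective R (shift 1 E) (m - 1)" by (rule two_term_injective_shift[OF E])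
  note E1C = two_term_injective_complexes[OF E1]
  have "homotopic R (cone W X s) (shift 1 E) p (zero_map (shift 1 E))"
  proof (rule null_homotopic_two_term[OF E1 C p])
    fix z assume "z \<in> cocycles (cone W X s) (m - 1)"
    then have "z \<in> coboundaries (cone W X s) (m - 1)" using cone_acyclic[OF W X s] by blast
    then show "p (m - 1) z = \<zero>\<^bsub>obj (shift 1 E) (m - 1)\<^esub>"
      by (intro two_term_coboundaries[OF E1] chain_map_coboundaries[OF p])
  qed (rule cone_acyclic[OF W X s])
  then obtain H where H: "\<And>n. H n \<in> mod_hom R (obj (cone W X s) n) (obj (shift 1 E) (n - 1))"
    and "\<And>n x. x \<in> carrier (obj (cone W X s) n) \<Longrightarrow> H n x \<in> carrier (obj (shift 1 E) (n - 1))"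
    and "\<And>n x. x \<in> carrier (obj (cone W X s) n) \<Longrightarrow> H (n + 1) (diff (cone W X s) n x) \<in> carrier (obj (shift 1 E) n)"
    and Heq: "\<And>n x. x \<in> carrier (obj (cone W X s) n) \<Longrightarrow>
      p n x = (diff (shift 1 E) (n - 1) (H n x) \<oplus>\<^bsub>obj (shift 1 E) n\<^esub>
        H (n + 1) (diff (cone W X s) n x)) \<oplus>\<^bsub>obj (shift 1 E) n\<^esub> zero_map (shift 1 E) n x"
    using homotopicE[OF _ E1C C p chain_map_zero_map[OF E1C]] by blast
  have H': "H n \<in> mod_hom R (direct_sum (obj W (n + 1)) (obj X n)) (obj E n)" for n
    using H[of n] by simp
  have Hc: "H n (upair (w, x)) \<in> carrier (obj E n)"
    if "w \<in> carrier (obj W (n + 1))" "x \<in> carrier (obj X n)" for n w x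
    using mod_hom_closed[OF H'] that by simp
  have Hadd: "H n (upair (w \<oplus>\<^bsub>obj W (n + 1)\<^esub> w', x \<oplus>\<^bsub>obj X n\<^esub> x')) =
      H n (upair (w, x)) \<oplus>\<^bsub>obj E n\<^esub> H n (upair (w', x'))"
    if "w \<in> carrier (obj W (n + 1))" "x \<in> carrier (obj X n)"
       "w' \<in> carrier (obj W (n + 1))" "x' \<in> carrier (obj X n)" for n w x w' x'
    using mod_hom_add[OF H', of "upair (w, x)" n "upair (w', x')"] that by simp
  have Heq': "f (n + 1) w = \<ominus>\<^bsub>obj E (n + 1)\<^esub> diff E n (H n (upair (w, x))) \<oplus>\<^bsub>obj E (n + 1)\<^esub>
      H (n + 1) (upair (\<ominus>\<^bsub>obj W (n + 2)\<^esub> diff W (n + 1) w, s (n + 1) w \<oplus>\<^bsub>obj X (n + 1)\<^esub> diff X n x))"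
    if wx: "w \<in> carrier (obj W (n + 1))" "x \<in> carrier (obj X n)" for n w x
  proof -
    interpret E: abelian_group "obj E (n + 1)" using EC by (rule complexes_group)
    have 1: "diff W (n + 1) w \<in> carrier (obj W (n + 1 + 1))" using W wx by simp
    have 2: "s (n + 1) w \<oplus>\<^bsub>obj X (n + 1)\<^esub> diff X n x \<in> carrier (obj X (n + 1))"
      using sc X wx by simp
    have 3: "\<ominus>\<^bsub>obj W (n + 2)\<^esub> diff W (n + 1) w \<in> carrier (obj W (n + 1 + 1))"
      using uminus_obj_closed[OF W 1] unfolding e .
    have 4: "diff E n (H n (upair (w, x))) \<in> carrier (obj E (n + 1))"
      using Hc[OF wx] EC by simp
    have "upair (w, x) \<in> carrier (obj (cone W X s) n)" using wx by simp
    from Heq[OF this] show ?thesis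
      using Hc[OF 3 2] 4 unfolding p_def ufst_upair cone_diff shift_obj shift_diff zero_map_def e by simp
  qed
  define g where "g = (\<lambda>n x. H n (upair (\<zero>\<^bsub>obj W (n + 1)\<^esub>, x)))"
  have gh: "g n \<in> mod_hom R (obj X n) (obj E n)" for n
    unfolding g_def
    by (rule mod_hom_comp[OF mod_hom_pair[OF mod_hom_const_zero[OF complexes_module[OF W]] mod_hom_id] H'])
  have g: "g \<in> chain_maps R X E"
  proof (rule chain_mapsI[OF gh])
    fix n x assume x: "x \<in> carrier (obj X n)"
    interpret E: abelian_group "obj E (n + 1)" using EC by (rule complexes_group)
    interpret W: abelian_group "obj W (n + 2)" using W by (rule complexes_group)
    interpret X: abelian_group "obj X (n + 1)" using X by (rule complexes_group)
    have z: "\<zero>\<^bsub>obj W (n + 1)\<^esub> \<in> carrier (obj W (n + 1))" using W by simp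
    have dx: "diff X n x \<in> carrier (obj X (n + 1))" using X x by simp
    have 1: "g (n + 1) (diff X n x) \<in> carrier (obj E (n + 1))" using mod_hom_closed[OF gh dx] .
    have 2: "diff E n (g n x) \<in> carrier (obj E (n + 1))" using mod_hom_closed[OF gh x] EC by simp
    have d0: "diff W (n + 1) \<zero>\<^bsub>obj W (n + 1)\<^esub> = \<zero>\<^bsub>obj W (n + 2)\<^esub>"
      using diff_zero[OF W, of "n + 1"] unfolding e .
    have "\<zero>\<^bsub>obj E (n + 1)\<^esub> = \<ominus>\<^bsub>obj E (n + 1)\<^esub> diff E n (g n x) \<oplus>\<^bsub>obj E (n + 1)\<^esub> g (n + 1) (diff X n x)"
      using Heq'[OF z x] dx W.a_inv_zero
      unfolding g_def d0 chain_map_zero[OF f W EC] chain_map_zero[OF sc W X] e by simp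
    then have "\<ominus>\<^bsub>obj E (n + 1)\<^esub> diff E n (g n x) = \<ominus>\<^bsub>obj E (n + 1)\<^esub> g (n + 1) (diff X n x)"
      using E.add_eq_zero_iff[of "\<ominus>\<^bsub>obj E (n + 1)\<^esub> diff E n (g n x)" "g (n + 1) (diff X n x)"] 1 2 by simp
    then show "g (n + 1) (diff X n x) = diff E n (g n x)"
      using E.minus_minus[OF 1] E.minus_minus[OF 2] by metis
  qed
  have kh: "(\<lambda>x. \<ominus>\<^bsub>obj E (n - 1)\<^esub> H (n - 1) (upair (x, \<zero>\<^bsub>obj X (n - 1)\<^esub>))) \<in> mod_hom R (obj W n) (obj E (n - 1))" for n
  proof -
    have "(\<lambda>x. upair (x, \<zero>\<^bsub>obj X (n - 1)\<^esub>)) \<in> mod_hom R (obj W n) (direct_sum (obj W (n - 1 + 1)) (obj X (n - 1)))"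
      using mod_hom_pair[OF mod_hom_id mod_hom_const_zero[OF complexes_module[OF X]]] by simp
    from mod_hom_neg[OF mod_hom_comp[OF this H'] complexes_module[OF EC]] show ?thesis .
  qed
  have "homotopic R W E f (comp_map g s)"
  proof (rule homotopicI[OF EC W f chain_map_comp[OF sc g] kh])
    fix n w assume w: "w \<in> carrier (obj W n)"
    interpret E: abelian_group "obj E n" using EC by (rule complexes_group)
    interpret X: abelian_group "obj X n" using X by (rule complexes_group)
    interpret W: abelian_group "obj W (n + 1)" using W by (rule complexes_group)
    have w': "w \<in> carrier (obj W (n - 1 + 1))" using w by simp
    have z: "\<zero>\<^bsub>obj X (n - 1)\<^esub> \<in> carrier (obj X (n - 1))" "\<zero>\<^bsub>obj X n\<^esub> \<in> carrier (obj X n)" using X by simp_all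
    have dw: "diff W n w \<in> carrier (obj W (n + 1))" using W w by simp
    have ndw: "\<ominus>\<^bsub>obj W (n + 1)\<^esub> diff W n w \<in> carrier (obj W (n + 1))" using W dw by simp
    have sw: "s n w \<in> carrier (obj X n)" using sc w by simp
    have d0: "diff X (n - 1) \<zero>\<^bsub>obj X (n - 1)\<^esub> = \<zero>\<^bsub>obj X n\<^esub>"
      using diff_zero[OF X, of "n - 1"] by simp
    have k1: "H (n - 1) (upair (w, \<zero>\<^bsub>obj X (n - 1)\<^esub>)) \<in> carrier (obj E (n - 1))"
      by (rule Hc[OF w' z(1)])
    have k2: "H n (upair (diff W n w, \<zero>\<^bsub>obj X n\<^esub>)) \<in> carrier (obj E n)" by (rule Hc[OF dw z(2)])
    have dk: "diff E (n - 1) (H (n - 1) (upair (w, \<zero>\<^bsub>obj X (n - 1)\<^esub>))) \<in> carrier (obj E n)"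
      using EC k1 by simp
    have gs: "g n (s n w) \<in> carrier (obj E n)" using g sw by simp
    have "H n (upair (\<ominus>\<^bsub>obj W (n + 1)\<^esub> diff W n w, \<zero>\<^bsub>obj X n\<^esub>)) =
        \<ominus>\<^bsub>obj E n\<^esub> H n (upair (diff W n w, \<zero>\<^bsub>obj X n\<^esub>))"
    proof -
      have u: "\<ominus>\<^bsub>direct_sum (obj W (n + 1)) (obj X n)\<^esub> upair (diff W n w, \<zero>\<^bsub>obj X n\<^esub>) =
          upair (\<ominus>\<^bsub>obj W (n + 1)\<^esub> diff W n w, \<zero>\<^bsub>obj X n\<^esub>)"
        using direct_sum_uminus[OF complexes_small_module[OF W] complexes_small_module[OF X] dw z(2)] by simp
      have "abelian_group (direct_sum (obj W (n + 1)) (obj X n))"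
        using complexes_group[OF C, of n] by simp
      from mod_hom_uminus[OF H' this complexes_group[OF EC], of "upair (diff W n w, \<zero>\<^bsub>obj X n\<^esub>)"]
      show ?thesis unfolding u using dw z by simp
    qed
    moreover have "H n (upair (\<ominus>\<^bsub>obj W (n + 1)\<^esub> diff W n w, s n w)) =
        H n (upair (\<ominus>\<^bsub>obj W (n + 1)\<^esub> diff W n w, \<zero>\<^bsub>obj X n\<^esub>)) \<oplus>\<^bsub>obj E n\<^esub> g n (s n w)"
      using Hadd[OF ndw z(2) _ sw, of "\<zero>\<^bsub>obj W (n + 1)\<^esub>"] W ndw sw by (simp add: g_def)
    ultimately have "f n w = \<ominus>\<^bsub>obj E n\<^esub> diff E (n - 1) (H (n - 1) (upair (w, \<zero>\<^bsub>obj X (n - 1)\<^esub>))) \<oplus>\<^bsub>obj E n\<^esub>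
        (\<ominus>\<^bsub>obj E n\<^esub> H n (upair (diff W n w, \<zero>\<^bsub>obj X n\<^esub>)) \<oplus>\<^bsub>obj E n\<^esub> g n (s n w))"
      using Heq'[OF w' z(1)] sw unfolding e d0 by simp
    then show "f n w = (diff E (n - 1) (\<ominus>\<^bsub>obj E (n - 1)\<^esub> H (n - 1) (upair (w, \<zero>\<^bsub>obj X (n - 1)\<^esub>))) \<oplus>\<^bsub>obj E n\<^esub>
        \<ominus>\<^bsub>obj E (n + 1 - 1)\<^esub> H (n + 1 - 1) (upair (diff W n w, \<zero>\<^bsub>obj X (n + 1 - 1)\<^esub>))) \<oplus>\<^bsub>obj E n\<^esub> comp_map g s n w"
      using dk k2 gs diff_uminus[OF EC k1] unfolding e comp_map_def by (simp add: E.a_assoc)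
  qed
  then show thesis using that g by blast
qed

text \<open>
  The homotopy pullback of \<open>f : X \<rightarrow> Y\<close> and \<open>t : Y' \<rightarrow> Y\<close>: a chain map into it is a pair of chain
  maps to \<open>X\<close> and \<open>Y'\<close> with a chosen homotopy between their composites to \<open>Y\<close>.
\<close>

definition hpullback :: "('r, 'u) cochain \<Rightarrow> ('r, 'u) cochain \<Rightarrow> ('r, 'u) cochain \<Rightarrow>
    (int \<Rightarrow> 'u \<Rightarrow> 'u) \<Rightarrow> (int \<Rightarrow> 'u \<Rightarrow> 'u) \<Rightarrow> ('r, 'u) cochain" where
  "hpullback X Y' Y f t =
     \<lparr> obj = (\<lambda>n. direct_sum (obj X n) (direct_sum (obj Y' n) (obj Y (n - 1)))),
       diff = (\<lambda>n x. upair (diff X n (ufst x), upair (diff Y' n (ufst (usnd x)),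
         (f n (ufst x) \<ominus>\<^bsub>obj Y n\<^esub> t n (ufst (usnd x)))
           \<ominus>\<^bsub>obj Y n\<^esub> diff Y (n - 1) (usnd (usnd x))))) \<rparr>"

lemma hpullback_obj [simp]:
  "obj (hpullback X Y' Y f t) n = direct_sum (obj X n) (direct_sum (obj Y' n) (obj Y (n - 1)))"
  by (simp add: hpullback_def)

lemma hpullback_diff [simp]:
  "diff (hpullback X Y' Y f t) n (upair (x, upair (y', y))) = upair (diff X n x, upair (diff Y' n y',
     (f n x \<ominus>\<^bsub>obj Y n\<^esub> t n y') \<ominus>\<^bsub>obj Y n\<^esub> diff Y (n - 1) y))"
  by (simp add: hpullback_def)

lemma hpullbackE:
  assumes "p \<in> carrier (obj (hpullback X Y' Y f t) n)"
  obtains x y' y where "x \<in> carrier (obj X n)" "y' \<in> carrier (obj Y' n)" "y \<in> carrier (obj Y (n - 1))"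
    "p = upair (x, upair (y', y))"
  using assms unfolding hpullback_obj by (metis direct_sumE)

context
  fixes R :: "'r ring" and X Y' Y :: "('r, 'u) cochain" and f t :: "int \<Rightarrow> 'u \<Rightarrow> 'u"
  assumes X: "X \<in> complexes R" and Y': "Y' \<in> complexes R" and Y: "Y \<in> complexes R"
    and f: "f \<in> chain_maps R X Y" and t: "t \<in> chain_maps R Y' Y"
begin

lemma hpullback_complexes: "hpullback X Y' Y f t \<in> complexes R"
proof (rule complexesI)
  fix n show "small_module R (obj (hpullback X Y' Y f t) n)"
    unfolding hpullback_obj
    by (intro direct_sum_small_module complexes_small_module X Y Y')
next
  fix n
  have dY: "diff Y (n - 1) \<in> mod_hom R (obj Y (n - 1)) (obj Y n)" by (rule diff_hom[OF Y]) simp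
  have e: "n + 1 - 1 = n" by simp
  show "diff (hpullback X Y' Y f t) n \<in> mod_hom R (obj (hpullback X Y' Y f t) n) (obj (hpullback X Y' Y f t) (n + 1))"
    unfolding hpullback_obj e unfolding hpullback_def cochain.simps
    by (intro mod_hom_pair mod_hom_diff complexes_module Y mod_hom_comp[OF mod_hom_ufst diff_hom[OF X refl]]
       mod_hom_comp[OF mod_hom_comp[OF mod_hom_usnd mod_hom_ufst] diff_hom[OF Y' refl]]
       mod_hom_comp[OF mod_hom_ufst chain_map_hom[OF f]]
       mod_hom_comp[OF mod_hom_comp[OF mod_hom_usnd mod_hom_ufst] chain_map_hom[OF t]]
       mod_hom_comp[OF mod_hom_comp[OF mod_hom_usnd mod_hom_usnd] dY])
next
  fix n p assume "p \<in> carrier (obj (hpullback X Y' Y f t) n)"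
  then obtain x y' y where p: "x \<in> carrier (obj X n)" "y' \<in> carrier (obj Y' n)" "y \<in> carrier (obj Y (n - 1))"
    "p = upair (x, upair (y', y))" by (rule hpullbackE)
  interpret Y1: abelian_group "obj Y (n + 1)" using Y by (rule complexes_group)
  have dy: "diff Y (n - 1) y \<in> carrier (obj Y n)" using Y p by simp
  have c: "f n x \<in> carrier (obj Y n)" "t n y' \<in> carrier (obj Y n)" using f t p by simp_all
  have e: "n + 1 - 1 = n" "n + 2 - 1 = n + 1" by simp_all
  have 1: "diff Y n (diff Y (n - 1) y) = \<zero>\<^bsub>obj Y (n + 1)\<^esub>"
    by (rule diff_diff[OF Y _ _ p(3)]) simp_all
  have 2: "diff Y n ((f n x \<ominus>\<^bsub>obj Y n\<^esub> t n y') \<ominus>\<^bsub>obj Y n\<^esub> diff Y (n - 1) y) =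
      (diff Y n (f n x) \<ominus>\<^bsub>obj Y (n + 1)\<^esub> diff Y n (t n y')) \<ominus>\<^bsub>obj Y (n + 1)\<^esub> \<zero>\<^bsub>obj Y (n + 1)\<^esub>"
    using c dy Y by (simp add: diff_minus 1)
  have d: "diff Y n (f n x) \<in> carrier (obj Y (n + 1))" "diff Y n (t n y') \<in> carrier (obj Y (n + 1))"
    using c Y by simp_all
  have 3: "(diff Y n (f n x) \<ominus>\<^bsub>obj Y (n + 1)\<^esub> diff Y n (t n y')) \<ominus>\<^bsub>obj Y (n + 1)\<^esub>
      ((diff Y n (f n x) \<ominus>\<^bsub>obj Y (n + 1)\<^esub> diff Y n (t n y')) \<ominus>\<^bsub>obj Y (n + 1)\<^esub> \<zero>\<^bsub>obj Y (n + 1)\<^esub>) = \<zero>\<^bsub>obj Y (n + 1)\<^esub>"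
    using d by algebra
  show "diff (hpullback X Y' Y f t) (n + 1) (diff (hpullback X Y' Y f t) n p) = \<zero>\<^bsub>obj (hpullback X Y' Y f t) (n + 2)\<^esub>"
    unfolding p(4) hpullback_diff hpullback_obj direct_sum_zero e
      chain_map_diff[OF f refl p(1)] chain_map_diff[OF t refl p(2)] 2 3
      diff_diff[OF X refl refl p(1)] diff_diff[OF Y' refl refl p(2)] ..
qed

lemma hpullback_proj1: "(\<lambda>n. ufst) \<in> chain_maps R (hpullback X Y' Y f t) X"
  by (rule chain_mapsI) (auto simp: mod_hom_ufst elim!: direct_sumE)

lemma hpullback_proj2: "(\<lambda>n x. ufst (usnd x)) \<in> chain_maps R (hpullback X Y' Y f t) Y'"
  by (rule chain_mapsI)
    (auto simp: mod_hom_comp[OF mod_hom_usnd mod_hom_ufst] elim!: direct_sumE)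

lemma hpullback_homotopy:
  "homotopic R (hpullback X Y' Y f t) Y (comp_map f (\<lambda>n. ufst)) (comp_map t (\<lambda>n x. ufst (usnd x)))"
proof (rule homotopicI[where h = "\<lambda>n x. usnd (usnd x)"])
  fix n p assume "p \<in> carrier (obj (hpullback X Y' Y f t) n)"
  then obtain x y' y where p: "x \<in> carrier (obj X n)" "y' \<in> carrier (obj Y' n)" "y \<in> carrier (obj Y (n - 1))"
    "p = upair (x, upair (y', y))" by (rule hpullbackE)
  interpret Y: abelian_group "obj Y n" using Y by (rule complexes_group)
  have dy: "diff Y (n - 1) y \<in> carrier (obj Y n)" using Y p by simp
  have c: "f n x \<in> carrier (obj Y n)" "t n y' \<in> carrier (obj Y n)" using f t p by simp_all
  show "comp_map f (\<lambda>n. ufst) n p = (diff Y (n - 1) (usnd (usnd p)) \<oplus>\<^bsub>obj Y n\<^esub>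
      usnd (usnd (diff (hpullback X Y' Y f t) n p))) \<oplus>\<^bsub>obj Y n\<^esub> comp_map t (\<lambda>n x. ufst (usnd x)) n p"
    unfolding comp_map_def p(4) hpullback_diff ufst_upair usnd_upair using dy c by algebra
next
  fix n show "(\<lambda>x. usnd (usnd x)) \<in> mod_hom R (obj (hpullback X Y' Y f t) n) (obj Y (n - 1))"
    unfolding hpullback_obj by (rule mod_hom_comp[OF mod_hom_usnd mod_hom_usnd])
qed (rule Y hpullback_complexes chain_map_comp[OF hpullback_proj1 f] chain_map_comp[OF hpullback_proj2 t])+

lemma hpullback_lift:
  assumes W: "W \<in> complexes R" and u: "u \<in> chain_maps R W X" and v: "v \<in> chain_maps R W Y'"
    and hom: "homotopic R W Y (comp_map f u) (comp_map t v)"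
  obtains p where "p \<in> chain_maps R W (hpullback X Y' Y f t)"
    "comp_map (\<lambda>n. ufst) p = u" "comp_map (\<lambda>n x. ufst (usnd x)) p = v"
proof -
  obtain h where h: "\<And>n. h n \<in> mod_hom R (obj W n) (obj Y (n - 1))"
    and hc: "\<And>n x. x \<in> carrier (obj W n) \<Longrightarrow> h n x \<in> carrier (obj Y (n - 1))"
    and hd: "\<And>n x. x \<in> carrier (obj W n) \<Longrightarrow> h (n + 1) (diff W n x) \<in> carrier (obj Y n)"
    and eq: "\<And>n x. x \<in> carrier (obj W n) \<Longrightarrow> comp_map f u n x =
      (diff Y (n - 1) (h n x) \<oplus>\<^bsub>obj Y n\<^esub> h (n + 1) (diff W n x)) \<oplus>\<^bsub>obj Y n\<^esub> comp_map t v n x"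
    using homotopicE[OF hom Y W chain_map_comp[OF u f] chain_map_comp[OF v t]] by blast
  define p where "p = (\<lambda>n x. upair (u n x, upair (v n x, h n x)))"
  have "p \<in> chain_maps R W (hpullback X Y' Y f t)"
  proof (rule chain_mapsI)
    fix n show "p n \<in> mod_hom R (obj W n) (obj (hpullback X Y' Y f t) n)"
      unfolding p_def hpullback_obj by (intro mod_hom_pair chain_map_hom[OF u] chain_map_hom[OF v] h)
  next
    fix n x assume x: "x \<in> carrier (obj W n)"
    interpret Y: abelian_group "obj Y n" using Y by (rule complexes_group)
    have dh: "diff Y (n - 1) (h n x) \<in> carrier (obj Y n)" using hc[OF x] Y by simp
    have tv: "t n (v n x) \<in> carrier (obj Y n)" using t v x by simp
    have "f n (u n x) = (diff Y (n - 1) (h n x) \<oplus>\<^bsub>obj Y n\<^esub> h (n + 1) (diff W n x)) \<oplus>\<^bsub>obj Y n\<^esub> t n (v n x)"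
      using eq[OF x] by (simp add: comp_map_def)
    then have "(f n (u n x) \<ominus>\<^bsub>obj Y n\<^esub> t n (v n x)) \<ominus>\<^bsub>obj Y n\<^esub> diff Y (n - 1) (h n x) =
       ((diff Y (n - 1) (h n x) \<oplus>\<^bsub>obj Y n\<^esub> h (n + 1) (diff W n x)) \<oplus>\<^bsub>obj Y n\<^esub> t n (v n x)
         \<ominus>\<^bsub>obj Y n\<^esub> t n (v n x)) \<ominus>\<^bsub>obj Y n\<^esub> diff Y (n - 1) (h n x)" by simp
    also have "\<dots> = h (n + 1) (diff W n x)" using dh tv hd[OF x] by algebra
    finally show "p (n + 1) (diff W n x) = diff (hpullback X Y' Y f t) n (p n x)"
      unfolding p_def hpullback_diff chain_map_diff[OF u refl x] chain_map_diff[OF v refl x] by simp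
  qed
  then show thesis by (rule that) (simp_all add: p_def comp_map_def)
qed

text \<open>
  The fibre of the projection to \<open>X\<close> is the shifted cone of \<open>t\<close>, which is acyclic.  The proof chases
  elements: a cocycle is a triple \<open>(x, y', y)\<close> of cocycles \<open>x\<close>, \<open>y'\<close> with \<open>f x - t y' = d y\<close>.
\<close>

lemma hpullback_quasi_iso:
  assumes qt: "quasi_iso R Y' Y t"
  shows "quasi_iso R (hpullback X Y' Y f t) X (\<lambda>n. ufst)"
proof -
  have inj: "coh_inj Y' Y t" and surj: "coh_surj Y' Y t" using qt unfolding quasi_iso_iff[OF Y' Y] by auto
  note P = hpullback_complexes
  have "coh_inj (hpullback X Y' Y f t) X (\<lambda>n. ufst)"
    unfolding coh_inj_def
  proof (intro allI ballI impI)
    fix n p assume p: "p \<in> cocycles (hpullback X Y' Y f t) n" "ufst p \<in> coboundaries X n"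
    obtain x y' y where q: "x \<in> carrier (obj X n)" "y' \<in> carrier (obj Y' n)" "y \<in> carrier (obj Y (n - 1))"
      "p = upair (x, upair (y', y))" using cocycles_closed[OF p(1)] by (rule hpullbackE)
    interpret Y: abelian_group "obj Y n" using Y by (rule complexes_group)
    interpret Y0: abelian_group "obj Y (n - 1)" using Y by (rule complexes_group)
    have e: "n + 1 - 1 = n" "n - 1 + 1 = n" "n - 1 - 1 = n - 2" "n - 2 + 1 = n - 1" by simp_all
    have c: "f n x \<in> carrier (obj Y n)" "t n y' \<in> carrier (obj Y n)" "diff Y (n - 1) y \<in> carrier (obj Y n)"
      using f t q Y by simp_all
    have z: "diff Y' n y' = \<zero>\<^bsub>obj Y' (n + 1)\<^esub>"
      "(f n x \<ominus>\<^bsub>obj Y n\<^esub> t n y') \<ominus>\<^bsub>obj Y n\<^esub> diff Y (n - 1) y = \<zero>\<^bsub>obj Y n\<^esub>"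
      using cocycles_diff[OF p(1)] unfolding q(4) hpullback_diff hpullback_obj e by simp_all
    have fx: "f n x \<ominus>\<^bsub>obj Y n\<^esub> t n y' = diff Y (n - 1) y"
      using z(2) c by (simp add: Y.minus_eq_zero_iff)
    obtain u where u: "u \<in> carrier (obj X (n - 1))" "x = diff X (n - 1) u"
      using p(2) e(2)[symmetric] unfolding q(4) ufst_upair by (rule coboundariesE)
    have fu: "f (n - 1) u \<in> carrier (obj Y (n - 1))" using f u by simp
    have dfu: "diff Y (n - 1) (f (n - 1) u) = f n x"
      unfolding u(2) using chain_map_diff[OF f e(2)[symmetric] u(1)] by simp
    have "t n y' = diff Y (n - 1) (f (n - 1) u \<ominus>\<^bsub>obj Y (n - 1)\<^esub> y)"
    proof -
      have "t n y' = f n x \<ominus>\<^bsub>obj Y n\<^esub> (f n x \<ominus>\<^bsub>obj Y n\<^esub> t n y')" using c by algebra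
      then show ?thesis unfolding fx using diff_minus[OF Y fu q(3)] dfu by simp
    qed
    then have "t n y' \<in> coboundaries Y n"
      using coboundariesI[of "f (n - 1) u \<ominus>\<^bsub>obj Y (n - 1)\<^esub> y" Y "n - 1" n] fu q(3) Y by simp
    then have "y' \<in> coboundaries Y' n" using inj cocyclesI[OF q(2) z(1)] unfolding coh_inj_def by blast
    then obtain v where v: "v \<in> carrier (obj Y' (n - 1))" "y' = diff Y' (n - 1) v"
      using e(2)[symmetric] by (rule coboundariesE)
    have tv: "t (n - 1) v \<in> carrier (obj Y (n - 1))" using t v by simp
    have dtv: "diff Y (n - 1) (t (n - 1) v) = t n y'"
      unfolding v(2) using chain_map_diff[OF t e(2)[symmetric] v(1)] by simp
    define k where "k = (f (n - 1) u \<ominus>\<^bsub>obj Y (n - 1)\<^esub> t (n - 1) v) \<ominus>\<^bsub>obj Y (n - 1)\<^esub> y"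
    have kc: "k \<in> carrier (obj Y (n - 1))" unfolding k_def using fu tv q(3) Y by simp
    have "k \<in> cocycles Y (n - 1)"
      using kc diff_minus[OF Y _ q(3), of "f (n - 1) u \<ominus>\<^bsub>obj Y (n - 1)\<^esub> t (n - 1) v"]
        diff_minus[OF Y fu tv] fu tv Y dfu dtv z(2)
      by (intro cocyclesI) (simp_all add: k_def)
    then obtain v' where v': "v' \<in> cocycles Y' (n - 1)"
        "k \<ominus>\<^bsub>obj Y (n - 1)\<^esub> t (n - 1) v' \<in> coboundaries Y (n - 1)"
      using surj unfolding coh_surj_def by blast
    have tv': "t (n - 1) v' \<in> carrier (obj Y (n - 1))" using t v' by simp
    obtain w where w: "w \<in> carrier (obj Y (n - 2))" "k \<ominus>\<^bsub>obj Y (n - 1)\<^esub> t (n - 1) v' = diff Y (n - 2) w"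
      using v'(2) e(4)[symmetric] by (rule coboundariesE)
    let ?q = "upair (u, upair (v \<oplus>\<^bsub>obj Y' (n - 1)\<^esub> v', w))"
    have v'c: "v' \<in> carrier (obj Y' (n - 1))" using v' by simp
    have qc: "?q \<in> carrier (obj (hpullback X Y' Y f t) (n - 1))"
      using u v v'c w Y' by simp
    have 1: "diff Y' (n - 1) (v \<oplus>\<^bsub>obj Y' (n - 1)\<^esub> v') = y'"
    proof -
      interpret Y': abelian_group "obj Y' n" using Y' by (rule complexes_group)
      show ?thesis using diff_add[OF Y' v(1) v'c] cocycles_diff[OF v'(1)] v(2) q(2) by simp
    qed
    have 2: "(f (n - 1) u \<ominus>\<^bsub>obj Y (n - 1)\<^esub> t (n - 1) (v \<oplus>\<^bsub>obj Y' (n - 1)\<^esub> v')) \<ominus>\<^bsub>obj Y (n - 1)\<^esub> diff Y (n - 2) w = y"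
      unfolding w(2)[symmetric] chain_map_add[OF t v(1) v'c] k_def using fu tv tv' q(3) by algebra
    have "p = diff (hpullback X Y' Y f t) (n - 1) ?q"
      unfolding hpullback_diff e(3) 1 2 using q(4) u(2) by simp
    then show "p \<in> coboundaries (hpullback X Y' Y f t) n" using coboundariesI[OF qc e(2)[symmetric]] by simp
  qed
  moreover have "coh_surj (hpullback X Y' Y f t) X (\<lambda>n. ufst)"
    unfolding coh_surj_def
  proof (intro allI ballI)
    fix n x assume x: "x \<in> cocycles X n"
    interpret Y: abelian_group "obj Y n" using Y by (rule complexes_group)
    interpret X: abelian_group "obj X n" using X by (rule complexes_group)
    have e: "n + 1 - 1 = n" "n - 1 + 1 = n" by simp_all
    obtain y' where y': "y' \<in> cocycles Y' n" "f n x \<ominus>\<^bsub>obj Y n\<^esub> t n y' \<in> coboundaries Y n"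
      using surj chain_map_cocycles[OF f X Y x] unfolding coh_surj_def by blast
    obtain y where y: "y \<in> carrier (obj Y (n - 1))" "f n x \<ominus>\<^bsub>obj Y n\<^esub> t n y' = diff Y (n - 1) y"
      using y'(2) e(2)[symmetric] by (rule coboundariesE)
    have "upair (x, upair (y', y)) \<in> cocycles (hpullback X Y' Y f t) n"
    proof (rule cocyclesI)
      have "diff Y (n - 1) y \<in> carrier (obj Y n)" using y Y by simp
      then show "diff (hpullback X Y' Y f t) n (upair (x, upair (y', y))) = \<zero>\<^bsub>obj (hpullback X Y' Y f t) (n + 1)\<^esub>"
        unfolding hpullback_diff hpullback_obj e y(2) cocycles_diff[OF x] cocycles_diff[OF y'(1)]
        by (simp add: Y.minus_eq Y.r_neg)
    qed (use x y' y in simp)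
    moreover have "x \<ominus>\<^bsub>obj X n\<^esub> ufst (upair (x, upair (y', y))) \<in> coboundaries X n"
      using coboundaries_zero[OF X, of n] x by (simp add: X.minus_eq X.r_neg)
    ultimately show "\<exists>z\<in>cocycles (hpullback X Y' Y f t) n. x \<ominus>\<^bsub>obj X n\<^esub> ufst z \<in> coboundaries X n" by blast
  qed
  ultimately show ?thesis unfolding quasi_iso_iff[OF P X] using hpullback_proj1 by blast
qed

text \<open>
  Quasi-isomorphisms satisfy the Ore condition up to homotopy, so roofs can be composed.
\<close>

lemma ore:
  assumes qt: "quasi_iso R Y' Y t"
  obtains V a b where "V \<in> complexes R" "quasi_iso R V X a" "b \<in> chain_maps R V Y'"
    "homotopic R V Y (comp_map f a) (comp_map t b)"
  using that[OF hpullback_complexes hpullback_quasi_iso[OF qt] hpullback_proj2 hpullback_homotopy] .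

end

end


section \<open>Calculus in the homotopy category\<close>

text \<open>
  Homotopy and quasi-isomorphism are bundled with their typing conditions, so that chains of
  homotopies can be composed without side conditions.
\<close>

definition heq ::
  "'r ring \<Rightarrow> ('r, 'u) cochain \<Rightarrow> ('r, 'u) cochain \<Rightarrow> (int \<Rightarrow> 'u \<Rightarrow> 'u) \<Rightarrow> (int \<Rightarrow> 'u \<Rightarrow> 'u) \<Rightarrow> bool" where
  "heq R X Y f g \<longleftrightarrow> X \<in> complexes R \<and> Y \<in> complexes R \<and> f \<in> chain_maps R X Y \<and>
     g \<in> chain_maps R X Y \<and> homotopic R X Y f g"

definition qis :: "'r ring \<Rightarrow> ('r, 'u) cochain \<Rightarrow> ('r, 'u) cochain \<Rightarrow> (int \<Rightarrow> 'u \<Rightarrow> 'u) \<Rightarrow> bool" where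
  "qis R X Y f \<longleftrightarrow> X \<in> complexes R \<and> Y \<in> complexes R \<and> quasi_iso R X Y f"

lemma heqD:
  assumes "heq R X Y f g"
  shows "X \<in> complexes R" "Y \<in> complexes R" "f \<in> chain_maps R X Y" "g \<in> chain_maps R X Y"
    "homotopic R X Y f g"
  using assms by (auto simp: heq_def)

lemma qisD:
  assumes "qis R X Y f"
  shows "X \<in> complexes R" "Y \<in> complexes R" "f \<in> chain_maps R X Y" "quasi_iso R X Y f"
    "coh_inj X Y f" "coh_surj X Y f"
  using assms quasi_iso_iff[of X R Y f] by (auto simp: qis_def)

lemma heq_refl: "X \<in> complexes R \<Longrightarrow> Y \<in> complexes R \<Longrightarrow> f \<in> chain_maps R X Y \<Longrightarrow> heq R X Y f f"
  by (simp add: heq_def homotopic_refl)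

lemma heq_sym: "heq R X Y f g \<Longrightarrow> heq R X Y g f"
  using homotopic_sym[of R X Y f g] by (simp add: heq_def)

lemma heq_trans [trans]: "heq R X Y f g \<Longrightarrow> heq R X Y g h \<Longrightarrow> heq R X Y f h"
  using homotopic_trans[of R X Y f g h] by (simp add: heq_def)

lemma heq_left:
  assumes "heq R X Y f g" "e \<in> chain_maps R Y Z" "Z \<in> complexes R"
  shows "heq R X Z (comp_map e f) (comp_map e g)"
  using assms(2,3) heqD[OF assms(1)] chain_map_comp homotopic_comp_left[OF heqD(5)[OF assms(1)]]
  unfolding heq_def by metis

lemma heq_right:
  assumes "heq R X Y f g" "e \<in> chain_maps R W X" "W \<in> complexes R"
  shows "heq R W Y (comp_map f e) (comp_map g e)"
  using assms(2,3) heqD[OF assms(1)] chain_map_comp homotopic_comp_right[OF heqD(5)[OF assms(1)]]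
  unfolding heq_def by metis

lemma heq_cong:
  assumes "X \<in> complexes R" "Y \<in> complexes R" "f \<in> chain_maps R X Y" "g \<in> chain_maps R X Y"
    "\<And>n x. x \<in> carrier (obj X n) \<Longrightarrow> f n x = g n x"
  shows "heq R X Y f g"
  using homotopic_cong[OF homotopic_refl[OF assms(1-3)], of f g] assms by (simp add: heq_def)

lemma heq_comp_zero:
  assumes "X \<in> complexes R" "Y \<in> complexes R" "Z \<in> complexes R" "e \<in> chain_maps R Y Z"
  shows "heq R X Z (comp_map e (zero_map Y)) (zero_map Z)"
  by (rule heq_cong[OF assms(1,3) chain_map_comp[OF chain_map_zero_map[OF assms(2)] assms(4)]
      chain_map_zero_map[OF assms(3)]])
    (simp add: comp_map_def zero_map_def chain_map_zero[OF assms(4,2,3)])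

lemma heq_null_left:
  assumes "heq R X Y f (zero_map Y)" "e \<in> chain_maps R Y Z" "Z \<in> complexes R"
  shows "heq R X Z (comp_map e f) (zero_map Z)"
  using heq_trans[OF heq_left[OF assms] heq_comp_zero[OF heqD(1,2)[OF assms(1)] assms(3,2)]] .

lemma heq_null_right:
  assumes "heq R X Y f (zero_map Y)" "e \<in> chain_maps R W X" "W \<in> complexes R"
  shows "heq R W Y (comp_map f e) (zero_map Y)"
  using heq_right[OF assms] by simp

definition sub_map :: "('r, 'u) cochain \<Rightarrow> (int \<Rightarrow> 'u \<Rightarrow> 'u) \<Rightarrow> (int \<Rightarrow> 'u \<Rightarrow> 'u) \<Rightarrow> int \<Rightarrow> 'u \<Rightarrow> 'u" where
  "sub_map Y f g = (\<lambda>n x. f n x \<ominus>\<^bsub>obj Y n\<^esub> g n x)"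

lemma sub_map_chain_map:
  assumes "f \<in> chain_maps R X Y" "g \<in> chain_maps R X Y" "Y \<in> complexes R"
  shows "sub_map Y f g \<in> chain_maps R X Y"
proof (rule chain_mapsI)
  fix n show "sub_map Y f g n \<in> mod_hom R (obj X n) (obj Y n)"
    unfolding sub_map_def
    by (rule mod_hom_diff[OF chain_map_hom[OF assms(1)] chain_map_hom[OF assms(2)] complexes_module[OF assms(3)]])
next
  fix n x assume "x \<in> carrier (obj X n)"
  then show "sub_map Y f g (n + 1) (diff X n x) = diff Y n (sub_map Y f g n x)"
    using assms by (simp add: sub_map_def chain_map_diff diff_minus chain_map_closed[OF assms(1)] chain_map_closed[OF assms(2)])
qed

lemma heq_iff_sub_map:
  assumes X: "X \<in> complexes R" and Y: "Y \<in> complexes R" and f: "f \<in> chain_maps R X Y" and g: "g \<in> chain_maps R X Y"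
  shows "heq R X Y f g \<longleftrightarrow> heq R X Y (sub_map Y f g) (zero_map Y)"
proof -
  have "sub_map Y f g n x \<ominus>\<^bsub>obj Y n\<^esub> zero_map Y n x = f n x \<ominus>\<^bsub>obj Y n\<^esub> g n x"
    if "x \<in> carrier (obj X n)" for n x
  proof -
    interpret abelian_group "obj Y n" using Y by (rule complexes_group)
    have "f n x \<in> carrier (obj Y n)" "g n x \<in> carrier (obj Y n)" using f g that by simp_all
    then show ?thesis unfolding sub_map_def zero_map_def by algebra
  qed
  then have "homotopic R X Y (sub_map Y f g) (zero_map Y) \<longleftrightarrow> homotopic R X Y f g"
    unfolding homotopic_def by simp
  then show ?thesis using assms sub_map_chain_map[OF f g Y] by (simp add: heq_def)
qed

lemma qis_id: "X \<in> complexes R \<Longrightarrow> qis R X X id_map"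
  by (simp add: qis_def quasi_iso_id)

lemma qis_comp: "qis R X Y f \<Longrightarrow> qis R Y Z g \<Longrightarrow> qis R X Z (comp_map g f)"
  using quasi_iso_comp unfolding qis_def by metis

lemma qis_cancel:
  "qis R X Z (comp_map g f) \<Longrightarrow> qis R Y Z g \<Longrightarrow> f \<in> chain_maps R X Y \<Longrightarrow> qis R X Y f"
  using quasi_iso_cancel unfolding qis_def by metis

lemma qis_heq: "qis R X Y f \<Longrightarrow> heq R X Y f g \<Longrightarrow> qis R X Y g"
  using quasi_iso_homotopic unfolding qis_def heq_def by metis

lemma coh_inj_cancel_right:
  assumes "coh_inj X Z (comp_map g f)" "coh_surj X Y f" "f \<in> chain_maps R X Y" "g \<in> chain_maps R Y Z"
    "X \<in> complexes R" "Y \<in> complexes R" "Z \<in> complexes R"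
  shows "coh_inj Y Z g"
  unfolding coh_inj_def
proof (intro allI ballI impI)
  fix n y assume y: "y \<in> cocycles Y n" "g n y \<in> coboundaries Z n"
  interpret Y: abelian_group "obj Y n" using assms(6) by (rule complexes_group)
  interpret Z: abelian_group "obj Z n" using assms(7) by (rule complexes_group)
  obtain x where x: "x \<in> cocycles X n" "y \<ominus>\<^bsub>obj Y n\<^esub> f n x \<in> coboundaries Y n"
    using assms(2) y(1) unfolding coh_surj_def by blast
  have c: "f n x \<in> carrier (obj Y n)" "y \<in> carrier (obj Y n)" using assms(3) x y by simp_all
  have gc: "g n (f n x) \<in> carrier (obj Z n)" "g n y \<in> carrier (obj Z n)" using assms(4) c by simp_all
  have "g n y \<ominus>\<^bsub>obj Z n\<^esub> g n (f n x) \<in> coboundaries Z n"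
    using chain_map_coboundaries[OF assms(4) x(2)] c by (simp add: chain_map_minus[OF assms(4,6,7)])
  then have "g n y \<ominus>\<^bsub>obj Z n\<^esub> (g n y \<ominus>\<^bsub>obj Z n\<^esub> g n (f n x)) \<in> coboundaries Z n"
    by (rule coboundaries_minus[OF assms(7) y(2)])
  moreover have "g n y \<ominus>\<^bsub>obj Z n\<^esub> (g n y \<ominus>\<^bsub>obj Z n\<^esub> g n (f n x)) = g n (f n x)" using gc by algebra
  ultimately have "x \<in> coboundaries X n" using assms(1) x(1) unfolding coh_inj_def comp_map_def by simp
  then have "(y \<ominus>\<^bsub>obj Y n\<^esub> f n x) \<oplus>\<^bsub>obj Y n\<^esub> f n x \<in> coboundaries Y n"
    using coboundaries_add[OF assms(6) x(2)] chain_map_coboundaries[OF assms(3)] by blast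
  moreover have "(y \<ominus>\<^bsub>obj Y n\<^esub> f n x) \<oplus>\<^bsub>obj Y n\<^esub> f n x = y" using c by algebra
  ultimately show "y \<in> coboundaries Y n" by simp
qed

context universe
begin

lemma qis_ore:
  fixes X Y Y' :: "('r, 'u) cochain"
  assumes "X \<in> complexes R" "f \<in> chain_maps R X Y" "qis R Y' Y t"
  obtains V a b where "qis R V X a" "b \<in> chain_maps R V Y'" "heq R V Y (comp_map f a) (comp_map t b)"
proof -
  note t = qisD[OF assms(3)]
  obtain V a b where V: "V \<in> complexes R" "quasi_iso R V X a" "b \<in> chain_maps R V Y'"
    "homotopic R V Y (comp_map f a) (comp_map t b)"
    using ore[OF assms(1) t(1,2) assms(2) t(3,4)] by blast
  have a: "qis R V X a" using V assms(1) by (simp add: qis_def)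
  show thesis
    using that[OF a V(3)] V t assms(2) qisD(3)[OF a] chain_map_comp[OF qisD(3)[OF a] assms(2)]
      chain_map_comp[OF V(3) t(3)] by (simp add: heq_def)
qed

lemma qis_extend:
  fixes W X E :: "('r, 'u) cochain"
  assumes s: "qis R W X s" and E: "two_term_injective R E m" and f: "f \<in> chain_maps R W E"
  obtains g where "g \<in> chain_maps R X E" "heq R W E f (comp_map g s)"
proof -
  obtain g where g: "g \<in> chain_maps R X E" "homotopic R W E f (comp_map g s)"
    using quasi_iso_extend[OF qisD(4,1,2)[OF s] E f] by blast
  show thesis
    using that[OF g(1)] g f qisD(1)[OF s] two_term_injective_complexes[OF E]
      chain_map_comp[OF qisD(3)[OF s] g(1)] by (simp add: heq_def)
qed

text \<open>
  For a complex of injectives \<open>E\<close>, precomposition with a quasi-isomorphism \<open>W \<rightarrow> X\<close> is a bijection from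
  homotopy classes of maps \<open>X \<rightarrow> E\<close> to those of maps \<open>W \<rightarrow> E\<close>: the preceding lemma gives
  surjectivity, the next two injectivity.
\<close>

lemma qis_null:
  fixes W X E :: "('r, 'u) cochain"
  assumes s: "qis R W X s" and E: "two_term_injective R E m" and g: "g \<in> chain_maps R X E"
    and null: "heq R W E (comp_map g s) (zero_map E)"
  shows "heq R X E g (zero_map E)"
  using quasi_iso_null_homotopic[OF qisD(4,1,2)[OF s] E g heqD(5)[OF null]] g
    qisD(2)[OF s] two_term_injective_complexes[OF E]
  by (simp add: heq_def)

lemma qis_heq_cancel:
  fixes W X E :: "('r, 'u) cochain"
  assumes s: "qis R W X s" and E: "two_term_injective R E m" and g: "g \<in> chain_maps R X E" "g' \<in> chain_maps R X E"
    and eq: "heq R W E (comp_map g s) (comp_map g' s)"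
  shows "heq R X E g g'"
proof -
  note EC = two_term_injective_complexes[OF E]
  have "comp_map (sub_map E g g') s = sub_map E (comp_map g s) (comp_map g' s)"
    by (simp add: comp_map_def sub_map_def)
  then have "heq R W E (comp_map (sub_map E g g') s) (zero_map E)"
    using eq heq_iff_sub_map[OF heqD(1-4)[OF eq]] by simp
  from qis_null[OF s E sub_map_chain_map[OF g EC] this]
  show ?thesis using heq_iff_sub_map[OF qisD(2)[OF s] EC g] by simp
qed

definition zero_module :: "('r, 'u) module" where
  "zero_module = \<lparr> carrier = {undefined}, monoid.mult = undefined, one = undefined,
     ring.zero = undefined, add = (\<lambda>x y. undefined), smult = (\<lambda>a x. undefined) \<rparr>"

definition zero_complex :: "('r, 'u) cochain" where
  "zero_complex = \<lparr> obj = (\<lambda>n. zero_module), diff = (\<lambda>n x. undefined) \<rparr>"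

lemma zero_complex_complexes:
  fixes R :: "'r ring"
  assumes "cring R" shows "zero_complex \<in> complexes R"
proof (rule complexesI)
  interpret cring R by fact
  have "abelian_group (zero_module :: ('r, 'u) module)"
    by (rule abelian_groupI) (simp_all add: zero_module_def)
  then have "module R (zero_module :: ('r, 'u) module)"
    by (rule moduleI[OF assms]) (simp_all add: zero_module_def)
  moreover have "carrier (zero_module :: ('r, 'u) module) \<prec> (UNIV :: 'u set)"
    by (rule finite_small) (simp add: zero_module_def)
  ultimately show "small_module R (obj (zero_complex :: ('r, 'u) cochain) n)" for n
    by (simp add: small_module_def zero_complex_def)
qed (auto simp: zero_complex_def zero_module_def mod_hom_def)

text \<open>
  The null homotopy lifts \<open>f\<close> to the homotopy fibre \<open>P\<close> of the quasi-isomorphism \<open>g\<close>.  As \<open>P\<close> is acyclic,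
  the zero complex maps to it by a quasi-isomorphism; pulling this back along the lift \<open>W \<rightarrow> P\<close> yields a
  quasi-isomorphism to \<open>W\<close> after which the lift is null homotopic.
\<close>

lemma qis_factor_null:
  fixes W C E :: "('r, 'u) cochain"
  assumes R: "cring R" and g: "qis R C E g" and f: "f \<in> chain_maps R W C"
    and null: "heq R W E (comp_map g f) (zero_map E)"
  obtains V a where "qis R V W a" "heq R V C (comp_map f a) (zero_map C)"
proof -
  let ?Z = "zero_complex :: ('r, 'u) cochain"
  note Z = zero_complex_complexes[OF R]
  note C = qisD(1)[OF g] and E = qisD(2)[OF g] and gc = qisD(3)[OF g] and W = heqD(1)[OF null]
  note zE = chain_map_zero_map[OF E, of ?Z]
  note pb = Z C E zE gc
  let ?P = "hpullback ?Z C E (zero_map E) g"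
  have P: "?P \<in> complexes R" by (rule hpullback_complexes[OF pb])
  have q: "qis R ?P ?Z (\<lambda>n. ufst)"
    using hpullback_quasi_iso[OF pb qisD(4)[OF g]] P Z by (simp add: qis_def)
  have pr2: "(\<lambda>n x. ufst (usnd x)) \<in> chain_maps R ?P C" by (rule hpullback_proj2[OF pb])
  have "homotopic R W E (comp_map (zero_map E) (zero_map ?Z)) (comp_map g f)"
    using heqD(5)[OF heq_sym[OF null]] by simp
  then obtain p where p: "p \<in> chain_maps R W ?P" "comp_map (\<lambda>n x. ufst (usnd x)) p = f"
    using hpullback_lift[OF pb W chain_map_zero_map[OF Z] f] by blast
  have zP: "zero_map ?P \<in> chain_maps R ?Z ?P" by (rule chain_map_zero_map[OF P])
  have "heq R ?Z ?Z id_map (comp_map (\<lambda>n. ufst) (zero_map ?P))"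
  proof (rule heq_cong[OF Z Z chain_map_id chain_map_comp[OF zP qisD(3)[OF q]]])
    fix n x assume "x \<in> carrier (obj ?Z n)"
    then show "id_map n x = comp_map (\<lambda>n. ufst) (zero_map ?P) n x"
      by (simp add: id_map_def comp_map_def zero_map_def zero_complex_def zero_module_def)
  qed
  from qis_cancel[OF qis_heq[OF qis_id[OF Z] this] q zP]
  have "qis R ?Z ?P (zero_map ?P)" .
  from qis_ore[OF W p(1) this] obtain V a b where V: "qis R V W a"
    "heq R V ?P (comp_map p a) (comp_map (zero_map ?P) b)" by blast
  then have "heq R V ?P (comp_map p a) (zero_map ?P)" by simp
  from heq_null_left[OF this pr2 C] have "heq R V C (comp_map f a) (zero_map C)"
    unfolding comp_map_assoc p(2) .
  then show thesis using that V(1) by blast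
qed

lemma qis_factor_heq:
  fixes W C E :: "('r, 'u) cochain"
  assumes R: "cring R" and g: "qis R C E g" and f: "f \<in> chain_maps R W C" "f' \<in> chain_maps R W C"
    and eq: "heq R W E (comp_map g f) (comp_map g f')"
  obtains V a where "qis R V W a" "heq R V C (comp_map f a) (comp_map f' a)"
proof -
  note C = qisD(1)[OF g] and E = qisD(2)[OF g] and gc = qisD(3)[OF g] and W = heqD(1)[OF eq]
  note sub = sub_map_chain_map[OF f C]
  have "heq R W E (comp_map g (sub_map C f f')) (sub_map E (comp_map g f) (comp_map g f'))"
  proof (rule heq_cong[OF W E chain_map_comp[OF sub gc] sub_map_chain_map[OF heqD(3,4)[OF eq] E]])
    fix n x assume "x \<in> carrier (obj W n)"
    then show "comp_map g (sub_map C f f') n x = sub_map E (comp_map g f) (comp_map g f') n x"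
      by (simp add: comp_map_def sub_map_def chain_map_minus[OF gc C E] chain_map_closed[OF f(1)] chain_map_closed[OF f(2)])
  qed
  also have "heq R W E \<dots> (zero_map E)" using eq heq_iff_sub_map[OF heqD(1-4)[OF eq]] by simp
  finally obtain V a where V: "qis R V W a" "heq R V C (comp_map (sub_map C f f') a) (zero_map C)"
    using qis_factor_null[OF R g sub] by blast
  have "comp_map (sub_map C f f') a = sub_map C (comp_map f a) (comp_map f' a)"
    by (simp add: comp_map_def sub_map_def)
  then have "heq R V C (comp_map f a) (comp_map f' a)"
    using V(2) heq_iff_sub_map[OF qisD(1)[OF V(1)] C chain_map_comp[OF qisD(3)[OF V(1)] f(1)]
        chain_map_comp[OF qisD(3)[OF V(1)] f(2)]] by simp
  then show thesis using that V(1) by blast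
qed

end


section \<open>Morphisms in the derived category\<close>

lemma roofs_iff:
  "X \<in> complexes R \<Longrightarrow> (W, s, f) \<in> roofs R X Y \<longleftrightarrow> qis R W X s \<and> f \<in> chain_maps R W Y"
  by (auto simp: roofs_def qis_def)

lemma roof_eq_iff:
  assumes X: "X \<in> complexes R" and Y: "Y \<in> complexes R"
  shows "((W, s, f), (W', s', f')) \<in> roof_eq R X Y \<longleftrightarrow>
     (W, s, f) \<in> roofs R X Y \<and> (W', s', f') \<in> roofs R X Y \<and>
     (\<exists>V a b. qis R V X (comp_map s a) \<and> a \<in> chain_maps R V W \<and> b \<in> chain_maps R V W' \<and>
       heq R V X (comp_map s a) (comp_map s' b) \<and> heq R V Y (comp_map f a) (comp_map f' b))"
    (is "?L \<longleftrightarrow> ?r \<and> ?r' \<and> ?R")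
proof
  assume L: ?L
  then have r: ?r ?r' by (auto simp: roof_eq_def)
  then have s: "s \<in> chain_maps R W X" "f \<in> chain_maps R W Y" "s' \<in> chain_maps R W' X" "f' \<in> chain_maps R W' Y"
    by (auto simp: roofs_def quasi_iso_chain_map)
  obtain V a b where V: "V \<in> complexes R" "a \<in> chain_maps R V W" "b \<in> chain_maps R V W'"
      "quasi_iso R V X (comp_map s a)" "homotopic R V X (comp_map s a) (comp_map s' b)"
      "homotopic R V Y (comp_map f a) (comp_map f' b)"
    using L by (auto simp: roof_eq_def)
  have ?R
    using V X Y chain_map_comp[OF V(2) s(1)] chain_map_comp[OF V(2) s(2)]
      chain_map_comp[OF V(3) s(3)] chain_map_comp[OF V(3) s(4)]
    by (intro exI[of _ V] exI[of _ a] exI[of _ b]) (simp add: qis_def heq_def)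
  then show "?r \<and> ?r' \<and> ?R" using r by blast
next
  assume "?r \<and> ?r' \<and> ?R"
  then show ?L unfolding roof_eq_def qis_def heq_def by blast
qed

lemma roof_eq_refl:
  assumes X: "X \<in> complexes R" and Y: "Y \<in> complexes R" and r: "r \<in> roofs R X Y"
  shows "(r, r) \<in> roof_eq R X Y"
proof -
  obtain W s f where rr: "r = (W, s, f)" by (cases r)
  have s: "qis R W X s" "f \<in> chain_maps R W Y" using r roofs_iff[OF X] rr by blast+
  show ?thesis
    unfolding rr roof_eq_iff[OF X Y]
    using r rr s heq_refl[OF qisD(1)[OF s(1)] X qisD(3)[OF s(1)]] heq_refl[OF qisD(1)[OF s(1)] Y s(2)]
    by (intro conjI exI[of _ W] exI[of _ id_map]) simp_all
qed

lemma Hom_D_class: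
  assumes "r \<in> roofs R X Y" shows "roof_eq R X Y `` {r} \<in> Hom_D R X Y"
  unfolding Hom_D_def using assms by (rule quotientI)

lemma Hom_DE:
  assumes "\<phi> \<in> Hom_D R X Y"
  obtains W s f where "(W, s, f) \<in> roofs R X Y" "\<phi> = roof_eq R X Y `` {(W, s, f)}"
  using assms unfolding Hom_D_def by (metis quotientE prod_cases3)

lemma id_roof: "X \<in> complexes R \<Longrightarrow> f \<in> chain_maps R X Y \<Longrightarrow> (X, id_map, f) \<in> roofs R X Y"
  by (simp add: roofs_iff qis_id)

lemma of_map_Hom_D: "X \<in> complexes R \<Longrightarrow> f \<in> chain_maps R X Y \<Longrightarrow> of_map R X Y f \<in> Hom_D R X Y"
  unfolding of_map_def by (intro Hom_D_class id_roof)

lemma zero_D_Hom_D: "X \<in> complexes R \<Longrightarrow> Y \<in> complexes R \<Longrightarrow> zero_D R X Y \<in> Hom_D R X Y"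
  unfolding zero_D_def by (intro of_map_Hom_D chain_map_zero_map)

lemma of_map_eq_zeroD:
  assumes X: "X \<in> complexes R" and Y: "Y \<in> complexes R" and f: "f \<in> chain_maps R X Y"
    and eq: "of_map R X Y f = zero_D R X Y"
  obtains V a where "qis R V X a" "heq R V Y (comp_map f a) (zero_map Y)"
proof -
  have "(X, id_map, zero_map Y) \<in> zero_D R X Y"
    using roof_eq_refl[OF X Y id_roof[OF X chain_map_zero_map[OF Y]]] by (simp add: zero_D_def of_map_def)
  then have "((X, id_map, f), (X, id_map, zero_map Y)) \<in> roof_eq R X Y"
    unfolding eq[symmetric] by (simp add: of_map_def)
  then show thesis using that unfolding roof_eq_iff[OF X Y] by auto
qed

text \<open>
  The map comparing the zero roof with \<open>(W, s, f)\<close> is a quasi-isomorphism to \<open>W\<close>, because \<open>s\<close> can be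
  cancelled, and it kills \<open>f\<close>.
\<close>

lemma Hom_D_zeroD:
  assumes X: "X \<in> complexes R" and Y: "Y \<in> complexes R"
    and zero: "Hom_D R X Y = {zero_D R X Y}" and s: "qis R W X s" and f: "f \<in> chain_maps R W Y"
  obtains V a where "qis R V W a" "heq R V Y (comp_map f a) (zero_map Y)"
proof -
  have r: "(W, s, f) \<in> roofs R X Y" using s f by (simp add: roofs_iff[OF X])
  have "roof_eq R X Y `` {(W, s, f)} = zero_D R X Y" using zero Hom_D_class[OF r] by simp
  moreover have "(W, s, f) \<in> roof_eq R X Y `` {(W, s, f)}" using roof_eq_refl[OF X Y r] by simp
  ultimately have "((X, id_map, zero_map Y), (W, s, f)) \<in> roof_eq R X Y"
    by (simp add: zero_D_def of_map_def)
  then obtain V a b where V: "b \<in> chain_maps R V W" "qis R V X a" "heq R V X a (comp_map s b)"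
      "heq R V Y (zero_map Y) (comp_map f b)"
    unfolding roof_eq_iff[OF X Y] by auto
  have "qis R V W b" using qis_cancel[OF qis_heq[OF V(2,3)] s V(1)] .
  then show thesis using that heq_sym[OF V(4)] by blast
qed

text \<open>
  Let \<open>(W0, s0, f0)\<close> represent an isomorphism \<open>\<phi>\<close> with inverse \<open>\<psi>\<close>.  On cohomology a roof \<open>(W, s, f)\<close> acts
  as \<open>f s\<^sup>-\<^sup>1\<close>.  Hence \<open>\<psi> \<phi> = id\<close> forces \<open>f0\<close> to be injective on cohomology, and \<open>\<phi> \<psi> = id\<close> forces it to
  be surjective.
\<close>

lemma iso_D_zigzag:
  assumes X: "X \<in> complexes R" and Y: "Y \<in> complexes R" and iso: "iso_mor_D R X Y \<phi>"
  obtains W s f where "qis R W X s" "qis R W Y f"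
proof -
  obtain \<psi> where phi: "\<phi> \<in> Hom_D R X Y" and psi: "\<psi> \<in> Hom_D R Y X"
    and id1: "comp_D R X Y X \<psi> \<phi> = id_D R X" and id2: "comp_D R Y X Y \<phi> \<psi> = id_D R Y"
    using iso unfolding iso_mor_D_def by blast
  obtain W0 s0 f0 where r0: "(W0, s0, f0) \<in> roofs R X Y" and phi0: "\<phi> = roof_eq R X Y `` {(W0, s0, f0)}"
    using phi by (rule Hom_DE)
  obtain W0' t0 g0 where r0': "(W0', t0, g0) \<in> roofs R Y X" and psi0: "\<psi> = roof_eq R Y X `` {(W0', t0, g0)}"
    using psi by (rule Hom_DE)
  have s0: "qis R W0 X s0" "f0 \<in> chain_maps R W0 Y" using r0 roofs_iff[OF X] by blast+
  have W0: "W0 \<in> complexes R" using qisD(1)[OF s0(1)] .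
  \<comment> \<open>Two members of \<open>\<phi>\<close> have right legs that agree up to quasi-isomorphisms on the source.\<close>
  have member: "qis R W X s \<and> f \<in> chain_maps R W Y \<and> (\<exists>V a b. qis R V W0 a \<and> qis R V W b \<and>
      heq R V Y (comp_map f0 a) (comp_map f b))" if mem: "(W, s, f) \<in> \<phi>" for W s f
  proof -
    obtain V a b where V: "qis R V X (comp_map s0 a)" "a \<in> chain_maps R V W0" "b \<in> chain_maps R V W"
       "heq R V X (comp_map s0 a) (comp_map s b)" "heq R V Y (comp_map f0 a) (comp_map f b)"
       "(W, s, f) \<in> roofs R X Y"
      using mem unfolding phi0 Image_singleton_iff roof_eq_iff[OF X Y] by blast
    have s: "qis R W X s" "f \<in> chain_maps R W Y" using V(6) roofs_iff[OF X] by blast+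
    have "qis R V W0 a" by (rule qis_cancel[OF V(1) s0(1) V(2)])
    moreover have "qis R V W b" by (rule qis_cancel[OF qis_heq[OF V(1,4)] s(1) V(3)])
    ultimately show ?thesis using s V(5) by blast
  qed
  have member': "qis R W Y t \<and> g \<in> chain_maps R W X" if "(W, t, g) \<in> \<psi>" for W t g
    using that roofs_iff[OF Y] unfolding psi0 Image_singleton_iff roof_eq_iff[OF Y X] by blast
  have idX: "(X, id_map, id_map) \<in> comp_D R X Y X \<psi> \<phi>"
    unfolding id1 id_D_def of_map_def using roof_eq_refl[OF X X id_roof[OF X chain_map_id]] by simp
  have idY: "(Y, id_map, id_map) \<in> comp_D R Y X Y \<phi> \<psi>"
    unfolding id2 id_D_def of_map_def using roof_eq_refl[OF Y Y id_roof[OF Y chain_map_id]] by simp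
  have inj: "coh_inj W0 Y f0"
  proof -
    obtain W s f W' t g V a b where 1: "(W, s, f) \<in> \<phi>" "(W', t, g) \<in> \<psi>" "V \<in> complexes R"
        "quasi_iso R V W a" "b \<in> chain_maps R V W'" "homotopic R V Y (comp_map f a) (comp_map t b)"
        "((V, comp_map s a, comp_map g b), (X, id_map, id_map)) \<in> roof_eq R X X"
      using idX unfolding comp_D_def by blast
    note m = member[OF 1(1)] and m' = member'[OF 1(2)]
    have W: "W \<in> complexes R" "W' \<in> complexes R" using m m' qisD(1) by blast+
    have a: "qis R V W a" using 1 W by (simp add: qis_def)
    have sa: "qis R V X (comp_map s a)" using qis_comp[OF a] m by blast
    obtain T a' b' where T: "qis R T X (comp_map (comp_map s a) a')" "a' \<in> chain_maps R T V"
        "heq R T X (comp_map (comp_map s a) a') b'" "heq R T X (comp_map (comp_map g b) a') b'"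
      using 1(7) unfolding roof_eq_iff[OF X X] by auto
    have a': "qis R T V a'" by (rule qis_cancel[OF T(1) sa T(2)])
    have gba: "qis R T X (comp_map (comp_map g b) a')"
      by (rule qis_heq[OF T(1) heq_trans[OF T(3) heq_sym[OF T(4)]]])
    have gb: "comp_map g b \<in> chain_maps R V X" using 1(5) m' chain_map_comp by blast
    have "coh_inj V X (comp_map g b)"
      by (rule coh_inj_cancel_right[OF qisD(5)[OF gba] qisD(6,3)[OF a'] gb qisD(1,2)[OF a'] X])
    then have "coh_inj V W' b" using coh_inj_cancel m' by blast
    then have "coh_inj V Y (comp_map t b)"
      using coh_inj_comp 1(3,5) W m' qisD(5) by metis
    moreover have t: "comp_map t b \<in> chain_maps R V Y" "comp_map f a \<in> chain_maps R V Y"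
      using chain_map_comp[OF 1(5)] chain_map_comp[OF qisD(3)[OF a]] m m' qisD(3) by blast+
    moreover have "homotopic R V Y (comp_map t b) (comp_map f a)"
      by (rule homotopic_sym[OF 1(6,3) Y t(2,1)])
    ultimately have "coh_inj V Y (comp_map f a)" using coh_inj_homotopic[OF _ _ 1(3) Y] by blast
    then have fi: "coh_inj W Y f"
      using coh_inj_cancel_right[OF _ qisD(6,3)[OF a] _ 1(3) W(1) Y] m by blast
    obtain V' a1 b1 where V': "qis R V' W0 a1" "qis R V' W b1" "heq R V' Y (comp_map f0 a1) (comp_map f b1)"
      using m by blast
    have "coh_inj V' Y (comp_map f b1)"
      by (rule coh_inj_comp[OF qisD(5)[OF V'(2)] fi qisD(3,1,2)[OF V'(2)]])
    then have "coh_inj V' Y (comp_map f0 a1)"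
      using coh_inj_homotopic[OF _ heqD(5)[OF heq_sym[OF V'(3)]] heqD(1,2,4,3)[OF V'(3)]] by blast
    then show ?thesis
      using coh_inj_cancel_right[OF _ qisD(6,3)[OF V'(1)] s0(2) qisD(1,2)[OF V'(1)] Y] by blast
  qed
  have surj: "coh_surj W0 Y f0"
  proof -
    obtain W s f W' t g V a b where 1: "(W, s, f) \<in> \<phi>" "(W', t, g) \<in> \<psi>" "V \<in> complexes R"
        "quasi_iso R V W' a" "b \<in> chain_maps R V W"
        "((V, comp_map t a, comp_map f b), (Y, id_map, id_map)) \<in> roof_eq R Y Y"
      using idY unfolding comp_D_def by blast
    note m = member[OF 1(1)]
    have W: "W \<in> complexes R" using m qisD(1) by blast
    obtain T a' b' where T: "qis R T Y (comp_map (comp_map t a) a')" "a' \<in> chain_maps R T V"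
        "heq R T Y (comp_map (comp_map t a) a') b'" "heq R T Y (comp_map (comp_map f b) a') b'"
      using 1(6) unfolding roof_eq_iff[OF Y Y] by auto
    have "qis R T Y (comp_map (comp_map f b) a')"
      by (rule qis_heq[OF T(1) heq_trans[OF T(3) heq_sym[OF T(4)]]])
    then have "coh_surj T Y (comp_map f (comp_map b a'))" using qisD(6) by (simp add: comp_map_assoc)
    then have fs: "coh_surj W Y f"
      by (rule coh_surj_cancel[OF _ chain_map_comp[OF T(2) 1(5)] qisD(1)[OF T(1)] W])
    obtain V' a1 b1 where V': "qis R V' W0 a1" "qis R V' W b1" "heq R V' Y (comp_map f0 a1) (comp_map f b1)"
      using m by blast
    have "coh_surj V' Y (comp_map f b1)"
      using coh_surj_comp[OF qisD(6)[OF V'(2)] fs qisD(3)[OF V'(2)] _ qisD(1,2)[OF V'(2)] Y] m by blast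
    then have "coh_surj V' Y (comp_map f0 a1)"
      using coh_surj_homotopic[OF _ heqD(5)[OF heq_sym[OF V'(3)]] heqD(1,2,4,3)[OF V'(3)]] by blast
    then show ?thesis by (rule coh_surj_cancel[OF _ qisD(3,1,2)[OF V'(1)]])
  qed
  have "qis R W0 Y f0" using inj surj s0(2) W0 Y quasi_iso_iff[OF W0 Y] by (simp add: qis_def)
  then show thesis using that s0(1) by blast
qed


section \<open>Morphisms into objects with a two-term injective model\<close>

text \<open>
  Given a quasi-isomorphism \<open>g : C \<rightarrow> E\<close>, a chain map \<open>h : X \<rightarrow> E\<close> represents the roof \<open>X \<leftarrow> W \<rightarrow> C\<close> if both
  describe the same morphism \<open>W \<rightarrow> E\<close> up to homotopy.
\<close>

definition represents ::
  "'r ring \<Rightarrow> ('r, 'u) cochain \<Rightarrow> ('r, 'u) cochain \<Rightarrow> (int \<Rightarrow> 'u \<Rightarrow> 'u) \<Rightarrow> ('r, 'u) roof \<Rightarrow>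
     (int \<Rightarrow> 'u \<Rightarrow> 'u) \<Rightarrow> bool" where
  "represents R X E g r h \<longleftrightarrow> h \<in> chain_maps R X E \<and>
     (case r of (W, s, f) \<Rightarrow> heq R W E (comp_map h s) (comp_map g f))"

definition all_null :: "'r ring \<Rightarrow> ('r, 'u) cochain \<Rightarrow> ('r, 'u) cochain \<Rightarrow> bool" where
  "all_null R X E \<longleftrightarrow> (\<forall>h\<in>chain_maps R X E. heq R X E h (zero_map E))"

locale injective_model = universe U for U :: "'u itself" +
  fixes R :: "'r ring" and C E :: "('r, 'u) cochain" and g :: "int \<Rightarrow> 'u \<Rightarrow> 'u" and m :: int
  assumes cring_R: "cring R" and model: "qis R C E g" and two_term_E: "two_term_injective R E m"
begin

lemmas C_complex = qisD(1)[OF model] and E_complex = qisD(2)[OF model] and g_map = qisD(3)[OF model]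

lemma represents_exists:
  assumes X: "X \<in> complexes R" and r: "r \<in> roofs R X C"
  obtains h where "represents R X E g r h"
proof -
  obtain W s f where rr: "r = (W, s, f)" by (cases r)
  have s: "qis R W X s" "f \<in> chain_maps R W C" using r roofs_iff[OF X] rr by blast+
  obtain h where "h \<in> chain_maps R X E" "heq R W E (comp_map g f) (comp_map h s)"
    using qis_extend[OF s(1) two_term_E chain_map_comp[OF s(2) g_map]] by blast
  then show thesis using that[of h] rr heq_sym by (simp add: represents_def) blast
qed

lemma represents_unique:
  assumes X: "X \<in> complexes R" and r: "r \<in> roofs R X C"
    and "represents R X E g r h" "represents R X E g r h'"
  shows "heq R X E h h'"
proof -
  obtain W s f where rr: "r = (W, s, f)" by (cases r)
  have s: "qis R W X s" using r roofs_iff[OF X] rr by blast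
  have h: "h \<in> chain_maps R X E" "heq R W E (comp_map h s) (comp_map g f)"
    "h' \<in> chain_maps R X E" "heq R W E (comp_map h' s) (comp_map g f)"
    using assms(3,4) by (simp_all add: rr represents_def)
  show ?thesis
    by (rule qis_heq_cancel[OF s two_term_E h(1,3) heq_trans[OF h(2) heq_sym[OF h(4)]]])
qed

lemma represents_heq:
  assumes X: "X \<in> complexes R" and r: "r \<in> roofs R X C"
    and h: "represents R X E g r h" and eq: "heq R X E h h'"
  shows "represents R X E g r h'"
proof -
  obtain W s f where rr: "r = (W, s, f)" by (cases r)
  have s: "qis R W X s" using r roofs_iff[OF X] rr by blast
  have hh: "heq R W E (comp_map h s) (comp_map g f)" using h by (simp add: rr represents_def)
  have "heq R W E (comp_map h' s) (comp_map g f)"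
    using heq_trans[OF heq_sym[OF heq_right[OF eq qisD(3,1)[OF s]]] hh] .
  then show ?thesis using heqD(4)[OF eq] by (simp add: rr represents_def)
qed

text \<open>
  The point of the injective model: roofs into \<open>C\<close> modulo equivalence are chain maps into \<open>E\<close>
  modulo homotopy.
\<close>

lemma roof_eq_iff_represents:
  assumes X: "X \<in> complexes R" and r: "r \<in> roofs R X C" "r' \<in> roofs R X C"
  shows "(r, r') \<in> roof_eq R X C \<longleftrightarrow> (\<exists>h. represents R X E g r h \<and> represents R X E g r' h)"
proof -
  obtain W s f where rr: "r = (W, s, f)" by (cases r)
  obtain W' s' f' where rr': "r' = (W', s', f')" by (cases r')
  have s: "qis R W X s" "f \<in> chain_maps R W C" using r roofs_iff[OF X] rr by blast+
  have s': "qis R W' X s'" "f' \<in> chain_maps R W' C" using r roofs_iff[OF X] rr' by blast+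
  show ?thesis
  proof
    assume "(r, r') \<in> roof_eq R X C"
    then obtain V a b where V: "qis R V X (comp_map s a)" "a \<in> chain_maps R V W" "b \<in> chain_maps R V W'"
      "heq R V X (comp_map s a) (comp_map s' b)" "heq R V C (comp_map f a) (comp_map f' b)"
      unfolding rr rr' roof_eq_iff[OF X C_complex] by blast
    note VC = qisD(1)[OF V(1)]
    obtain h where h: "represents R X E g r h" using represents_exists[OF X r(1)] .
    then have h': "h \<in> chain_maps R X E" "heq R W E (comp_map h s) (comp_map g f)"
      by (simp_all add: rr represents_def)
    have b: "qis R V W' b" by (rule qis_cancel[OF qis_heq[OF V(1,4)] s'(1) V(3)])
    have "heq R V E (comp_map (comp_map h s') b) (comp_map (comp_map h s) a)"
      using heq_left[OF heq_sym[OF V(4)] h'(1) E_complex] by (simp add: comp_map_assoc)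
    also have "heq R V E \<dots> (comp_map (comp_map g f) a)" by (rule heq_right[OF h'(2) V(2) VC])
    also have "heq R V E (comp_map (comp_map g f) a) (comp_map (comp_map g f') b)"
      using heq_left[OF V(5) g_map E_complex] by (simp add: comp_map_assoc)
    finally have "heq R W' E (comp_map h s') (comp_map g f')"
      by (rule qis_heq_cancel[OF b two_term_E chain_map_comp[OF qisD(3)[OF s'(1)] h'(1)]
          chain_map_comp[OF s'(2) g_map]])
    then show "\<exists>h. represents R X E g r h \<and> represents R X E g r' h"
      using h h'(1) by (intro exI[of _ h]) (simp add: rr' represents_def)
  next
    assume "\<exists>h. represents R X E g r h \<and> represents R X E g r' h"
    then obtain h where h: "h \<in> chain_maps R X E" "heq R W E (comp_map h s) (comp_map g f)"
       "heq R W' E (comp_map h s') (comp_map g f')" by (auto simp: rr rr' represents_def)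
    obtain V a b where V: "qis R V W a" "b \<in> chain_maps R V W'" "heq R V X (comp_map s a) (comp_map s' b)"
      using qis_ore[OF qisD(1,3)[OF s(1)] s'(1)] by blast
    note VC = qisD(1)[OF V(1)] and ac = qisD(3)[OF V(1)]
    have "heq R V E (comp_map g (comp_map f a)) (comp_map h (comp_map s a))"
      using heq_right[OF heq_sym[OF h(2)] ac VC] by (simp add: comp_map_assoc)
    also have "heq R V E \<dots> (comp_map h (comp_map s' b))" by (rule heq_left[OF V(3) h(1) E_complex])
    also have "heq R V E (comp_map h (comp_map s' b)) (comp_map g (comp_map f' b))"
      using heq_right[OF h(3) V(2) VC] by (simp add: comp_map_assoc)
    finally obtain V' c where V': "qis R V' V c" "heq R V' C (comp_map (comp_map f a) c) (comp_map (comp_map f' b) c)"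
      using qis_factor_heq[OF cring_R model chain_map_comp[OF ac s(2)] chain_map_comp[OF V(2) s'(2)]] by blast
    note cc = qisD(3)[OF V'(1)] and VC' = qisD(1)[OF V'(1)]
    have 1: "qis R V' X (comp_map s (comp_map a c))" using qis_comp[OF qis_comp[OF V'(1) V(1)] s(1)] .
    have 2: "heq R V' X (comp_map s (comp_map a c)) (comp_map s' (comp_map b c))"
      using heq_right[OF V(3) cc VC'] by (simp add: comp_map_assoc)
    show "(r, r') \<in> roof_eq R X C"
      unfolding rr rr' roof_eq_iff[OF X C_complex]
      using r[unfolded rr rr'] 1 2 V'(2) chain_map_comp[OF cc ac] chain_map_comp[OF cc V(2)]
      by (intro conjI exI[of _ V'] exI[of _ "comp_map a c"] exI[of _ "comp_map b c"]) (simp_all add: comp_map_assoc)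
  qed
qed

lemma class_eq_represents:
  assumes X: "X \<in> complexes R" and r: "r \<in> roofs R X C" and h: "represents R X E g r h"
  shows "roof_eq R X C `` {r} = {r' \<in> roofs R X C. represents R X E g r' h}"
proof (intro equalityI subsetI)
  fix r' assume "r' \<in> roof_eq R X C `` {r}"
  then have rr': "(r, r') \<in> roof_eq R X C" by simp
  then have r': "r' \<in> roofs R X C" by (auto simp: roof_eq_def)
  obtain h' where h': "represents R X E g r h'" "represents R X E g r' h'"
    using rr' roof_eq_iff_represents[OF X r r'] by blast
  show "r' \<in> {r' \<in> roofs R X C. represents R X E g r' h}"
    using represents_heq[OF X r' h'(2) represents_unique[OF X r h'(1) h]] r' by simp
next
  fix r' assume "r' \<in> {r' \<in> roofs R X C. represents R X E g r' h}"
  then show "r' \<in> roof_eq R X C `` {r}" using roof_eq_iff_represents[OF X r] h by auto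
qed

lemma zero_D_eq_represents:
  assumes X: "X \<in> complexes R"
  shows "zero_D R X C = {r \<in> roofs R X C. represents R X E g r (zero_map E)}"
proof -
  have "represents R X E g (X, id_map, zero_map C) (zero_map E)"
    using heq_sym[OF heq_comp_zero[OF X C_complex E_complex g_map]] E_complex by (simp add: represents_def)
  from class_eq_represents[OF X id_roof[OF X chain_map_zero_map[OF C_complex]] this] show ?thesis
    by (simp add: zero_D_def of_map_def)
qed

lemma Hom_D_zero_iff:
  assumes X: "X \<in> complexes R"
  shows "Hom_D R X C = {zero_D R X C} \<longleftrightarrow> all_null R X E"
proof
  assume zero: "Hom_D R X C = {zero_D R X C}"
  show "all_null R X E"
    unfolding all_null_def
  proof
    fix h assume h: "h \<in> chain_maps R X E"
    obtain W s f where W: "qis R W X s" "f \<in> chain_maps R W C" "heq R W E (comp_map h s) (comp_map g f)"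
      using qis_ore[OF X h model] by blast
    have r: "(W, s, f) \<in> roofs R X C" using W by (simp add: roofs_iff[OF X])
    have rep: "represents R X E g (W, s, f) h" using h W by (simp add: represents_def)
    have "roof_eq R X C `` {(W, s, f)} = zero_D R X C" using Hom_D_class[OF r] zero by simp
    then have "represents R X E g (W, s, f) (zero_map E)"
      using roof_eq_refl[OF X C_complex r] unfolding zero_D_eq_represents[OF X] by blast
    then show "heq R X E h (zero_map E)" using represents_unique[OF X r rep] by blast
  qed
next
  assume null: "all_null R X E"
  have "\<phi> = zero_D R X C" if phi: "\<phi> \<in> Hom_D R X C" for \<phi>
  proof -
    obtain W s f where r: "(W, s, f) \<in> roofs R X C" "\<phi> = roof_eq R X C `` {(W, s, f)}"
      using phi by (rule Hom_DE)
    obtain h where h: "represents R X E g (W, s, f) h" using represents_exists[OF X r(1)] .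
    then have "heq R X E h (zero_map E)" using null by (simp add: all_null_def represents_def)
    from class_eq_represents[OF X r(1) represents_heq[OF X r(1) h this]]
    show ?thesis unfolding r(2) zero_D_eq_represents[OF X] .
  qed
  then show "Hom_D R X C = {zero_D R X C}" using zero_D_Hom_D[OF X C_complex] by blast
qed

text \<open>
  If \<open>h\<close> represents \<open>\<psi>\<close> and \<open>\<phi>\<close> is given by \<open>(W0, s0, f0)\<close>, then \<open>\<psi> \<phi>\<close> is represented by the extension \<open>k\<close>
  of \<open>h f0\<close> along \<open>s0\<close>.  This identifies the composite, which is defined as a set of roofs, with a single
  equivalence class.
\<close>

lemma comp_D_represents:
  assumes X: "X \<in> complexes R" and Y: "Y \<in> complexes R"
    and r: "(W0, s0, f0) \<in> roofs R X Y" and r': "(W0', t0, g0) \<in> roofs R Y C"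
    and h: "represents R Y E g (W0', t0, g0) h"
    and k: "k \<in> chain_maps R X E" "heq R W0 E (comp_map k s0) (comp_map h f0)"
  shows "comp_D R X Y C (roof_eq R Y C `` {(W0', t0, g0)}) (roof_eq R X Y `` {(W0, s0, f0)}) =
    {r \<in> roofs R X C. represents R X E g r k}" (is "comp_D R X Y C ?psi ?phi = ?K")
proof -
  have hc: "h \<in> chain_maps R Y E" using h by (simp add: represents_def)
  have s0: "qis R W0 X s0" "f0 \<in> chain_maps R W0 Y" using r roofs_iff[OF X] by blast+
  have t0: "qis R W0' Y t0" "g0 \<in> chain_maps R W0' C" using r' roofs_iff[OF Y] by blast+
  have phi: "qis R W X s \<and> f \<in> chain_maps R W Y \<and> heq R W E (comp_map k s) (comp_map h f)"
    if mem: "(W, s, f) \<in> ?phi" for W s f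
  proof -
    obtain V a b where V: "(W, s, f) \<in> roofs R X Y" "qis R V X (comp_map s0 a)" "a \<in> chain_maps R V W0"
       "b \<in> chain_maps R V W" "heq R V X (comp_map s0 a) (comp_map s b)" "heq R V Y (comp_map f0 a) (comp_map f b)"
      using mem unfolding Image_singleton_iff roof_eq_iff[OF X Y] by blast
    note VC = qisD(1)[OF V(2)]
    have s: "qis R W X s" "f \<in> chain_maps R W Y" using V(1) roofs_iff[OF X] by blast+
    have b: "qis R V W b" by (rule qis_cancel[OF qis_heq[OF V(2,5)] s(1) V(4)])
    have "heq R V E (comp_map (comp_map k s) b) (comp_map (comp_map k s0) a)"
      using heq_left[OF heq_sym[OF V(5)] k(1) E_complex] by (simp add: comp_map_assoc)
    also have "heq R V E \<dots> (comp_map (comp_map h f0) a)" by (rule heq_right[OF k(2) V(3) VC])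
    also have "heq R V E (comp_map (comp_map h f0) a) (comp_map (comp_map h f) b)"
      using heq_left[OF V(6) hc E_complex] by (simp add: comp_map_assoc)
    finally have "heq R W E (comp_map k s) (comp_map h f)"
      by (rule qis_heq_cancel[OF b two_term_E chain_map_comp[OF qisD(3)[OF s(1)] k(1)]
          chain_map_comp[OF s(2) hc]])
    then show ?thesis using s by blast
  qed
  have psi: "qis R W Y t \<and> e \<in> chain_maps R W C \<and> heq R W E (comp_map h t) (comp_map g e)"
    if "(W, t, e) \<in> ?psi" for W t e
    using that roofs_iff[OF Y] unfolding class_eq_represents[OF Y r' h] by (auto simp: represents_def)
  have comp: "(V, comp_map s a, comp_map e b) \<in> ?K"
    if 1: "(W, s, f) \<in> ?phi" "(W', t, e) \<in> ?psi" "qis R V W a" "b \<in> chain_maps R V W'"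
      "heq R V Y (comp_map f a) (comp_map t b)" for W s f W' t e V a b
  proof -
    note p = phi[OF 1(1)] and q = psi[OF 1(2)]
    have a: "qis R V X (comp_map s a)" using qis_comp[OF 1(3)] p by blast
    have c: "comp_map e b \<in> chain_maps R V C" using q chain_map_comp[OF 1(4)] by blast
    have ks: "heq R W E (comp_map k s) (comp_map h f)" using p by blast
    have "heq R V E (comp_map k (comp_map s a)) (comp_map h (comp_map f a))"
      using heq_right[OF ks qisD(3,1)[OF 1(3)]] by (simp add: comp_map_assoc)
    also have "heq R V E \<dots> (comp_map h (comp_map t b))" by (rule heq_left[OF 1(5) hc E_complex])
    also have "heq R V E (comp_map h (comp_map t b)) (comp_map g (comp_map e b))"
      using heq_right[of R W' E "comp_map h t" "comp_map g e", OF _ 1(4) qisD(1)[OF 1(3)]] q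
      by (simp add: comp_map_assoc)
    finally show ?thesis using a c k(1) by (simp add: represents_def roofs_iff[OF X])
  qed
  show ?thesis
  proof (intro equalityI subsetI)
    fix r assume "r \<in> comp_D R X Y C ?psi ?phi"
    then obtain W s f W' t e V a b where 1: "(W, s, f) \<in> ?phi" "(W', t, e) \<in> ?psi"
        "V \<in> complexes R" "quasi_iso R V W a" "b \<in> chain_maps R V W'"
        "homotopic R V Y (comp_map f a) (comp_map t b)"
        "((V, comp_map s a, comp_map e b), r) \<in> roof_eq R X C"
      unfolding comp_D_def by blast
    note p = phi[OF 1(1)] and q = psi[OF 1(2)]
    have a: "qis R V W a" using 1(3,4) p qisD(1) by (auto simp: qis_def)
    have "heq R V Y (comp_map f a) (comp_map t b)"
      unfolding heq_def using 1(3,6) Y chain_map_comp[OF qisD(3)[OF a]] chain_map_comp[OF 1(5)] p q qisD(3)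
      by blast
    from comp[OF 1(1,2) a 1(5) this]
    have v: "(V, comp_map s a, comp_map e b) \<in> roofs R X C"
        "represents R X E g (V, comp_map s a, comp_map e b) k" by simp_all
    have "r \<in> roof_eq R X C `` {(V, comp_map s a, comp_map e b)}" using 1(7) by simp
    then show "r \<in> ?K" unfolding class_eq_represents[OF X v] .
  next
    fix r assume rK: "r \<in> ?K"
    obtain V a b where V: "qis R V W0 a" "b \<in> chain_maps R V W0'" "heq R V Y (comp_map f0 a) (comp_map t0 b)"
      using qis_ore[OF qisD(1)[OF s0(1)] s0(2) t0(1)] by blast
    have m: "(W0, s0, f0) \<in> ?phi" "(W0', t0, g0) \<in> ?psi"
      using roof_eq_refl[OF X Y r] roof_eq_refl[OF Y C_complex r'] by simp_all
    from comp[OF m V] have v: "(V, comp_map s0 a, comp_map g0 b) \<in> roofs R X C"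
        "represents R X E g (V, comp_map s0 a, comp_map g0 b) k" by simp_all
    have "((V, comp_map s0 a, comp_map g0 b), r) \<in> roof_eq R X C"
      using rK class_eq_represents[OF X v] by blast
    then show "r \<in> comp_D R X Y C ?psi ?phi"
      unfolding comp_D_def using m V(2) qisD(1,4)[OF V(1)] heqD(5)[OF V(3)] by blast
  qed
qed

lemma comp_D_Hom_D:
  assumes X: "X \<in> complexes R" and Y: "Y \<in> complexes R"
    and phi: "\<phi> \<in> Hom_D R X Y" and psi: "\<psi> \<in> Hom_D R Y C"
  shows "comp_D R X Y C \<psi> \<phi> \<in> Hom_D R X C"
proof -
  obtain W0 s0 f0 where r: "(W0, s0, f0) \<in> roofs R X Y" "\<phi> = roof_eq R X Y `` {(W0, s0, f0)}"
    using phi by (rule Hom_DE)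
  obtain W0' t0 g0 where r': "(W0', t0, g0) \<in> roofs R Y C" "\<psi> = roof_eq R Y C `` {(W0', t0, g0)}"
    using psi by (rule Hom_DE)
  have s0: "qis R W0 X s0" "f0 \<in> chain_maps R W0 Y" using r(1) roofs_iff[OF X] by blast+
  obtain h where h: "represents R Y E g (W0', t0, g0) h" using represents_exists[OF Y r'(1)] .
  then have hc: "h \<in> chain_maps R Y E" by (simp add: represents_def)
  obtain k where k: "k \<in> chain_maps R X E" "heq R W0 E (comp_map h f0) (comp_map k s0)"
    using qis_extend[OF s0(1) two_term_E chain_map_comp[OF s0(2) hc]] .
  have eq: "comp_D R X Y C \<psi> \<phi> = {r \<in> roofs R X C. represents R X E g r k}"
    unfolding r(2) r'(2) by (rule comp_D_represents[OF X Y r(1) r'(1) h k(1) heq_sym[OF k(2)]])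
  obtain W s f where W: "qis R W X s" "f \<in> chain_maps R W C" "heq R W E (comp_map k s) (comp_map g f)"
    using qis_ore[OF X k(1) model] by blast
  have w: "(W, s, f) \<in> roofs R X C" using W by (simp add: roofs_iff[OF X])
  have "represents R X E g (W, s, f) k" using k W by (simp add: represents_def)
  from class_eq_represents[OF X w this] Hom_D_class[OF w] show ?thesis unfolding eq by simp
qed

lemma comp_D_of_map_eq_zero:
  assumes X: "X \<in> complexes R" and Y: "Y \<in> complexes R"
    and f: "f \<in> chain_maps R X Y" and psi: "\<psi> \<in> Hom_D R Y C"
    and null: "\<And>h. h \<in> chain_maps R Y E \<Longrightarrow> heq R X E (comp_map h f) (zero_map E)"
  shows "comp_D R X Y C \<psi> (of_map R X Y f) = zero_D R X C"
proof -
  obtain W0' t0 g0 where r': "(W0', t0, g0) \<in> roofs R Y C" "\<psi> = roof_eq R Y C `` {(W0', t0, g0)}"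
    using psi by (rule Hom_DE)
  obtain h where h: "represents R Y E g (W0', t0, g0) h" using represents_exists[OF Y r'(1)] .
  then have hc: "h \<in> chain_maps R Y E" by (simp add: represents_def)
  have "heq R X E (comp_map (zero_map E) id_map) (comp_map h f)" using heq_sym[OF null[OF hc]] by simp
  from comp_D_represents[OF X Y id_roof[OF X f] r'(1) h chain_map_zero_map[OF E_complex] this]
  show ?thesis unfolding r'(2) of_map_def zero_D_eq_represents[OF X] .
qed

lemma injective_model_shift: "injective_model U R (shift k C) (shift k E) (shift_map k g) (m - k)"
proof (intro injective_model.intro injective_model_axioms.intro)
  show "qis R (shift k C) (shift k E) (shift_map k g)"
    using qisD(1,2,4)[OF model] shift_quasi_iso by (auto simp: qis_def)
qed (rule universe_axioms cring_R two_term_injective_shift[OF two_term_E])+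

lemma perp_iff:
  "Z \<in> perp R J C \<longleftrightarrow> Z \<in> complexes R \<and> (\<forall>k\<in>J. all_null R Z (shift k E))"
proof -
  have "Hom_D R Z (shift k C) = {zero_D R Z (shift k C)} \<longleftrightarrow> all_null R Z (shift k E)"
    if "Z \<in> complexes R" for k
    by (rule injective_model.Hom_D_zero_iff[OF injective_model_shift that])
  then show ?thesis unfolding perp_def by auto
qed

end

context universe
begin

lemma all_null_qis:
  fixes X Y E :: "('r, 'u) cochain"
  assumes s: "qis R X Y s" and E: "two_term_injective R E m"
  shows "all_null R X E \<longleftrightarrow> all_null R Y E"
proof
  note EC = two_term_injective_complexes[OF E]
  assume null: "all_null R X E"
  show "all_null R Y E"
    unfolding all_null_def
  proof
    fix h assume h: "h \<in> chain_maps R Y E"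
    have "heq R X E (comp_map h s) (zero_map E)"
      using null chain_map_comp[OF qisD(3)[OF s] h] by (simp add: all_null_def)
    then show "heq R Y E h (zero_map E)" by (rule qis_null[OF s E h])
  qed
next
  assume null: "all_null R Y E"
  show "all_null R X E"
    unfolding all_null_def
  proof
    fix h assume h: "h \<in> chain_maps R X E"
    obtain k where k: "k \<in> chain_maps R Y E" "heq R X E h (comp_map k s)" by (rule qis_extend[OF s E h])
    have "heq R Y E k (zero_map E)" using null k by (simp add: all_null_def)
    from heq_null_right[OF this qisD(3,1)[OF s]] show "heq R X E h (zero_map E)" using heq_trans[OF k(2)] by blast
  qed
qed

text \<open>
  An isomorphism from \<open>C\<close> to \<open>E\<close> is a priori a roof \<open>C \<leftarrow> W \<rightarrow> E\<close>; extending \<open>W \<rightarrow> E\<close> along \<open>W \<rightarrow> C\<close>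
  straightens it to a quasi-isomorphism \<open>C \<rightarrow> E\<close>.
\<close>

lemma injective_model_of_two_term:
  fixes C :: "('r, 'u) cochain"
  assumes R: "cring R" and C: "C \<in> complexes R" and two: "two_term R C"
  obtains E g m where "injective_model U R C E g m"
proof -
  obtain E m where E: "two_term_injective R E m" "iso_D R C E"
    using two unfolding two_term_def two_term_injective_def by blast
  obtain W s f where W: "qis R W C s" "qis R W E f"
    using E(2) iso_D_zigzag[OF C two_term_injective_complexes[OF E(1)]] unfolding iso_D_def by blast
  obtain g where g: "g \<in> chain_maps R C E" "heq R W E f (comp_map g s)"
    using qis_extend[OF W(1) E(1) qisD(3)[OF W(2)]] .
  have gs: "qis R W E (comp_map g s)" by (rule qis_heq[OF W(2) g(2)])
  note C = C and EC = two_term_injective_complexes[OF E(1)]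
  have "coh_inj C E g" by (rule coh_inj_cancel_right[OF qisD(5)[OF gs] qisD(6,3)[OF W(1)] g(1) qisD(1)[OF W(1)] C EC])
  moreover have "coh_surj C E g" by (rule coh_surj_cancel[OF qisD(6)[OF gs] qisD(3,1)[OF W(1)] C])
  ultimately have "qis R C E g" using g(1) C EC by (simp add: qis_def quasi_iso_iff[OF C EC])
  then have "injective_model U R C E g m"
    using R E(1) universe by (intro injective_model.intro universe.intro injective_model_axioms.intro)
  then show thesis by (rule that)
qed

end


section \<open>Stalk complexes of ideals\<close>

context universe
begin

definition stalk :: "int \<Rightarrow> ('r, 'u) module \<Rightarrow> ('r, 'u) cochain" where
  "stalk k M = \<lparr> obj = (\<lambda>n. if n = k then M else zero_module),
     diff = (\<lambda>n x. \<zero>\<^bsub>if n + 1 = k then M else zero_module\<^esub>) \<rparr>"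

definition stalk_map :: "int \<Rightarrow> ('r, 'u) cochain \<Rightarrow> ('u \<Rightarrow> 'u) \<Rightarrow> int \<Rightarrow> 'u \<Rightarrow> 'u" where
  "stalk_map k Y f = (\<lambda>n x. if n = k then f x else \<zero>\<^bsub>obj Y n\<^esub>)"

lemma stalk_obj [simp]: "obj (stalk k M) k = M"
  by (simp add: stalk_def)

lemma stalk_diff: "diff (stalk k M) n x = \<zero>\<^bsub>obj (stalk k M) (n + 1)\<^esub>"
  by (simp add: stalk_def)

lemma stalk_carrier: "n \<noteq> k \<Longrightarrow> x \<in> carrier (obj (stalk k M) n) \<Longrightarrow> x = \<zero>\<^bsub>obj (stalk k M) n\<^esub>"
  by (simp add: stalk_def zero_module_def)

lemma zero_module_small:
  assumes "cring R" shows "small_module R (zero_module :: ('r, 'u) module)"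
  using complexes_small_module[OF zero_complex_complexes[OF assms], of 0] by (simp add: zero_complex_def)

lemma stalk_complexes:
  fixes M :: "('r, 'u) module"
  assumes "small_module R M" shows "stalk k M \<in> complexes R"
proof -
  have R: "cring R" using assms by (simp add: small_module_def module_def)
  have sm: "small_module R (obj (stalk k M) n)" for n
    using assms zero_module_small[OF R] by (simp add: stalk_def)
  then have md: "module R (obj (stalk k M) n)" for n by (simp add: small_module_def)
  have "diff (stalk k M) n = (\<lambda>x. \<zero>\<^bsub>obj (stalk k M) (n + 1)\<^esub>)" for n by (simp add: stalk_def)
  then have "diff (stalk k M) n \<in> mod_hom R (obj (stalk k M) n) (obj (stalk k M) (n + 1))" for n
    using mod_hom_const_zero[OF md] by simp
  moreover have "n + 1 + 1 = n + 2" for n :: int by simp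
  ultimately show ?thesis using sm by (intro complexesI) (simp_all add: stalk_diff add.commute[of 2])
qed

lemma stalk_map_chain_map:
  fixes M :: "('r, 'u) module"
  assumes M: "small_module R M" and Y: "Y \<in> complexes R" and f: "f \<in> mod_hom R M (obj Y k)"
    and cyc: "\<And>x. x \<in> carrier M \<Longrightarrow> f x \<in> cocycles Y k"
  shows "stalk_map k Y f \<in> chain_maps R (stalk k M) Y"
proof (rule chain_mapsI)
  fix n show "stalk_map k Y f n \<in> mod_hom R (obj (stalk k M) n) (obj Y n)"
  proof (cases "n = k")
    case True then show ?thesis using f by (simp add: stalk_map_def)
  next
    case False then show ?thesis using mod_hom_const_zero[OF complexes_module[OF Y]] by (simp add: stalk_map_def)
  qed
next
  fix n x assume x: "x \<in> carrier (obj (stalk k M) n)"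
  have f0: "f \<zero>\<^bsub>M\<^esub> = \<zero>\<^bsub>obj Y k\<^esub>"
    using mod_hom_zero[OF f _ complexes_group[OF Y]] M by (simp add: small_module_def module_def)
  then have l: "stalk_map k Y f (n + 1) (diff (stalk k M) n x) = \<zero>\<^bsub>obj Y (n + 1)\<^esub>"
    by (auto simp: stalk_map_def stalk_diff)
  show "stalk_map k Y f (n + 1) (diff (stalk k M) n x) = diff Y n (stalk_map k Y f n x)"
  proof (cases "n = k")
    case True
    then show ?thesis using x cyc[of x] cocycles_diff[of "f x" Y k] by (simp add: l) (simp add: stalk_map_def)
  next
    case False
    then show ?thesis using diff_zero[OF Y, of n] by (simp add: l) (simp add: stalk_map_def)
  qed
qed

lemma stalk_cocycles: "z \<in> carrier M \<Longrightarrow> z \<in> cocycles (stalk k M) k"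
  by (simp add: cocycles_def stalk_diff)

lemma stalk_coboundaries: "b \<in> coboundaries (stalk k M) k \<Longrightarrow> b = \<zero>\<^bsub>M\<^esub>"
  by (auto simp: coboundaries_def stalk_diff)

text \<open>An ideal of \<open>R\<close> as an \<open>R\<close>-module, moved into the universe along an injection \<open>c\<close>.\<close>

definition ideal_module :: "('r \<Rightarrow> 'u) \<Rightarrow> 'r ring \<Rightarrow> 'r set \<Rightarrow> ('r, 'u) module" where
  "ideal_module c R S = (let d = inv_into (carrier R) c in
     \<lparr> carrier = c ` S, monoid.mult = undefined, one = undefined, ring.zero = c \<zero>\<^bsub>R\<^esub>,
       add = (\<lambda>x y. c (d x \<oplus>\<^bsub>R\<^esub> d y)), smult = (\<lambda>a x. c (a \<otimes>\<^bsub>R\<^esub> d x)) \<rparr>)"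

lemma ideal_module_small:
  fixes c :: "'r \<Rightarrow> 'u"
  assumes R: "cring R" and S: "ideal S R" and c: "inj_on c (carrier R)"
    and small: "carrier R \<prec> (UNIV :: 'u set)"
  shows "small_module R (ideal_module c R S)"
proof -
  interpret cring R by fact
  interpret S: ideal S R by fact
  have sc: "x \<in> carrier R" if "x \<in> S" for x using that S.a_subset by blast
  have d: "inv_into (carrier R) c (c x) = x" if "x \<in> carrier R" for x using c that by simp
  have neg: "\<ominus>\<^bsub>R\<^esub> x \<in> S" if "x \<in> S" for x using that by (rule S.a_inv_closed)
  have "abelian_group (ideal_module c R S)"
  proof (rule abelian_groupI)
    fix x assume "x \<in> carrier (ideal_module c R S)"
    then obtain y where y: "y \<in> S" "x = c y" by (auto simp: ideal_module_def Let_def)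
    then have "c (\<ominus>\<^bsub>R\<^esub> y) \<oplus>\<^bsub>ideal_module c R S\<^esub> x = \<zero>\<^bsub>ideal_module c R S\<^esub>"
      using sc[OF y(1)] by (simp add: ideal_module_def Let_def d l_neg)
    moreover have "c (\<ominus>\<^bsub>R\<^esub> y) \<in> carrier (ideal_module c R S)"
      using neg[OF y(1)] by (simp add: ideal_module_def Let_def)
    ultimately show "\<exists>y\<in>carrier (ideal_module c R S). y \<oplus>\<^bsub>ideal_module c R S\<^esub> x = \<zero>\<^bsub>ideal_module c R S\<^esub>"
      by blast
  qed (auto simp: ideal_module_def Let_def d sc a_ac)
  then have "module R (ideal_module c R S)"
    by (rule moduleI[OF R])
      (auto simp: ideal_module_def Let_def d sc S.I_l_closed l_distr r_distr m_assoc)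
  moreover have "c ` S \<prec> (UNIV :: 'u set)"
    using small S.a_subset image_lepoll subset_imp_lepoll lesspoll_trans1 by metis
  ultimately show ?thesis by (simp add: small_module_def) (simp add: ideal_module_def Let_def)
qed

lemma ideal_module_hom:
  fixes c :: "'r \<Rightarrow> 'u" and M :: "('r, 'u) module"
  assumes M: "module R M" and S: "ideal S R" and c: "inj_on c (carrier R)" and y: "y \<in> carrier M"
  shows "(\<lambda>x. inv_into (carrier R) c x \<odot>\<^bsub>M\<^esub> y) \<in> mod_hom R (ideal_module c R S) M"
proof -
  interpret M: module R M by fact
  interpret S: ideal S R by fact
  have sc: "x \<in> carrier R" if "x \<in> S" for x using that S.a_subset by blast
  have d: "inv_into (carrier R) c (c x) = x" if "x \<in> carrier R" for x using c that by simp
  show ?thesis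
    by (rule mod_homI)
      (auto simp: ideal_module_def Let_def d sc y M.smult_l_distr M.smult_assoc1)
qed

end


section \<open>Ideals in noetherian rings\<close>

lemma (in noetherian_ring) maximal_in_ideals:
  assumes "A \<noteq> {}" "A \<subseteq> {I. ideal I R}"
  obtains M where "M \<in> A" "\<And>I. I \<in> A \<Longrightarrow> M \<subseteq> I \<Longrightarrow> I = M"
proof -
  have "\<exists>M\<in>A. \<forall>X\<in>A. M \<subseteq> X \<longrightarrow> X = M"
  proof (rule subset_Zorn_nonempty[OF assms(1)])
    fix C assume C: "C \<noteq> {}" "subset.chain A C"
    then have "subset.chain {I. ideal I R} C" using assms(2) by (auto simp: subset.chain_def)
    from ideal_chain_is_trivial[OF C(1) this] C(2) show "\<Union>C \<in> A" by (auto simp: subset.chain_def)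
  qed
  then show thesis using that by blast
qed

lemma (in cring) ideal_criterion:
  assumes sub: "S \<subseteq> carrier R" and zero: "\<zero> \<in> S" and add: "\<And>x y. x \<in> S \<Longrightarrow> y \<in> S \<Longrightarrow> x \<oplus> y \<in> S"
    and mult: "\<And>a x. a \<in> carrier R \<Longrightarrow> x \<in> S \<Longrightarrow> a \<otimes> x \<in> S"
  shows "ideal S R"
proof (rule idealI[OF ring_axioms])
  show "subgroup S (add_monoid R)"
  proof (rule add.subgroupI)
    fix x assume x: "x \<in> S"
    have "\<ominus> \<one> \<otimes> x \<in> S" using mult[OF _ x] by simp
    moreover have "\<ominus> \<one> \<otimes> x = \<ominus> x" using x sub by (auto simp: l_minus)
    ultimately show "\<ominus> x \<in> S" by simp
  qed (use assms in auto)
  fix a x assume "a \<in> S" "x \<in> carrier R"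
  then show "x \<otimes> a \<in> S" "a \<otimes> x \<in> S" using mult[of x a] m_comm[of a x] sub by auto
qed

lemma (in cring) annihilator_ideal:
  assumes "s \<in> carrier R" shows "ideal {r \<in> carrier R. s \<otimes> r = \<zero>} R"
  using assms by (intro ideal_criterion) (auto simp: r_distr m_lcomm)

lemma (in module) annihilator_ideal:
  assumes "y \<in> carrier M" shows "ideal {r \<in> carrier R. r \<odot>\<^bsub>M\<^esub> y = \<zero>\<^bsub>M\<^esub>} R"
  using assms by (intro R.ideal_criterion) (auto simp: smult_l_distr smult_assoc1)

text \<open>
  A form of Nakayama's lemma at the prime ideal \<open>ann(y)\<close>: an ideal \<open>J\<close> that is not killed by any
  \<open>s\<close> outside this prime maps nontrivially to \<open>R y\<close>.  Take an ideal \<open>L \<subseteq> J\<close> maximal among those that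
  contain no \<open>s J\<close> with \<open>s y \<noteq> 0\<close>, and \<open>j \<in> J - L\<close>.  Then \<open>s J \<subseteq> L + R j\<close> for some \<open>s\<close> with
  \<open>s y \<noteq> 0\<close>, and the map sends \<open>r \<in> J\<close> to \<open>t y\<close> where \<open>s r \<in> t j + L\<close>.
\<close>

lemma nonzero_map_to_cyclic:
  assumes noeth: "noetherian_ring R" and M: "module R M"
    and J: "ideal J R" and y: "y \<in> carrier M" "y \<noteq> \<zero>\<^bsub>M\<^esub>"
    and prime: "\<And>a b. a \<in> carrier R \<Longrightarrow> b \<in> carrier R \<Longrightarrow> a \<odot>\<^bsub>M\<^esub> y \<noteq> \<zero>\<^bsub>M\<^esub> \<Longrightarrow> b \<odot>\<^bsub>M\<^esub> y \<noteq> \<zero>\<^bsub>M\<^esub> \<Longrightarrow>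
       (a \<otimes>\<^bsub>R\<^esub> b) \<odot>\<^bsub>M\<^esub> y \<noteq> \<zero>\<^bsub>M\<^esub>"
    and J0: "\<And>s. s \<in> carrier R \<Longrightarrow> s \<odot>\<^bsub>M\<^esub> y \<noteq> \<zero>\<^bsub>M\<^esub> \<Longrightarrow> \<exists>r\<in>J. s \<otimes>\<^bsub>R\<^esub> r \<noteq> \<zero>\<^bsub>R\<^esub>"
  obtains psi where "\<And>r. r \<in> J \<Longrightarrow> \<exists>t\<in>carrier R. psi r = t \<odot>\<^bsub>M\<^esub> y"
    "\<And>r r'. r \<in> J \<Longrightarrow> r' \<in> J \<Longrightarrow> psi (r \<oplus>\<^bsub>R\<^esub> r') = psi r \<oplus>\<^bsub>M\<^esub> psi r'"
    "\<And>a r. a \<in> carrier R \<Longrightarrow> r \<in> J \<Longrightarrow> psi (a \<otimes>\<^bsub>R\<^esub> r) = a \<odot>\<^bsub>M\<^esub> psi r"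
    "\<exists>r\<in>J. psi r \<noteq> \<zero>\<^bsub>M\<^esub>"
proof -
  interpret M: module R M by fact
  interpret R: noetherian_ring R by fact
  interpret J: ideal J R by fact
  have Jc: "r \<in> carrier R" if "r \<in> J" for r using that J.a_subset by blast
  define A where "A = {L. ideal L R \<and> L \<subseteq> J \<and>
    (\<forall>s\<in>carrier R. s \<odot>\<^bsub>M\<^esub> y \<noteq> \<zero>\<^bsub>M\<^esub> \<longrightarrow> \<not> (\<forall>r\<in>J. s \<otimes>\<^bsub>R\<^esub> r \<in> L))}"
  have "{\<zero>\<^bsub>R\<^esub>} \<in> A" unfolding A_def using M.R.zeroideal J0 J.zero_closed by auto
  then obtain L where L: "L \<in> A" "\<And>I. I \<in> A \<Longrightarrow> L \<subseteq> I \<Longrightarrow> I = L"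
    using R.maximal_in_ideals[of A] unfolding A_def by blast
  have Lideal: "ideal L R" and LJ: "L \<subseteq> J" using L(1) by (auto simp: A_def)
  interpret L: ideal L R by fact
  have Ls: "\<not> (\<forall>r\<in>J. s \<otimes>\<^bsub>R\<^esub> r \<in> L)" if "s \<in> carrier R" "s \<odot>\<^bsub>M\<^esub> y \<noteq> \<zero>\<^bsub>M\<^esub>" for s
    using L(1) that by (auto simp: A_def)
  have Lc: "r \<in> carrier R" if "r \<in> L" for r using that L.a_subset by blast
  have "\<one>\<^bsub>R\<^esub> \<odot>\<^bsub>M\<^esub> y \<noteq> \<zero>\<^bsub>M\<^esub>" using y by simp
  then obtain j where j: "j \<in> J" "\<one>\<^bsub>R\<^esub> \<otimes>\<^bsub>R\<^esub> j \<notin> L" using Ls[OF M.R.one_closed] by blast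
  then have jL: "j \<notin> L" and jc: "j \<in> carrier R" using Jc by auto
  define L' where "L' = L <+>\<^bsub>R\<^esub> PIdl\<^bsub>R\<^esub> j"
  have L'ideal: "ideal L' R" unfolding L'_def by (intro M.R.add_ideals Lideal M.R.cgenideal_ideal jc)
  have L'_iff: "x \<in> L' \<longleftrightarrow> (\<exists>l\<in>L. \<exists>t\<in>carrier R. x = l \<oplus>\<^bsub>R\<^esub> t \<otimes>\<^bsub>R\<^esub> j)" for x
    unfolding L'_def set_add_def' cgenideal_def by blast
  have "L \<subseteq> L'"
  proof
    fix l assume "l \<in> L"
    moreover from this have "l = l \<oplus>\<^bsub>R\<^esub> \<zero>\<^bsub>R\<^esub> \<otimes>\<^bsub>R\<^esub> j" using Lc jc by simp
    ultimately show "l \<in> L'" unfolding L'_iff by blast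
  qed
  moreover have "j \<in> L'"
  proof -
    have "j = \<zero>\<^bsub>R\<^esub> \<oplus>\<^bsub>R\<^esub> \<one>\<^bsub>R\<^esub> \<otimes>\<^bsub>R\<^esub> j" using jc by simp
    then show ?thesis unfolding L'_iff using L.zero_closed by blast
  qed
  moreover have "L' \<subseteq> J"
  proof
    fix x assume "x \<in> L'"
    then obtain l t where "l \<in> L" "t \<in> carrier R" "x = l \<oplus>\<^bsub>R\<^esub> t \<otimes>\<^bsub>R\<^esub> j" unfolding L'_iff by blast
    then show "x \<in> J" using LJ J.I_l_closed[OF j(1)] by (auto intro: J.a_closed)
  qed
  ultimately have "L' \<notin> A" using L(2)[of L'] jL by blast
  then obtain s where s: "s \<in> carrier R" "s \<odot>\<^bsub>M\<^esub> y \<noteq> \<zero>\<^bsub>M\<^esub>" "\<And>r. r \<in> J \<Longrightarrow> s \<otimes>\<^bsub>R\<^esub> r \<in> L'"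
    unfolding A_def using L'ideal \<open>L' \<subseteq> J\<close> by blast
  have ex: "\<exists>t. t \<in> carrier R \<and> (s \<otimes>\<^bsub>R\<^esub> r) \<ominus>\<^bsub>R\<^esub> (t \<otimes>\<^bsub>R\<^esub> j) \<in> L" if r: "r \<in> J" for r
  proof -
    obtain l t where lt: "l \<in> L" "t \<in> carrier R" "s \<otimes>\<^bsub>R\<^esub> r = l \<oplus>\<^bsub>R\<^esub> t \<otimes>\<^bsub>R\<^esub> j"
      using s(3)[OF r] unfolding L'_iff by blast
    have "(l \<oplus>\<^bsub>R\<^esub> t \<otimes>\<^bsub>R\<^esub> j) \<ominus>\<^bsub>R\<^esub> (t \<otimes>\<^bsub>R\<^esub> j) = l" using Lc[OF lt(1)] lt(2) jc by algebra
    then show ?thesis using lt by auto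
  qed
  define tt where "tt = (\<lambda>r. SOME t. t \<in> carrier R \<and> (s \<otimes>\<^bsub>R\<^esub> r) \<ominus>\<^bsub>R\<^esub> (t \<otimes>\<^bsub>R\<^esub> j) \<in> L)"
  have tt: "tt r \<in> carrier R" "(s \<otimes>\<^bsub>R\<^esub> r) \<ominus>\<^bsub>R\<^esub> (tt r \<otimes>\<^bsub>R\<^esub> j) \<in> L" if "r \<in> J" for r
    using someI_ex[OF ex[OF that]] unfolding tt_def by blast+
  have zero: "t \<odot>\<^bsub>M\<^esub> y = \<zero>\<^bsub>M\<^esub>" if t: "t \<in> carrier R" "t \<otimes>\<^bsub>R\<^esub> j \<in> L" for t
  proof (rule ccontr)
    assume "t \<odot>\<^bsub>M\<^esub> y \<noteq> \<zero>\<^bsub>M\<^esub>"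
    from prime[OF t(1) s(1) this s(2)] have ts: "(t \<otimes>\<^bsub>R\<^esub> s) \<odot>\<^bsub>M\<^esub> y \<noteq> \<zero>\<^bsub>M\<^esub>" .
    have "(t \<otimes>\<^bsub>R\<^esub> s) \<otimes>\<^bsub>R\<^esub> r \<in> L" if r: "r \<in> J" for r
    proof -
      obtain l u where lu: "l \<in> L" "u \<in> carrier R" "s \<otimes>\<^bsub>R\<^esub> r = l \<oplus>\<^bsub>R\<^esub> u \<otimes>\<^bsub>R\<^esub> j"
        using s(3)[OF r] unfolding L'_iff by blast
      have "(t \<otimes>\<^bsub>R\<^esub> s) \<otimes>\<^bsub>R\<^esub> r = t \<otimes>\<^bsub>R\<^esub> (s \<otimes>\<^bsub>R\<^esub> r)" using t s(1) Jc[OF r] by (simp add: M.R.m_assoc)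
      also have "\<dots> = t \<otimes>\<^bsub>R\<^esub> l \<oplus>\<^bsub>R\<^esub> u \<otimes>\<^bsub>R\<^esub> (t \<otimes>\<^bsub>R\<^esub> j)"
        unfolding lu(3) using t(1) Lc[OF lu(1)] lu(2) jc by (simp add: M.R.r_distr M.R.m_lcomm)
      also have "\<dots> \<in> L" using L.I_l_closed[OF lu(1) t(1)] L.I_l_closed[OF t(2) lu(2)] by (rule L.a_closed)
      finally show ?thesis .
    qed
    then show False using Ls[OF _ ts] t(1) s(1) by simp
  qed
  have uniq: "t \<odot>\<^bsub>M\<^esub> y = tt r \<odot>\<^bsub>M\<^esub> y"
    if r: "r \<in> J" and t: "t \<in> carrier R" "(s \<otimes>\<^bsub>R\<^esub> r) \<ominus>\<^bsub>R\<^esub> (t \<otimes>\<^bsub>R\<^esub> j) \<in> L" for r t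
  proof -
    note c = t(1) tt(1)[OF r] jc s(1) Jc[OF r]
    have "(t \<ominus>\<^bsub>R\<^esub> tt r) \<otimes>\<^bsub>R\<^esub> j =
       ((s \<otimes>\<^bsub>R\<^esub> r) \<ominus>\<^bsub>R\<^esub> (tt r \<otimes>\<^bsub>R\<^esub> j)) \<oplus>\<^bsub>R\<^esub> \<ominus>\<^bsub>R\<^esub> ((s \<otimes>\<^bsub>R\<^esub> r) \<ominus>\<^bsub>R\<^esub> (t \<otimes>\<^bsub>R\<^esub> j))"
      using c by algebra
    also have "\<dots> \<in> L" by (intro L.a_closed tt(2)[OF r] L.a_inv_closed t(2))
    finally have "(t \<ominus>\<^bsub>R\<^esub> tt r) \<odot>\<^bsub>M\<^esub> y = \<zero>\<^bsub>M\<^esub>" using c by (intro zero) simp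
    then have "t \<odot>\<^bsub>M\<^esub> y \<ominus>\<^bsub>M\<^esub> tt r \<odot>\<^bsub>M\<^esub> y = \<zero>\<^bsub>M\<^esub>"
      using c y by (simp add: a_minus_def M.smult_l_distr M.smult_l_minus)
    then show ?thesis using c y by (simp add: M.M.minus_eq_zero_iff)
  qed
  show thesis
  proof (rule that[of "\<lambda>r. tt r \<odot>\<^bsub>M\<^esub> y"])
    show "\<exists>t\<in>carrier R. tt r \<odot>\<^bsub>M\<^esub> y = t \<odot>\<^bsub>M\<^esub> y" if "r \<in> J" for r using tt(1)[OF that] by blast
  next
    fix r r' assume r: "r \<in> J" "r' \<in> J"
    note c = tt(1)[OF r(1)] tt(1)[OF r(2)] jc s(1) Jc[OF r(1)] Jc[OF r(2)]
    have "(s \<otimes>\<^bsub>R\<^esub> (r \<oplus>\<^bsub>R\<^esub> r')) \<ominus>\<^bsub>R\<^esub> ((tt r \<oplus>\<^bsub>R\<^esub> tt r') \<otimes>\<^bsub>R\<^esub> j) =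
       ((s \<otimes>\<^bsub>R\<^esub> r) \<ominus>\<^bsub>R\<^esub> (tt r \<otimes>\<^bsub>R\<^esub> j)) \<oplus>\<^bsub>R\<^esub> ((s \<otimes>\<^bsub>R\<^esub> r') \<ominus>\<^bsub>R\<^esub> (tt r' \<otimes>\<^bsub>R\<^esub> j))"
      using c by algebra
    also have "\<dots> \<in> L" by (intro L.a_closed tt(2) r)
    finally have "(tt r \<oplus>\<^bsub>R\<^esub> tt r') \<odot>\<^bsub>M\<^esub> y = tt (r \<oplus>\<^bsub>R\<^esub> r') \<odot>\<^bsub>M\<^esub> y"
      using c by (intro uniq J.a_closed r) simp
    then show "tt (r \<oplus>\<^bsub>R\<^esub> r') \<odot>\<^bsub>M\<^esub> y = tt r \<odot>\<^bsub>M\<^esub> y \<oplus>\<^bsub>M\<^esub> tt r' \<odot>\<^bsub>M\<^esub> y"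
      using c y by (simp add: M.smult_l_distr)
  next
    fix a r assume a: "a \<in> carrier R" and r: "r \<in> J"
    note c = tt(1)[OF r] jc s(1) Jc[OF r] a
    have "(s \<otimes>\<^bsub>R\<^esub> (a \<otimes>\<^bsub>R\<^esub> r)) \<ominus>\<^bsub>R\<^esub> ((a \<otimes>\<^bsub>R\<^esub> tt r) \<otimes>\<^bsub>R\<^esub> j) =
       a \<otimes>\<^bsub>R\<^esub> ((s \<otimes>\<^bsub>R\<^esub> r) \<ominus>\<^bsub>R\<^esub> (tt r \<otimes>\<^bsub>R\<^esub> j))"
      using c by algebra
    also have "\<dots> \<in> L" by (intro L.I_l_closed tt(2) r a)
    finally have "(a \<otimes>\<^bsub>R\<^esub> tt r) \<odot>\<^bsub>M\<^esub> y = tt (a \<otimes>\<^bsub>R\<^esub> r) \<odot>\<^bsub>M\<^esub> y"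
      using c by (intro uniq J.I_l_closed r a) simp
    then show "tt (a \<otimes>\<^bsub>R\<^esub> r) \<odot>\<^bsub>M\<^esub> y = a \<odot>\<^bsub>M\<^esub> (tt r \<odot>\<^bsub>M\<^esub> y)"
      using c y by (simp add: M.smult_assoc1)
  next
    have "(s \<otimes>\<^bsub>R\<^esub> j) \<ominus>\<^bsub>R\<^esub> (s \<otimes>\<^bsub>R\<^esub> j) = \<zero>\<^bsub>R\<^esub>" using s(1) jc by algebra
    then have "s \<odot>\<^bsub>M\<^esub> y = tt j \<odot>\<^bsub>M\<^esub> y" using L.zero_closed s(1) by (intro uniq j(1)) simp_all
    then show "\<exists>r\<in>J. tt r \<odot>\<^bsub>M\<^esub> y \<noteq> \<zero>\<^bsub>M\<^esub>" using s(2) j(1) by auto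
  qed
qed


section \<open>Truncation arguments\<close>

lemma all_null_of_acyclic:
  assumes E: "two_term_injective R E m" and X: "X \<in> complexes R"
    and ex: "cocycles X m \<subseteq> coboundaries X m" "cocycles X (m + 1) \<subseteq> coboundaries X (m + 1)"
  shows "all_null R X E"
  unfolding all_null_def
proof
  fix h assume h: "h \<in> chain_maps R X E"
  have "homotopic R X E h (zero_map E)"
    by (rule null_homotopic_two_term[OF E X h _ ex(2)])
      (use two_term_coboundaries[OF E chain_map_coboundaries[OF h]] ex(1) in blast)
  then show "heq R X E h (zero_map E)"
    using X two_term_injective_complexes[OF E] h by (simp add: heq_def)
qed

text \<open>
  A homomorphism \<open>q : H\<^sup>m(A) \<rightarrow> ker(E\<^sup>m \<rightarrow> E\<^sup>m\<^sup>+\<^sup>1)\<close> always comes from a chain map: extend \<open>q\<close> from the cocycles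
  to \<open>h\<^sub>0\<close> on \<open>A\<^sup>m\<close>, and \<open>d h\<^sub>0\<close>, which kills the cocycles, from \<open>A\<^sup>m / Z\<^sup>m(A)\<close> to \<open>A\<^sup>m\<^sup>+\<^sup>1\<close>.  A null homotopic
  chain map is zero on cohomology, and \<open>E\<close> has no nonzero coboundaries in degree \<open>m\<close>; so \<open>q = 0\<close>.
\<close>

lemma cohomology_map_zero:
  fixes A E :: "('r, 'u) cochain"
  assumes E: "two_term_injective R E m" and A: "A \<in> complexes R" and null: "all_null R A E"
    and mem: "\<And>z. z \<in> cocycles A m \<Longrightarrow> q z \<in> cocycles E m"
    and add: "\<And>z z'. z \<in> cocycles A m \<Longrightarrow> z' \<in> cocycles A m \<Longrightarrow>
       q (z \<oplus>\<^bsub>obj A m\<^esub> z') = q z \<oplus>\<^bsub>obj E m\<^esub> q z'"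
    and smult: "\<And>a z. a \<in> carrier R \<Longrightarrow> z \<in> cocycles A m \<Longrightarrow> q (a \<odot>\<^bsub>obj A m\<^esub> z) = a \<odot>\<^bsub>obj E m\<^esub> q z"
    and kill: "\<And>b. b \<in> coboundaries A m \<Longrightarrow> q b = \<zero>\<^bsub>obj E m\<^esub>"
    and z: "z \<in> cocycles A m"
  shows "q z = \<zero>\<^bsub>obj E m\<^esub>"
proof -
  note EC = two_term_injective_complexes[OF E]
  have inj: "injective_module R (obj E n)" for n using E by (simp add: two_term_injective_def)
  note sm = complexes_small_module[OF A]
  interpret Am: module R "obj A m" using A by (rule complexes_module)
  interpret Em: abelian_group "obj E m" using EC by (rule complexes_group)
  define Zm where "Zm = (obj A m)\<lparr>carrier := cocycles A m\<rparr>"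
  have "submodule (cocycles A m) R (obj A m)"
    by (rule Am.submoduleI)
      (auto simp: cocycles_add[OF A] cocycles_uminus[OF A] cocycles_smult[OF A]
        intro: coboundaries_cocycles[OF A coboundaries_zero[OF A]])
  then have Zmod: "module R Zm" unfolding Zm_def by (rule module_carrier_update[OF _ Am.module_axioms])
  have "cocycles A m \<lesssim> carrier (obj A m)" by (rule subset_imp_lepoll) auto
  then have Zs: "small_module R Zm"
    using Zmod sm[of m] lesspoll_trans1 unfolding small_module_def by (auto simp: Zm_def)
  have "q \<in> mod_hom R Zm (obj E m)"
    by (rule mod_homI) (use mem add smult in \<open>auto simp: Zm_def\<close>)
  moreover have "(\<lambda>x. x) \<in> mod_hom R Zm (obj A m)"
    by (rule mod_homI) (auto simp: Zm_def)
  moreover have "q x = \<zero>\<^bsub>obj E m\<^esub>" if "x \<in> carrier Zm" "x = \<zero>\<^bsub>obj A m\<^esub>" for x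
    using kill[OF coboundaries_zero[OF A]] that by simp
  ultimately obtain h0 where h0: "h0 \<in> mod_hom R (obj A m) (obj E m)" "\<And>x. x \<in> carrier Zm \<Longrightarrow> h0 x = q x"
    using injective_extend[OF inj Zs sm] by metis
  have h0q: "h0 x = q x" if "x \<in> cocycles A m" for x using h0(2) that by (simp add: Zm_def)
  have dh0: "(\<lambda>x. diff E m (h0 x)) \<in> mod_hom R (obj A m) (obj E (m + 1))"
    by (rule mod_hom_comp[OF h0(1) diff_hom[OF EC refl]])
  have "diff E m (h0 x) = \<zero>\<^bsub>obj E (m + 1)\<^esub>"
    if "x \<in> carrier (obj A m)" "diff A m x = \<zero>\<^bsub>obj A (m + 1)\<^esub>" for x
    using cocycles_diff[OF mem[OF cocyclesI[OF that]]] h0q[OF cocyclesI[OF that]] by simp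
  then obtain h1 where h1: "h1 \<in> mod_hom R (obj A (m + 1)) (obj E (m + 1))"
      "\<And>x. x \<in> carrier (obj A m) \<Longrightarrow> h1 (diff A m x) = diff E m (h0 x)"
    using injective_extend[OF inj sm sm diff_hom[OF A refl] dh0] by metis
  define p where "p = (\<lambda>n x. if n = m then h0 x else if n = m + 1 then h1 x else \<zero>\<^bsub>obj E n\<^esub>)"
  have ph: "p n \<in> mod_hom R (obj A n) (obj E n)" for n
  proof -
    consider "n = m" | "n = m + 1" | "n \<noteq> m" "n \<noteq> m + 1" by blast
    then show ?thesis
    proof cases
      case 1 then show ?thesis using h0(1) by (simp add: p_def)
    next
      case 2 then show ?thesis using h1(1) by (simp add: p_def)
    next
      case 3 then show ?thesis using mod_hom_const_zero[OF complexes_module[OF EC]] by (simp add: p_def)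
    qed
  qed
  have p: "p \<in> chain_maps R A E"
  proof (rule chain_mapsI[OF ph])
    fix n x assume x: "x \<in> carrier (obj A n)"
    consider "n = m" | "n + 1 = m" | "n \<noteq> m" "n + 1 \<noteq> m" by blast
    then show "p (n + 1) (diff A n x) = diff E n (p n x)"
    proof cases
      case 1
      then show ?thesis using h1(2) x by (simp add: p_def)
    next
      case 2
      then have b: "diff A n x \<in> coboundaries A m" using coboundariesI[OF x] by simp
      have "p (n + 1) (diff A n x) = \<zero>\<^bsub>obj E m\<^esub>"
        using 2 h0q[OF coboundaries_cocycles[OF A b]] kill[OF b] by (simp add: p_def)
      moreover have "diff E n (p n x) = \<zero>\<^bsub>obj E m\<^esub>"
      proof -
        have "n \<noteq> m" "n \<noteq> m + 1" using 2 by auto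
        then show ?thesis using 2 diff_zero[OF EC, of n] by (simp add: p_def)
      qed
      ultimately show ?thesis by simp
    next
      case 3
      have 1: "diff E n (p n x) \<in> carrier (obj E (n + 1))" using EC mod_hom_closed[OF ph x] by simp
      have 2: "p (n + 1) (diff A n x) \<in> carrier (obj E (n + 1))" using mod_hom_closed[OF ph] A x by simp
      have ne: "n + 1 \<noteq> m" "n + 1 \<noteq> m + 1" using 3 by auto
      show ?thesis
        using two_term_injective_zero[OF E ne 1] two_term_injective_zero[OF E ne 2] by simp
    qed
  qed
  have "heq R A E p (zero_map E)" using null p by (simp add: all_null_def)
  from homotopic_cocycles[OF heqD(5)[OF this] A EC z p chain_map_zero_map[OF EC]]
  have "h0 z \<ominus>\<^bsub>obj E m\<^esub> \<zero>\<^bsub>obj E m\<^esub> \<in> coboundaries E m" by (simp add: p_def zero_map_def)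
  then have "h0 z \<ominus>\<^bsub>obj E m\<^esub> \<zero>\<^bsub>obj E m\<^esub> = \<zero>\<^bsub>obj E m\<^esub>" by (rule two_term_coboundaries[OF E])
  moreover have "h0 z \<in> carrier (obj E m)" using mod_hom_closed[OF h0(1)] z by simp
  ultimately show ?thesis using h0q[OF z] by (simp add: Em.minus_eq)
qed

text \<open>
  Two complexes isomorphic in the derived category are joined by such a zigzag, along which both
  cohomology and the vanishing of maps to complexes of injectives can be transported.
\<close>

definition zigzag :: "'r ring \<Rightarrow> ('r, 'u) cochain \<Rightarrow> ('r, 'u) cochain \<Rightarrow> bool" where
  "zigzag R X Y \<longleftrightarrow> (\<exists>W s f. qis R W X s \<and> qis R W Y f)"

lemma qis_acyclic_iff:
  assumes s: "qis R X Y s"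
  shows "cocycles X n \<subseteq> coboundaries X n \<longleftrightarrow> cocycles Y n \<subseteq> coboundaries Y n"
proof
  assume ex: "cocycles X n \<subseteq> coboundaries X n"
  show "cocycles Y n \<subseteq> coboundaries Y n"
  proof
    fix y assume y: "y \<in> cocycles Y n"
    interpret Y: abelian_group "obj Y n" using qisD(2)[OF s] by (rule complexes_group)
    obtain z where z: "z \<in> cocycles X n" "y \<ominus>\<^bsub>obj Y n\<^esub> s n z \<in> coboundaries Y n"
      using qisD(6)[OF s] y unfolding coh_surj_def by blast
    have b: "s n z \<in> coboundaries Y n" using chain_map_coboundaries[OF qisD(3)[OF s]] ex z(1) by blast
    have c: "y \<in> carrier (obj Y n)" "s n z \<in> carrier (obj Y n)"
      using y coboundaries_closed[OF qisD(2)[OF s] b] by simp_all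
    have "y = (y \<ominus>\<^bsub>obj Y n\<^esub> s n z) \<oplus>\<^bsub>obj Y n\<^esub> s n z" using c by algebra
    then show "y \<in> coboundaries Y n" using coboundaries_add[OF qisD(2)[OF s] z(2) b] by simp
  qed
next
  assume ex: "cocycles Y n \<subseteq> coboundaries Y n"
  show "cocycles X n \<subseteq> coboundaries X n"
    using qisD(5)[OF s] chain_map_cocycles[OF qisD(3,1,2)[OF s]] ex unfolding coh_inj_def by blast
qed

lemma zigzag_acyclic_iff:
  "zigzag R X Y \<Longrightarrow> cocycles X n \<subseteq> coboundaries X n \<longleftrightarrow> cocycles Y n \<subseteq> coboundaries Y n"
  unfolding zigzag_def using qis_acyclic_iff by metis

lemma (in universe) distinguished_triangleE:
  fixes X Y Z :: "('r, 'u) cochain"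
  assumes "distinguished_triangle R X Y Z u v w" "X \<in> complexes R" "Y \<in> complexes R" "Z \<in> complexes R"
  obtains A B f where "A \<in> complexes R" "B \<in> complexes R" "f \<in> chain_maps R A B"
    "zigzag R X A" "zigzag R Y B" "zigzag R Z (cone A B f)"
proof -
  obtain A B f a b c where 1: "A \<in> complexes R" "B \<in> complexes R" "f \<in> chain_maps R A B"
     "iso_mor_D R X A a" "iso_mor_D R Y B b" "iso_mor_D R Z (cone A B f) c"
    using assms(1) unfolding distinguished_triangle_def by blast
  have "zigzag R X A" unfolding zigzag_def using iso_D_zigzag[OF assms(2) 1(1,4)] by blast
  moreover have "zigzag R Y B" unfolding zigzag_def using iso_D_zigzag[OF assms(3) 1(2,5)] by blast
  moreover have "zigzag R Z (cone A B f)"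
    unfolding zigzag_def using iso_D_zigzag[OF assms(4) cone_complexes[OF 1(1-3)] 1(6)] by blast
  ultimately show thesis using that 1(1-3) by blast
qed


context universe
begin

lemma zigzag_all_null_iff:
  fixes X Y E :: "('r, 'u) cochain"
  shows "zigzag R X Y \<Longrightarrow> two_term_injective R E m \<Longrightarrow> all_null R X E \<longleftrightarrow> all_null R Y E"
  unfolding zigzag_def using all_null_qis by metis

text \<open>
  As \<open>H\<^sup>k\<^sup>-\<^sup>1(cone f) = 0\<close>, the map \<open>H\<^sup>k(A) \<rightarrow> H\<^sup>k(B)\<close> is injective, and the zigzag identifies \<open>H\<^sup>k(B)\<close> with the
  ideal \<open>S\<close>.
\<close>

lemma cohomology_embeds_in_ideal:
  fixes A B :: "('r, 'u) cochain" and c :: "'r \<Rightarrow> 'u"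
  assumes A: "A \<in> complexes R" and B: "B \<in> complexes R" and f: "f \<in> chain_maps R A B"
    and ex: "cocycles (cone A B f) (k - 1) \<subseteq> coboundaries (cone A B f) (k - 1)"
    and zz: "zigzag R (stalk k (ideal_module c R S)) B" and S: "ideal S R" and c: "inj_on c (carrier R)"
  obtains th where "\<And>z. z \<in> cocycles A k \<Longrightarrow> th z \<in> S"
    "\<And>z z'. z \<in> cocycles A k \<Longrightarrow> z' \<in> cocycles A k \<Longrightarrow> th (z \<oplus>\<^bsub>obj A k\<^esub> z') = th z \<oplus>\<^bsub>R\<^esub> th z'"
    "\<And>a z. a \<in> carrier R \<Longrightarrow> z \<in> cocycles A k \<Longrightarrow> th (a \<odot>\<^bsub>obj A k\<^esub> z) = a \<otimes>\<^bsub>R\<^esub> th z"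
    "\<And>z. z \<in> cocycles A k \<Longrightarrow> th z = \<zero>\<^bsub>R\<^esub> \<longleftrightarrow> z \<in> coboundaries A k"
proof -
  let ?M = "ideal_module c R S"
  let ?X = "stalk k ?M"
  obtain W s t where s: "qis R W ?X s" and t: "qis R W B t" using zz unfolding zigzag_def by blast
  note W = qisD(1)[OF s] and X = qisD(2)[OF s] and sc = qisD(3)[OF s] and tc = qisD(3)[OF t]
  have R: "cring R" using complexes_module[OF A] by (simp add: module_def)
  interpret R: cring R by fact
  interpret S: ideal S R by fact
  interpret Wk: module R "obj W k" using W by (rule complexes_module)
  interpret Ak: module R "obj A k" using A by (rule complexes_module)
  interpret Bk: module R "obj B k" using B by (rule complexes_module)
  have Sc: "r \<in> carrier R" if "r \<in> S" for r using that S.a_subset by blast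
  have d: "inv_into (carrier R) c (c x) = x" if "x \<in> carrier R" for x using c that by simp
  have cinj: "r = r'" if "r \<in> S" "r' \<in> S" "c r = c r'" for r r'
    using c that Sc by (metis inj_onD)
  \<comment> \<open>\<open>P z r\<close>: the classes of \<open>z\<close> and \<open>r\<close> agree in \<open>H\<^sup>k(B)\<close>, where \<open>S\<close> is identified with \<open>H\<^sup>k(B)\<close> through \<open>W\<close>.\<close>
  define P where "P = (\<lambda>z r. r \<in> S \<and> (\<exists>w\<in>cocycles W k. s k w = c r \<and>
     t k w \<ominus>\<^bsub>obj B k\<^esub> f k z \<in> coboundaries B k))"
  have tw: "t k w \<in> carrier (obj B k)" if "w \<in> cocycles W k" for w using tc that by simp
  have fz: "f k z \<in> carrier (obj B k)" if "z \<in> cocycles A k" for z using f that by simp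
  have ex_r: "\<exists>r. P z r" if z: "z \<in> cocycles A k" for z
  proof -
    obtain w where w: "w \<in> cocycles W k" "f k z \<ominus>\<^bsub>obj B k\<^esub> t k w \<in> coboundaries B k"
      using qisD(6)[OF t] chain_map_cocycles[OF f A B z] unfolding coh_surj_def by blast
    have "t k w \<ominus>\<^bsub>obj B k\<^esub> f k z = \<ominus>\<^bsub>obj B k\<^esub> (f k z \<ominus>\<^bsub>obj B k\<^esub> t k w)"
      using tw[OF w(1)] fz[OF z] by algebra
    then have b: "t k w \<ominus>\<^bsub>obj B k\<^esub> f k z \<in> coboundaries B k" using coboundaries_uminus[OF B w(2)] by simp
    have "s k w \<in> carrier ?M" using chain_map_closed[OF sc cocycles_closed[OF w(1)]] by simp
    then obtain r where "r \<in> S" "s k w = c r" by (auto simp: ideal_module_def Let_def)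
    then show ?thesis unfolding P_def using w(1) b by blast
  qed
  have P_add: "P (z \<oplus>\<^bsub>obj A k\<^esub> z') (r \<oplus>\<^bsub>R\<^esub> r')"
    if z: "z \<in> cocycles A k" "z' \<in> cocycles A k" and P: "P z r" "P z' r'" for z z' r r'
  proof -
    obtain w w' where w: "w \<in> cocycles W k" "s k w = c r" "t k w \<ominus>\<^bsub>obj B k\<^esub> f k z \<in> coboundaries B k"
       "w' \<in> cocycles W k" "s k w' = c r'" "t k w' \<ominus>\<^bsub>obj B k\<^esub> f k z' \<in> coboundaries B k" "r \<in> S" "r' \<in> S"
      using P unfolding P_def by blast
    have 1: "s k (w \<oplus>\<^bsub>obj W k\<^esub> w') = c (r \<oplus>\<^bsub>R\<^esub> r')"
      using chain_map_add[OF sc cocycles_closed[OF w(1)] cocycles_closed[OF w(4)]] w Sc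
      by (simp add: ideal_module_def Let_def d)
    have "t k (w \<oplus>\<^bsub>obj W k\<^esub> w') \<ominus>\<^bsub>obj B k\<^esub> f k (z \<oplus>\<^bsub>obj A k\<^esub> z') =
        (t k w \<oplus>\<^bsub>obj B k\<^esub> t k w') \<ominus>\<^bsub>obj B k\<^esub> (f k z \<oplus>\<^bsub>obj B k\<^esub> f k z')"
      using chain_map_add[OF tc cocycles_closed[OF w(1)] cocycles_closed[OF w(4)]]
        chain_map_add[OF f cocycles_closed[OF z(1)] cocycles_closed[OF z(2)]] by simp
    also have "\<dots> = (t k w \<ominus>\<^bsub>obj B k\<^esub> f k z) \<oplus>\<^bsub>obj B k\<^esub> (t k w' \<ominus>\<^bsub>obj B k\<^esub> f k z')"
      using tw[OF w(1)] tw[OF w(4)] fz[OF z(1)] fz[OF z(2)] by algebra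
    also have "\<dots> \<in> coboundaries B k" by (rule coboundaries_add[OF B w(3,6)])
    finally show ?thesis
      unfolding P_def using 1 S.a_closed[OF w(7,8)] cocycles_add[OF W w(1,4)] by blast
  qed
  have P_smult: "P (a \<odot>\<^bsub>obj A k\<^esub> z) (a \<otimes>\<^bsub>R\<^esub> r)"
    if a: "a \<in> carrier R" and z: "z \<in> cocycles A k" and P: "P z r" for a z r
  proof -
    obtain w where w: "w \<in> cocycles W k" "s k w = c r" "t k w \<ominus>\<^bsub>obj B k\<^esub> f k z \<in> coboundaries B k" "r \<in> S"
      using P unfolding P_def by blast
    have 1: "s k (a \<odot>\<^bsub>obj W k\<^esub> w) = c (a \<otimes>\<^bsub>R\<^esub> r)"
      using chain_map_smult[OF sc a cocycles_closed[OF w(1)]] w Sc by (simp add: ideal_module_def Let_def d)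
    have "t k (a \<odot>\<^bsub>obj W k\<^esub> w) \<ominus>\<^bsub>obj B k\<^esub> f k (a \<odot>\<^bsub>obj A k\<^esub> z) = a \<odot>\<^bsub>obj B k\<^esub> (t k w \<ominus>\<^bsub>obj B k\<^esub> f k z)"
      using chain_map_smult[OF tc a cocycles_closed[OF w(1)]] chain_map_smult[OF f a cocycles_closed[OF z]]
        a tw[OF w(1)] fz[OF z] by (simp add: a_minus_def Bk.smult_r_distr Bk.smult_r_minus)
    also have "\<dots> \<in> coboundaries B k" by (rule coboundaries_smult[OF B a w(3)])
    finally show ?thesis
      unfolding P_def using 1 S.I_l_closed[OF w(4) a] cocycles_smult[OF W a w(1)] by blast
  qed
  have P_ker: "r = \<zero>\<^bsub>R\<^esub> \<longleftrightarrow> z \<in> coboundaries A k" if z: "z \<in> cocycles A k" and P: "P z r" for z r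
  proof -
    obtain w where w: "w \<in> cocycles W k" "s k w = c r" "t k w \<ominus>\<^bsub>obj B k\<^esub> f k z \<in> coboundaries B k" "r \<in> S"
      using P unfolding P_def by blast
    have cz: "c \<zero>\<^bsub>R\<^esub> = \<zero>\<^bsub>?M\<^esub>" by (simp add: ideal_module_def Let_def)
    have "r = \<zero>\<^bsub>R\<^esub> \<longleftrightarrow> s k w = \<zero>\<^bsub>?M\<^esub>"
      unfolding w(2) cz[symmetric] using cinj[OF w(4) S.zero_closed] by blast
    also have "\<dots> \<longleftrightarrow> s k w \<in> coboundaries ?X k"
      using stalk_coboundaries coboundaries_zero[OF X, of k] by auto
    also have "\<dots> \<longleftrightarrow> w \<in> coboundaries W k"
      using qisD(5)[OF s] w(1) chain_map_coboundaries[OF sc] unfolding coh_inj_def by blast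
    also have "\<dots> \<longleftrightarrow> t k w \<in> coboundaries B k"
      using qisD(5)[OF t] w(1) chain_map_coboundaries[OF tc] unfolding coh_inj_def by blast
    also have "\<dots> \<longleftrightarrow> f k z \<in> coboundaries B k"
    proof -
      have "f k z = t k w \<ominus>\<^bsub>obj B k\<^esub> (t k w \<ominus>\<^bsub>obj B k\<^esub> f k z)"
        "t k w = (t k w \<ominus>\<^bsub>obj B k\<^esub> f k z) \<oplus>\<^bsub>obj B k\<^esub> f k z"
        using tw[OF w(1)] fz[OF z] by algebra+
      then show ?thesis using coboundaries_minus[OF B _ w(3)] coboundaries_add[OF B w(3)] by metis
    qed
    also have "\<dots> \<longleftrightarrow> z \<in> coboundaries A k"
      using cone_coh_inj[OF A B f ex z] chain_map_coboundaries[OF f] by blast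
    finally show ?thesis .
  qed
  have uniq: "r = r'" if z: "z \<in> cocycles A k" and P: "P z r" "P z r'" for z r r'
  proof -
    have rc: "r \<in> S" "r' \<in> S" using P by (auto simp: P_def)
    note m = P_smult[OF _ z P(2), of "\<ominus>\<^bsub>R\<^esub> \<one>\<^bsub>R\<^esub>"]
    have zc: "\<ominus>\<^bsub>R\<^esub> \<one>\<^bsub>R\<^esub> \<odot>\<^bsub>obj A k\<^esub> z \<in> cocycles A k" by (rule cocycles_smult[OF A _ z]) simp
    have "P (z \<oplus>\<^bsub>obj A k\<^esub> (\<ominus>\<^bsub>R\<^esub> \<one>\<^bsub>R\<^esub> \<odot>\<^bsub>obj A k\<^esub> z)) (r \<oplus>\<^bsub>R\<^esub> (\<ominus>\<^bsub>R\<^esub> \<one>\<^bsub>R\<^esub> \<otimes>\<^bsub>R\<^esub> r'))"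
      by (rule P_add[OF z zc P(1) m]) simp
    moreover have "z \<oplus>\<^bsub>obj A k\<^esub> (\<ominus>\<^bsub>R\<^esub> \<one>\<^bsub>R\<^esub> \<odot>\<^bsub>obj A k\<^esub> z) = \<zero>\<^bsub>obj A k\<^esub>"
      using z by (simp add: Ak.smult_l_minus Ak.M.r_neg)
    ultimately have "P \<zero>\<^bsub>obj A k\<^esub> (r \<oplus>\<^bsub>R\<^esub> (\<ominus>\<^bsub>R\<^esub> \<one>\<^bsub>R\<^esub> \<otimes>\<^bsub>R\<^esub> r'))" by simp
    from P_ker[OF coboundaries_cocycles[OF A coboundaries_zero[OF A]] this]
    have "r \<oplus>\<^bsub>R\<^esub> (\<ominus>\<^bsub>R\<^esub> \<one>\<^bsub>R\<^esub> \<otimes>\<^bsub>R\<^esub> r') = \<zero>\<^bsub>R\<^esub>" using coboundaries_zero[OF A] by blast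
    then show ?thesis using Sc[OF rc(1)] Sc[OF rc(2)] by (simp add: R.l_minus R.add_eq_zero_iff)
  qed
  define th where "th = (\<lambda>z. SOME r. P z r)"
  have th: "P z (th z)" if "z \<in> cocycles A k" for z using someI_ex[OF ex_r[OF that]] by (simp add: th_def)
  show thesis
  proof (rule that[of th])
    show "th z \<in> S" if "z \<in> cocycles A k" for z using th[OF that] by (simp add: P_def)
    show "th (z \<oplus>\<^bsub>obj A k\<^esub> z') = th z \<oplus>\<^bsub>R\<^esub> th z'" if z: "z \<in> cocycles A k" "z' \<in> cocycles A k" for z z'
      by (rule uniq[OF cocycles_add[OF A z] th[OF cocycles_add[OF A z]] P_add[OF z th[OF z(1)] th[OF z(2)]]])
    show "th (a \<odot>\<^bsub>obj A k\<^esub> z) = a \<otimes>\<^bsub>R\<^esub> th z" if z: "a \<in> carrier R" "z \<in> cocycles A k" for a z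
      by (rule uniq[OF cocycles_smult[OF A z] th[OF cocycles_smult[OF A z]] P_smult[OF z th[OF z(2)]]])
    show "th z = \<zero>\<^bsub>R\<^esub> \<longleftrightarrow> z \<in> coboundaries A k" if "z \<in> cocycles A k" for z
      by (rule P_ker[OF that th[OF that]])
  qed
qed

end


section \<open>Two-term cosilting complexes over noetherian rings\<close>

locale two_term_cosilting = injective_model U R C E g m
  for U :: "'u itself" and R :: "'r ring" and C E :: "('r, 'u) cochain" and g :: "int \<Rightarrow> 'u \<Rightarrow> 'u" and m :: int +
  assumes noetherian: "noetherian_ring R" and small_R: "carrier R \<prec> (UNIV :: 'u set)"
    and cosilting: "cosilting R C"
begin

definition code :: "'r \<Rightarrow> 'u" where
  "code = (SOME c. inj_on c (carrier R))"

abbreviation "decode \<equiv> inv_into (carrier R) code"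

abbreviation ideal_stalk :: "int \<Rightarrow> 'r set \<Rightarrow> ('r, 'u) cochain" where
  "ideal_stalk n S \<equiv> stalk n (ideal_module code R S)"

lemma inj_code: "inj_on code (carrier R)"
proof -
  have "\<exists>c :: 'r \<Rightarrow> 'u. inj_on c (carrier R)"
    using lesspoll_imp_lepoll[OF small_R] by (auto simp: lepoll_def)
  then show ?thesis unfolding code_def by (rule someI_ex)
qed

lemma decode_code [simp]: "r \<in> carrier R \<Longrightarrow> decode (code r) = r"
  using inj_code by simp

lemma ideal_module_carrier: "carrier (ideal_module code R S) = code ` S"
  by (simp add: ideal_module_def Let_def)

lemma ideal_small: "ideal S R \<Longrightarrow> small_module R (ideal_module code R S)"
  by (rule ideal_module_small[OF cring_R _ inj_code small_R])

lemma ideal_stalk_complexes: "ideal S R \<Longrightarrow> ideal_stalk n S \<in> complexes R"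
  by (rule stalk_complexes[OF ideal_small])

lemma whole_ring_ideal: "ideal (carrier R) R"
proof -
  interpret cring R by (rule cring_R)
  show ?thesis by (rule oneideal)
qed

text \<open>
  Multiplication of a cocycle by the elements of an ideal.  For the ideal \<open>R\<close> itself these are, up to
  values outside the carriers, all chain maps \<open>R[-n] \<rightarrow> Y\<close>.
\<close>

definition element_map :: "int \<Rightarrow> ('r, 'u) cochain \<Rightarrow> 'u \<Rightarrow> int \<Rightarrow> 'u \<Rightarrow> 'u" where
  "element_map n Y z = stalk_map n Y (\<lambda>x. decode x \<odot>\<^bsub>obj Y n\<^esub> z)"

lemma element_map_chain_map:
  assumes S: "ideal S R" and Y: "Y \<in> complexes R" and z: "z \<in> cocycles Y n"
  shows "element_map n Y z \<in> chain_maps R (ideal_stalk n S) Y"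
  unfolding element_map_def
proof (rule stalk_map_chain_map[OF ideal_small[OF S] Y])
  interpret S: ideal S R by fact
  show "(\<lambda>x. decode x \<odot>\<^bsub>obj Y n\<^esub> z) \<in> mod_hom R (ideal_module code R S) (obj Y n)"
    by (rule ideal_module_hom[OF complexes_module[OF Y] S inj_code cocycles_closed[OF z]])
  fix x assume "x \<in> carrier (ideal_module code R S)"
  then have "decode x \<in> carrier R" using S.a_subset by (auto simp: ideal_module_carrier)
  then show "decode x \<odot>\<^bsub>obj Y n\<^esub> z \<in> cocycles Y n" by (rule cocycles_smult[OF Y _ z])
qed

lemma element_map_code: "r \<in> carrier R \<Longrightarrow> element_map n Y z n (code r) = r \<odot>\<^bsub>obj Y n\<^esub> z"
  by (simp add: element_map_def stalk_map_def)

text \<open>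
  A quasi-isomorphism to \<open>R[-n]\<close> that kills the map hits the class of \<open>1\<close>, and \<open>1\<close> is sent to \<open>z\<close>.
\<close>

lemma element_map_zeroD:
  assumes Y: "Y \<in> complexes R" and z: "z \<in> cocycles Y n"
    and zero: "of_map R (ideal_stalk n (carrier R)) Y (element_map n Y z) = zero_D R (ideal_stalk n (carrier R)) Y"
  shows "z \<in> coboundaries Y n"
proof -
  let ?X = "ideal_stalk n (carrier R)"
  interpret R: cring R by (rule cring_R)
  interpret Y: module R "obj Y n" using Y by (rule complexes_module)
  note X = ideal_stalk_complexes[OF whole_ring_ideal, of n]
  note zm = element_map_chain_map[OF whole_ring_ideal Y z]
  obtain V a where V: "qis R V ?X a" "heq R V Y (comp_map (element_map n Y z) a) (zero_map Y)"
    by (rule of_map_eq_zeroD[OF X Y zm zero])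
  have u: "code \<one>\<^bsub>R\<^esub> \<in> carrier (ideal_module code R (carrier R))" by (simp add: ideal_module_carrier)
  interpret M: abelian_group "ideal_module code R (carrier R)"
    using complexes_group[OF X, of n] by simp
  obtain v where v: "v \<in> cocycles V n"
      "code \<one>\<^bsub>R\<^esub> \<ominus>\<^bsub>obj ?X n\<^esub> a n v \<in> coboundaries ?X n"
    using qisD(6)[OF V(1)] stalk_cocycles[OF u] unfolding coh_surj_def by blast
  have "a n v \<in> carrier (ideal_module code R (carrier R))"
    using chain_map_closed[OF qisD(3)[OF V(1)] cocycles_closed[OF v(1)]] by simp
  moreover have "code \<one>\<^bsub>R\<^esub> \<ominus>\<^bsub>ideal_module code R (carrier R)\<^esub> a n v = \<zero>\<^bsub>ideal_module code R (carrier R)\<^esub>"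
    using stalk_coboundaries[OF v(2)] by simp
  ultimately have av: "a n v = code \<one>\<^bsub>R\<^esub>" using u by (simp add: M.minus_eq_zero_iff)
  have "comp_map (element_map n Y z) a n v \<ominus>\<^bsub>obj Y n\<^esub> zero_map Y n v \<in> coboundaries Y n"
    by (rule homotopic_cocycles[OF heqD(5,1,2)[OF V(2)] v(1) heqD(3,4)[OF V(2)]])
  then show ?thesis using z by (simp add: comp_map_def zero_map_def av element_map_code Y.M.minus_eq)
qed

lemma perp_complexes: "Z \<in> perp R J C \<Longrightarrow> Z \<in> complexes R"
  unfolding perp_iff by blast

lemma t_structure: "t_structure R (perp R {..0} C) (perp R {0<..} C)"
  using cosilting by (simp add: cosilting_def)

lemma aisle_orthogonal:
  assumes "X \<in> perp R {..0} C" "Y \<in> perp R {0<..} C" shows "Hom_D R X Y = {zero_D R X Y}"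
  using t_structure assms unfolding t_structure_def by blast

lemma truncation:
  assumes X: "X \<in> complexes R"
  obtains X1 X2 A B f where "X1 \<in> perp R {..0} C" "X2 \<in> perp R {0<..} C"
    "A \<in> complexes R" "B \<in> complexes R" "f \<in> chain_maps R A B"
    "zigzag R X1 A" "zigzag R X B" "zigzag R X2 (cone A B f)"
proof -
  have "\<exists>X1\<in>perp R {..0} C. \<exists>X2\<in>perp R {0<..} C. \<exists>u v w. distinguished_triangle R X1 X X2 u v w"
    using t_structure[unfolded t_structure_def, THEN conjunct2, THEN conjunct2, THEN conjunct2, THEN conjunct2] X
    by (rule bspec)
  then obtain X1 X2 u v w where 1: "X1 \<in> perp R {..0} C" "X2 \<in> perp R {0<..} C"
      "distinguished_triangle R X1 X X2 u v w"
    by (elim bexE exE)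
  note c = perp_complexes[OF 1(1)] perp_complexes[OF 1(2)]
  show thesis
    by (rule distinguished_triangleE[OF 1(3) c(1) X c(2)]) (rule that[OF 1(1,2)])
qed

text \<open>
  For \<open>n < m\<close> the complex \<open>R[-n]\<close> lives below the degrees of \<open>C[k]\<close>, for every \<open>k \<le> 0\<close>.
\<close>

lemma low_stalk_in_aisle:
  assumes "n < m" shows "ideal_stalk n (carrier R) \<in> perp R {..0} C"
  unfolding perp_iff
proof (intro conjI ballI)
  let ?X = "ideal_stalk n (carrier R)"
  show X: "?X \<in> complexes R" by (rule ideal_stalk_complexes[OF whole_ring_ideal])
  fix k :: int assume k: "k \<in> {..0}"
  have ex: "cocycles ?X i \<subseteq> coboundaries ?X i" if i: "i \<noteq> n" for i
  proof
    fix z assume "z \<in> cocycles ?X i"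
    then have "z = \<zero>\<^bsub>obj ?X i\<^esub>" by (rule stalk_carrier[OF i cocycles_closed])
    then show "z \<in> coboundaries ?X i" using coboundaries_zero[OF X] by simp
  qed
  show "all_null R ?X (shift k E)"
    by (rule all_null_of_acyclic[OF two_term_injective_shift[OF two_term_E] X]; rule ex) (use k assms in auto)
qed

text \<open>
  A cohomology class of degree \<open>n\<close> is a map from \<open>R[-n]\<close>, an object of the aisle.
\<close>

lemma coaisle_low_acyclic:
  assumes Y: "Y \<in> perp R {0<..} C" and n: "n < m"
  shows "cocycles Y n \<subseteq> coboundaries Y n"
proof
  fix z assume z: "z \<in> cocycles Y n"
  note YC = perp_complexes[OF Y]
  note X = low_stalk_in_aisle[OF n]
  note XC = perp_complexes[OF X]
  have "of_map R (ideal_stalk n (carrier R)) Y (element_map n Y z) \<in> Hom_D R (ideal_stalk n (carrier R)) Y"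
    by (rule of_map_Hom_D[OF XC element_map_chain_map[OF whole_ring_ideal YC z]])
  then show "z \<in> coboundaries Y n"
    using element_map_zeroD[OF YC z] aisle_orthogonal[OF X Y] by blast
qed

text \<open>
  In the triangle \<open>A \<rightarrow> B \<rightarrow> G\<close> of \<open>P \<cong> B\<close> with \<open>A\<close> in the aisle and \<open>G\<close> in the coaisle, the first map is
  zero in the derived category.  So a map \<open>h : B \<rightarrow> E[k]\<close> becomes null homotopic on \<open>A\<close>, and as maps
  \<open>G \<rightarrow> E[k]\<close> vanish for \<open>k > 0\<close>, it is null homotopic itself.
\<close>

lemma in_coaisle_of_orthogonal:
  assumes P: "P \<in> complexes R"
    and orth: "\<And>X. X \<in> perp R {..0} C \<Longrightarrow> Hom_D R X P = {zero_D R X P}"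
  shows "P \<in> perp R {0<..} C"
  unfolding perp_iff
proof (intro conjI ballI P)
  fix k :: int assume k: "k \<in> {0<..}"
  obtain X1 X2 A B f where 1: "X1 \<in> perp R {..0} C" "X2 \<in> perp R {0<..} C"
    "A \<in> complexes R" "B \<in> complexes R" "f \<in> chain_maps R A B"
    "zigzag R X1 A" "zigzag R P B" "zigzag R X2 (cone A B f)"
    by (rule truncation[OF P])
  note Ek = two_term_injective_shift[OF two_term_E, of k]
  note EkC = two_term_injective_complexes[OF Ek]
  have "all_null R X2 (shift k E)" using 1(2) k unfolding perp_iff by blast
  then have cone: "all_null R (cone A B f) (shift k E)" using zigzag_all_null_iff[OF 1(8) Ek] by blast
  have "all_null R B (shift k E)"
    unfolding all_null_def
  proof
    fix h assume h: "h \<in> chain_maps R B (shift k E)"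
    obtain W1 s1 a1 where w1: "qis R W1 X1 s1" "qis R W1 A a1" using 1(6) unfolding zigzag_def by blast
    obtain W2 s2 b2 where w2: "qis R W2 P s2" "qis R W2 B b2" using 1(7) unfolding zigzag_def by blast
    obtain V a b where V: "qis R V W1 a" "b \<in> chain_maps R V W2"
        "heq R V B (comp_map (comp_map f a1) a) (comp_map b2 b)"
      using qis_ore[OF qisD(1)[OF w1(1)] chain_map_comp[OF qisD(3)[OF w1(2)] 1(5)] w2(2)] by blast
    obtain V' c where V': "qis R V' V c" "heq R V' P (comp_map (comp_map s2 b) c) (zero_map P)"
      by (rule Hom_D_zeroD[OF qisD(2)[OF w1(1)] P orth[OF 1(1)] qis_comp[OF V(1) w1(1)]
        chain_map_comp[OF V(2) qisD(3)[OF w2(1)]]])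
    obtain h' where h': "h' \<in> chain_maps R P (shift k E)"
        "heq R W2 (shift k E) (comp_map h b2) (comp_map h' s2)"
      by (rule qis_extend[OF w2(1) Ek chain_map_comp[OF qisD(3)[OF w2(2)] h]])
    note cc = qisD(3)[OF V'(1)] and VC' = qisD(1)[OF V'(1)]
    have "heq R V' (shift k E) (comp_map (comp_map h f) (comp_map a1 (comp_map a c)))
        (comp_map h (comp_map b2 (comp_map b c)))"
      using heq_right[OF heq_left[OF V(3) h EkC] cc VC'] by (simp add: comp_map_assoc)
    also have "heq R V' (shift k E) \<dots> (comp_map h' (comp_map s2 (comp_map b c)))"
      using heq_right[OF heq_right[OF h'(2) V(2) qisD(1)[OF V(1)]] cc VC'] by (simp add: comp_map_assoc)
    also have "heq R V' (shift k E) (comp_map h' (comp_map s2 (comp_map b c))) (zero_map (shift k E))"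
      using heq_null_left[OF V'(2) h'(1) EkC] by (simp add: comp_map_assoc)
    finally have "heq R A (shift k E) (comp_map h f) (zero_map (shift k E))"
      by (rule qis_null[OF qis_comp[OF qis_comp[OF V'(1) V(1)] w1(2)] Ek chain_map_comp[OF 1(5) h]])
    then have "homotopic R B (shift k E) h (zero_map (shift k E))"
      using null_homotopic_of_cone[OF 1(3,4) EkC 1(5) h heqD(5)] cone heqD(5) unfolding all_null_def by blast
    then show "heq R B (shift k E) h (zero_map (shift k E))" using 1(4) EkC h by (simp add: heq_def)
  qed
  then show "all_null R P (shift k E)" using zigzag_all_null_iff[OF 1(7) Ek] by blast
qed

end


context two_term_cosilting
begin

text \<open>
  Here \<open>prime\<close> says that \<open>ann(y)\<close> is a prime ideal.  The proof chooses \<open>s\<close> with \<open>ann(s)\<close> as large as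
  possible and truncates the stalk complex of the ideal \<open>s R\<close>.  The degree \<open>m\<close> cohomology of the aisle
  part embeds into \<open>s R\<close> and has no nonzero map to \<open>R y\<close>; it is zero, since by the choice of \<open>s\<close> no
  nonzero ideal inside \<open>s R\<close> is killed by an element outside the prime.  Hence every map from \<open>s R\<close> to
  \<open>E\<^sup>m\<^sup>+\<^sup>1\<close>, for instance \<open>x \<mapsto> x e\<close>, lifts to \<open>E\<^sup>m\<close>.
\<close>

lemma cokernel_killed_outside_prime:
  assumes y: "y \<in> cocycles E m" "y \<noteq> \<zero>\<^bsub>obj E m\<^esub>"
    and prime: "\<And>a b. a \<in> carrier R \<Longrightarrow> b \<in> carrier R \<Longrightarrow> a \<odot>\<^bsub>obj E m\<^esub> y \<noteq> \<zero>\<^bsub>obj E m\<^esub> \<Longrightarrow>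
      b \<odot>\<^bsub>obj E m\<^esub> y \<noteq> \<zero>\<^bsub>obj E m\<^esub> \<Longrightarrow> (a \<otimes>\<^bsub>R\<^esub> b) \<odot>\<^bsub>obj E m\<^esub> y \<noteq> \<zero>\<^bsub>obj E m\<^esub>"
  obtains s where "s \<in> carrier R" "s \<odot>\<^bsub>obj E m\<^esub> y \<noteq> \<zero>\<^bsub>obj E m\<^esub>"
    "\<And>e. e \<in> carrier (obj E (m + 1)) \<Longrightarrow> s \<odot>\<^bsub>obj E (m + 1)\<^esub> e \<in> coboundaries E (m + 1)"
proof -
  interpret R: cring R by (rule cring_R)
  interpret N: noetherian_ring R by (rule noetherian)
  interpret Em: module R "obj E m" using E_complex by (rule complexes_module)
  interpret Em1: module R "obj E (m + 1)" using E_complex by (rule complexes_module)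
  have yc: "y \<in> carrier (obj E m)" using y by simp
  define ann where "ann = (\<lambda>s. {r \<in> carrier R. s \<otimes>\<^bsub>R\<^esub> r = \<zero>\<^bsub>R\<^esub>})"
  define Q where "Q = {s \<in> carrier R. s \<odot>\<^bsub>obj E m\<^esub> y \<noteq> \<zero>\<^bsub>obj E m\<^esub>}"
  have "\<one>\<^bsub>R\<^esub> \<in> Q" using y yc by (simp add: Q_def)
  then have ne: "ann ` Q \<noteq> {}" by blast
  have id: "ann ` Q \<subseteq> {I. ideal I R}"
    using R.annihilator_ideal by (auto simp: Q_def ann_def)
  obtain I where I: "I \<in> ann ` Q" "\<And>I'. I' \<in> ann ` Q \<Longrightarrow> I \<subseteq> I' \<Longrightarrow> I' = I"
    by (rule N.maximal_in_ideals[OF ne id]) (rule that)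
  then obtain s where sQ: "s \<in> Q" "I = ann s" by blast
  have s: "s \<in> carrier R" "s \<odot>\<^bsub>obj E m\<^esub> y \<noteq> \<zero>\<^bsub>obj E m\<^esub>" using sQ(1) by (auto simp: Q_def)
  \<comment> \<open>No nonzero element of \<open>s R\<close> is killed from outside the prime.\<close>
  have ann_s: "s \<otimes>\<^bsub>R\<^esub> x = \<zero>\<^bsub>R\<^esub>"
    if t: "t \<in> carrier R" "t \<odot>\<^bsub>obj E m\<^esub> y \<noteq> \<zero>\<^bsub>obj E m\<^esub>" and x: "x \<in> carrier R" "t \<otimes>\<^bsub>R\<^esub> (s \<otimes>\<^bsub>R\<^esub> x) = \<zero>\<^bsub>R\<^esub>" for t x
  proof -
    have ts: "t \<otimes>\<^bsub>R\<^esub> s \<in> Q" using prime[OF t(1) s(1) t(2) s(2)] t(1) s(1) by (simp add: Q_def)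
    have "ann s \<subseteq> ann (t \<otimes>\<^bsub>R\<^esub> s)"
      using t(1) s(1) by (auto simp: ann_def R.m_assoc)
    then have "ann (t \<otimes>\<^bsub>R\<^esub> s) = ann s" using I(2)[OF imageI[OF ts]] sQ(2) by blast
    moreover have "x \<in> ann (t \<otimes>\<^bsub>R\<^esub> s)" using x t(1) s(1) by (simp add: ann_def R.m_assoc)
    ultimately show ?thesis by (simp add: ann_def)
  qed
  define S where "S = PIdl\<^bsub>R\<^esub> s"
  have S: "ideal S R" unfolding S_def by (rule R.cgenideal_ideal[OF s(1)])
  have S_iff: "r \<in> S \<longleftrightarrow> (\<exists>x\<in>carrier R. r = s \<otimes>\<^bsub>R\<^esub> x)" for r
    unfolding S_def cgenideal_def using s(1) R.m_comm by auto
  let ?X = "ideal_stalk m S"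
  have X: "?X \<in> complexes R" by (rule ideal_stalk_complexes[OF S])
  obtain X1 X2 A B f where 1: "X1 \<in> perp R {..0} C" "X2 \<in> perp R {0<..} C"
    "A \<in> complexes R" "B \<in> complexes R" "f \<in> chain_maps R A B"
    "zigzag R X1 A" "zigzag R ?X B" "zigzag R X2 (cone A B f)"
    by (rule truncation[OF X])
  have coneC: "cone A B f \<in> complexes R" by (rule cone_complexes[OF 1(3-5)])
  interpret Am: module R "obj A m" using 1(3) by (rule complexes_module)
  have "all_null R X1 (shift 0 E)" using 1(1) unfolding perp_iff by blast
  then have nullA: "all_null R A E" using zigzag_all_null_iff[OF 1(6) two_term_E] by simp
  have exG: "cocycles (cone A B f) (m - 1) \<subseteq> coboundaries (cone A B f) (m - 1)"
    using coaisle_low_acyclic[OF 1(2), of "m - 1"] zigzag_acyclic_iff[OF 1(8)] by simp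
  have exA: "cocycles A m \<subseteq> coboundaries A m"
  proof (rule ccontr)
    assume "\<not> cocycles A m \<subseteq> coboundaries A m"
    then obtain z1 where z1: "z1 \<in> cocycles A m" "z1 \<notin> coboundaries A m" by blast
    obtain th where th: "\<And>z. z \<in> cocycles A m \<Longrightarrow> th z \<in> S"
      "\<And>z z'. z \<in> cocycles A m \<Longrightarrow> z' \<in> cocycles A m \<Longrightarrow> th (z \<oplus>\<^bsub>obj A m\<^esub> z') = th z \<oplus>\<^bsub>R\<^esub> th z'"
      "\<And>a z. a \<in> carrier R \<Longrightarrow> z \<in> cocycles A m \<Longrightarrow> th (a \<odot>\<^bsub>obj A m\<^esub> z) = a \<otimes>\<^bsub>R\<^esub> th z"
      "\<And>z. z \<in> cocycles A m \<Longrightarrow> th z = \<zero>\<^bsub>R\<^esub> \<longleftrightarrow> z \<in> coboundaries A m"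
      by (rule cohomology_embeds_in_ideal[OF 1(3-5) exG 1(7) S inj_code]) (rule that)
    \<comment> \<open>\<open>H\<^sup>m(A)\<close>, viewed inside \<open>s R\<close>.\<close>
    define J where "J = th ` cocycles A m"
    have Sc: "r \<in> carrier R" if "r \<in> S" for r using that s(1) unfolding S_iff by auto
    have Jc: "r \<in> carrier R" if "r \<in> J" for r using that Sc[OF th(1)] unfolding J_def by blast
    have J: "ideal J R"
    proof (rule R.ideal_criterion)
      show "J \<subseteq> carrier R" using Jc by blast
      have c0: "\<zero>\<^bsub>obj A m\<^esub> \<in> coboundaries A m" by (rule coboundaries_zero[OF 1(3)])
      have c1: "\<zero>\<^bsub>obj A m\<^esub> \<in> cocycles A m" by (rule coboundaries_cocycles[OF 1(3) c0])
      show "\<zero>\<^bsub>R\<^esub> \<in> J" unfolding J_def using th(4)[OF c1] c0 c1 by (metis image_eqI)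
    next
      fix r r' assume "r \<in> J" "r' \<in> J"
      then obtain z z' where z: "z \<in> cocycles A m" "z' \<in> cocycles A m" "r = th z" "r' = th z'"
        by (auto simp: J_def)
      then have "r \<oplus>\<^bsub>R\<^esub> r' = th (z \<oplus>\<^bsub>obj A m\<^esub> z')" using th(2) by simp
      then show "r \<oplus>\<^bsub>R\<^esub> r' \<in> J" unfolding J_def using cocycles_add[OF 1(3) z(1,2)] by blast
    next
      fix a r assume a: "a \<in> carrier R" "r \<in> J"
      then obtain z where z: "z \<in> cocycles A m" "r = th z" by (auto simp: J_def)
      then have "a \<otimes>\<^bsub>R\<^esub> r = th (a \<odot>\<^bsub>obj A m\<^esub> z)" using th(3) a by simp
      then show "a \<otimes>\<^bsub>R\<^esub> r \<in> J" unfolding J_def using cocycles_smult[OF 1(3) a(1) z(1)] by blast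
    qed
    have J0: "\<exists>r\<in>J. t \<otimes>\<^bsub>R\<^esub> r \<noteq> \<zero>\<^bsub>R\<^esub>" if t: "t \<in> carrier R" "t \<odot>\<^bsub>obj E m\<^esub> y \<noteq> \<zero>\<^bsub>obj E m\<^esub>" for t
    proof (rule bexI)
      obtain x where x: "x \<in> carrier R" "th z1 = s \<otimes>\<^bsub>R\<^esub> x" using th(1)[OF z1(1)] S_iff by blast
      show "t \<otimes>\<^bsub>R\<^esub> th z1 \<noteq> \<zero>\<^bsub>R\<^esub>"
        using ann_s[OF t x(1)] th(4)[OF z1(1)] z1(2) x(2) by auto
      show "th z1 \<in> J" unfolding J_def using z1(1) by blast
    qed
    obtain psi where psi: "\<And>r. r \<in> J \<Longrightarrow> \<exists>t\<in>carrier R. psi r = t \<odot>\<^bsub>obj E m\<^esub> y"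
      "\<And>r r'. r \<in> J \<Longrightarrow> r' \<in> J \<Longrightarrow> psi (r \<oplus>\<^bsub>R\<^esub> r') = psi r \<oplus>\<^bsub>obj E m\<^esub> psi r'"
      "\<And>a r. a \<in> carrier R \<Longrightarrow> r \<in> J \<Longrightarrow> psi (a \<otimes>\<^bsub>R\<^esub> r) = a \<odot>\<^bsub>obj E m\<^esub> psi r"
      "\<exists>r\<in>J. psi r \<noteq> \<zero>\<^bsub>obj E m\<^esub>"
      by (rule nonzero_map_to_cyclic[OF noetherian Em.module_axioms J yc y(2)])
        ((rule prime; assumption) | (rule J0; assumption) | (rule that; assumption))+
    have thJ: "th z \<in> J" if "z \<in> cocycles A m" for z using that by (simp add: J_def)
    have psi0: "psi \<zero>\<^bsub>R\<^esub> = \<zero>\<^bsub>obj E m\<^esub>"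
    proof -
      have "th z1 \<in> J" by (rule thJ[OF z1(1)])
      then have "psi (\<zero>\<^bsub>R\<^esub> \<otimes>\<^bsub>R\<^esub> th z1) = \<zero>\<^bsub>R\<^esub> \<odot>\<^bsub>obj E m\<^esub> psi (th z1)" using psi(3) by simp
      moreover have "psi (th z1) \<in> carrier (obj E m)" using psi(1)[OF thJ[OF z1(1)]] yc by auto
      ultimately show ?thesis using Jc[OF thJ[OF z1(1)]] by simp
    qed
    have "psi (th z) = \<zero>\<^bsub>obj E m\<^esub>" if z: "z \<in> cocycles A m" for z
    proof (rule cohomology_map_zero[OF two_term_E 1(3) nullA, where q = "\<lambda>z. psi (th z)"])
      show "psi (th z) \<in> cocycles E m" if "z \<in> cocycles A m" for z
        using psi(1)[OF thJ[OF that]] cocycles_smult[OF E_complex _ y(1)] by auto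
      show "psi (th (z \<oplus>\<^bsub>obj A m\<^esub> z')) = psi (th z) \<oplus>\<^bsub>obj E m\<^esub> psi (th z')"
        if "z \<in> cocycles A m" "z' \<in> cocycles A m" for z z'
        using th(2)[OF that] psi(2)[OF thJ[OF that(1)] thJ[OF that(2)]] by simp
      show "psi (th (a \<odot>\<^bsub>obj A m\<^esub> z)) = a \<odot>\<^bsub>obj E m\<^esub> psi (th z)"
        if "a \<in> carrier R" "z \<in> cocycles A m" for a z
        using th(3)[OF that] psi(3)[OF that(1) thJ[OF that(2)]] by simp
      show "psi (th b) = \<zero>\<^bsub>obj E m\<^esub>" if "b \<in> coboundaries A m" for b
        using th(4)[OF coboundaries_cocycles[OF 1(3) that]] that psi0 by simp
    qed (rule z)
    then show False using psi(4) by (auto simp: J_def)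
  qed
  have exB: "cocycles B (m - 1) \<subseteq> coboundaries B (m - 1)"
  proof -
    have "cocycles ?X (m - 1) \<subseteq> coboundaries ?X (m - 1)"
    proof
      fix z assume z: "z \<in> cocycles ?X (m - 1)"
      have "z = \<zero>\<^bsub>obj ?X (m - 1)\<^esub>" by (rule stalk_carrier[OF _ cocycles_closed[OF z]]) simp
      then show "z \<in> coboundaries ?X (m - 1)" using coboundaries_zero[OF X] by simp
    qed
    then show ?thesis using zigzag_acyclic_iff[OF 1(7)] by blast
  qed
  note E1 = two_term_injective_shift[OF two_term_E, of 1]
  note E1C = two_term_injective_complexes[OF E1]
  have "all_null R X2 (shift 1 E)" using 1(2) unfolding perp_iff by simp
  then have nullG: "all_null R (cone A B f) (shift 1 E)" using zigzag_all_null_iff[OF 1(8) E1] by blast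
  \<comment> \<open>Restricted to \<open>A\<close>, a map to \<open>E[1]\<close> is null homotopic: its component in degree \<open>m - 1\<close> kills the
    cocycles because \<open>H\<^sup>m\<^sup>-\<^sup>1(B) = 0\<close>, and \<open>H\<^sup>m(A) = 0\<close>.\<close>
  have "all_null R B (shift 1 E)"
    unfolding all_null_def
  proof
    fix h assume h: "h \<in> chain_maps R B (shift 1 E)"
    have "homotopic R A (shift 1 E) (comp_map h f) (zero_map (shift 1 E))"
    proof (rule null_homotopic_two_term[OF E1 1(3) chain_map_comp[OF 1(5) h]])
      fix z assume "z \<in> cocycles A (m - 1)"
      then have "f (m - 1) z \<in> coboundaries B (m - 1)"
        using chain_map_cocycles[OF 1(5,3,4)] exB by blast
      from two_term_coboundaries[OF E1 chain_map_coboundaries[OF h this]]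
      show "comp_map h f (m - 1) z = \<zero>\<^bsub>obj (shift 1 E) (m - 1)\<^esub>" by (simp add: comp_map_def)
    qed (use exA in simp)
    then have "homotopic R B (shift 1 E) h (zero_map (shift 1 E))"
      using null_homotopic_of_cone[OF 1(3,4) E1C 1(5) h] nullG heqD(5) unfolding all_null_def by blast
    then show "heq R B (shift 1 E) h (zero_map (shift 1 E))" using 1(4) E1C h by (simp add: heq_def)
  qed
  then have nullX: "all_null R ?X (shift 1 E)" using zigzag_all_null_iff[OF 1(7) E1] by blast
  show thesis
  proof (rule that[OF s])
    fix e assume e: "e \<in> carrier (obj E (m + 1))"
    have "diff E (m + 1) e \<in> carrier (obj E (m + 1 + 1))" using E_complex e by simp
    then have "diff E (m + 1) e = \<zero>\<^bsub>obj E (m + 1 + 1)\<^esub>"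
      by (rule two_term_injective_zero[OF two_term_E, rotated 2]) simp_all
    then have ez: "e \<in> cocycles (shift 1 E) m"
      unfolding shift_cocycles[OF E_complex] using e by (rule cocyclesI[rotated])
    note em = element_map_chain_map[OF S E1C ez]
    have "heq R ?X (shift 1 E) (element_map m (shift 1 E) e) (zero_map (shift 1 E))"
      using nullX em by (simp add: all_null_def)
    note hom = heqD(5)[OF this]
    have "s \<in> S" unfolding S_iff using s(1) by (intro bexI[of _ "\<one>\<^bsub>R\<^esub>"]) simp_all
    then have "code s \<in> cocycles ?X m" by (intro stalk_cocycles) (simp add: ideal_module_carrier)
    from homotopic_cocycles[OF hom X E1C this em chain_map_zero_map[OF E1C]]
    have "s \<odot>\<^bsub>obj E (m + 1)\<^esub> e \<ominus>\<^bsub>obj E (m + 1)\<^esub> \<zero>\<^bsub>obj E (m + 1)\<^esub> \<in> coboundaries E (m + 1)"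
      using s(1) by (simp add: element_map_code zero_map_def shift_coboundaries[OF E_complex])
    then show "s \<odot>\<^bsub>obj E (m + 1)\<^esub> e \<in> coboundaries E (m + 1)"
      using s(1) e by (simp add: Em1.M.minus_eq)
  qed
qed

text \<open>
  A chain map from \<open>R[-n]\<close> is determined by the image of \<open>1\<close>, and a primitive of this cocycle gives a null
  homotopy.
\<close>

lemma null_of_element:
  assumes h: "h \<in> chain_maps R (ideal_stalk n (carrier R)) E"
    and b: "h n (code \<one>\<^bsub>R\<^esub>) \<in> coboundaries E n"
  shows "heq R (ideal_stalk n (carrier R)) E h (zero_map E)"
proof -
  let ?X = "ideal_stalk n (carrier R)"
  interpret R: cring R by (rule cring_R)
  note X = ideal_stalk_complexes[OF whole_ring_ideal, of n]
  obtain e where e: "e \<in> carrier (obj E (n - 1))" "h n (code \<one>\<^bsub>R\<^esub>) = diff E (n - 1) e"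
    using b by (rule coboundariesE[of _ _ _ "n - 1"]) simp
  define k where "k = (\<lambda>i x. if i = n then decode x \<odot>\<^bsub>obj E (n - 1)\<^esub> e else \<zero>\<^bsub>obj E (i - 1)\<^esub>)"
  have kh: "k i \<in> mod_hom R (obj ?X i) (obj E (i - 1))" for i
  proof (cases "i = n")
    case True
    then show ?thesis
      using ideal_module_hom[OF complexes_module[OF E_complex] whole_ring_ideal inj_code e(1)] by (simp add: k_def)
  next
    case False
    then show ?thesis using mod_hom_const_zero[OF complexes_module[OF E_complex]] by (simp add: k_def)
  qed
  have "homotopic R ?X E h (zero_map E)"
  proof (rule homotopicI[OF E_complex X h chain_map_zero_map[OF E_complex] kh])
    fix i x assume x: "x \<in> carrier (obj ?X i)"
    interpret Ei: module R "obj E i" using E_complex by (rule complexes_module)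
    have "k (i + 1) (diff ?X i x) = \<zero>\<^bsub>obj E (i + 1 - 1)\<^esub>"
      unfolding stalk_diff by (rule mod_hom_zero[OF kh complexes_group[OF X] complexes_group[OF E_complex]])
    then have kd: "k (i + 1) (diff ?X i x) = \<zero>\<^bsub>obj E i\<^esub>" by simp
    have dk: "diff E (i - 1) (k i x) = h i x"
    proof (cases "i = n")
      case True
      then obtain r where r: "r \<in> carrier R" "x = code r" using x by (auto simp: ideal_module_carrier)
      have one: "code \<one>\<^bsub>R\<^esub> \<in> carrier (ideal_module code R (carrier R))" by (simp add: ideal_module_carrier)
      have xr: "x = r \<odot>\<^bsub>ideal_module code R (carrier R)\<^esub> code \<one>\<^bsub>R\<^esub>"
        using r by (simp add: ideal_module_def Let_def)
      have "h n x = r \<odot>\<^bsub>obj E n\<^esub> h n (code \<one>\<^bsub>R\<^esub>)"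
        unfolding xr using chain_map_smult[OF h r(1), of "code \<one>\<^bsub>R\<^esub>" n] one by simp
      also have "\<dots> = diff E (n - 1) (r \<odot>\<^bsub>obj E (n - 1)\<^esub> e)"
        unfolding e(2) using diff_smult[OF E_complex r(1) e(1)] by simp
      finally show ?thesis using True r by (simp add: k_def)
    next
      case False
      have "h i x = \<zero>\<^bsub>obj E i\<^esub>"
        using stalk_carrier[OF False x] chain_map_zero[OF h X E_complex, of i] by simp
      then show ?thesis using False diff_zero[OF E_complex, of "i - 1"] by (simp add: k_def)
    qed
    have "h i x \<in> carrier (obj E i)" using chain_map_closed[OF h x] .
    then show "h i x = (diff E (i - 1) (k i x) \<oplus>\<^bsub>obj E i\<^esub> k (i + 1) (diff ?X i x)) \<oplus>\<^bsub>obj E i\<^esub> zero_map E i x"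
      unfolding dk kd by (simp add: zero_map_def)
  qed
  then show ?thesis using X E_complex h by (simp add: heq_def)
qed

context
  fixes I :: "'u set" and P :: "('r, 'u) cochain" and p :: "'u \<Rightarrow> ('r, 'u) mor"
  assumes power: "power_D R I C P p"
begin

lemma power_complexes: "P \<in> complexes R"
  using power by (simp add: power_D_def)

lemma power_proj: "i \<in> I \<Longrightarrow> p i \<in> Hom_D R P C"
  using power by (simp add: power_D_def)

text \<open>
  Maps into a power are determined by their components.  The composites with the projections must be
  known to be morphisms for uniqueness to apply, which is what \<open>comp_D_Hom_D\<close> provides.
\<close>

lemma power_eqI:
  assumes Z: "Z \<in> complexes R" and f: "f \<in> Hom_D R Z P" and f': "f' \<in> Hom_D R Z P"
    and eq: "\<And>i. i \<in> I \<Longrightarrow> comp_D R Z P C (p i) f = comp_D R Z P C (p i) f'"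
  shows "f = f'"
proof -
  define q where "q = (\<lambda>i. comp_D R Z P C (p i) f')"
  have "\<forall>i\<in>I. q i \<in> Hom_D R Z C"
    using comp_D_Hom_D[OF Z power_complexes f' power_proj] by (simp add: q_def)
  then have "\<exists>!g. g \<in> Hom_D R Z P \<and> (\<forall>i\<in>I. comp_D R Z P C (p i) g = q i)"
    using power Z unfolding power_D_def by blast
  then show ?thesis using f f' eq unfolding q_def by blast
qed

lemma power_in_coaisle: "P \<in> perp R {0<..} C"
proof (rule in_coaisle_of_orthogonal[OF power_complexes])
  fix X assume X: "X \<in> perp R {..0} C"
  note XC = perp_complexes[OF X]
  have "Hom_D R X (shift 0 C) = {zero_D R X (shift 0 C)}"
    using X unfolding perp_def by blast
  then have 0: "Hom_D R X C = {zero_D R X C}" by simp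
  note z = zero_D_Hom_D[OF XC power_complexes]
  have "f = zero_D R X P" if f: "f \<in> Hom_D R X P" for f
  proof (rule power_eqI[OF XC f z])
    fix i assume i: "i \<in> I"
    show "comp_D R X P C (p i) f = comp_D R X P C (p i) (zero_D R X P)"
      using comp_D_Hom_D[OF XC power_complexes f power_proj[OF i]]
        comp_D_Hom_D[OF XC power_complexes z power_proj[OF i]] unfolding 0 by simp
  qed
  then show "Hom_D R X P = {zero_D R X P}" using z by blast
qed

text \<open>
  The class of \<open>r z\<close> is a map \<open>R[-n] \<rightarrow> P\<close>.  Its components are classes in \<open>r H\<^sup>n(C) = r H\<^sup>n(E) = 0\<close>, so the
  map is zero.
\<close>

lemma power_cohomology_killed:
  assumes r: "r \<in> carrier R" and E: "\<And>e. e \<in> cocycles E n \<Longrightarrow> r \<odot>\<^bsub>obj E n\<^esub> e \<in> coboundaries E n"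
    and z: "z \<in> cocycles P n"
  shows "r \<odot>\<^bsub>obj P n\<^esub> z \<in> coboundaries P n"
proof -
  let ?X = "ideal_stalk n (carrier R)"
  interpret R: cring R by (rule cring_R)
  interpret Pn: module R "obj P n" using power_complexes by (rule complexes_module)
  note X = ideal_stalk_complexes[OF whole_ring_ideal, of n]
  have rz: "r \<odot>\<^bsub>obj P n\<^esub> z \<in> cocycles P n" by (rule cocycles_smult[OF power_complexes r z])
  note em = element_map_chain_map[OF whole_ring_ideal power_complexes rz]
  have 1: "comp_D R ?X P C (p i) (of_map R ?X P (element_map n P (r \<odot>\<^bsub>obj P n\<^esub> z))) = zero_D R ?X C" if i: "i \<in> I" for i
  proof (rule comp_D_of_map_eq_zero[OF X power_complexes em power_proj[OF i]])
    fix h assume h: "h \<in> chain_maps R P E"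
    have "comp_map h (element_map n P (r \<odot>\<^bsub>obj P n\<^esub> z)) n (code \<one>\<^bsub>R\<^esub>) = r \<odot>\<^bsub>obj E n\<^esub> h n z"
      using rz z r by (simp add: comp_map_def element_map_code chain_map_smult[OF h])
    then show "heq R ?X E (comp_map h (element_map n P (r \<odot>\<^bsub>obj P n\<^esub> z))) (zero_map E)"
      using E[OF chain_map_cocycles[OF h power_complexes E_complex z]]
      by (intro null_of_element chain_map_comp[OF em h]) simp
  qed
  have 2: "comp_D R ?X P C (p i) (zero_D R ?X P) = zero_D R ?X C" if i: "i \<in> I" for i
    unfolding zero_D_def[of R ?X P]
    by (rule comp_D_of_map_eq_zero[OF X power_complexes chain_map_zero_map[OF power_complexes] power_proj[OF i]])
      (rule heq_comp_zero[OF X power_complexes E_complex])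
  have "of_map R ?X P (element_map n P (r \<odot>\<^bsub>obj P n\<^esub> z)) = zero_D R ?X P"
    by (rule power_eqI[OF X of_map_Hom_D[OF X em] zero_D_Hom_D[OF X power_complexes]]) (simp add: 1 2)
  then show ?thesis by (rule element_map_zeroD[OF power_complexes rz])
qed

lemma power_high_acyclic:
  assumes n: "n > m + 1" shows "cocycles P n \<subseteq> coboundaries P n"
proof
  interpret R: cring R by (rule cring_R)
  interpret Pn: module R "obj P n" using power_complexes by (rule complexes_module)
  fix z assume z: "z \<in> cocycles P n"
  have "\<one>\<^bsub>R\<^esub> \<odot>\<^bsub>obj P n\<^esub> z \<in> coboundaries P n"
  proof (rule power_cohomology_killed[OF R.one_closed _ z])
    fix e assume "e \<in> cocycles E n"
    then have "\<one>\<^bsub>R\<^esub> \<odot>\<^bsub>obj E n\<^esub> e \<in> carrier (obj E n)" using E_complex by simp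
    then have "\<one>\<^bsub>R\<^esub> \<odot>\<^bsub>obj E n\<^esub> e = \<zero>\<^bsub>obj E n\<^esub>"
      by (rule two_term_injective_zero[OF two_term_E, rotated 2]) (use n in auto)
    then show "\<one>\<^bsub>R\<^esub> \<odot>\<^bsub>obj E n\<^esub> e \<in> coboundaries E n" using coboundaries_zero[OF E_complex] by simp
  qed
  then show "z \<in> coboundaries P n" using z by simp
qed

text \<open>
  Only \<open>k = -1\<close> is not a matter of degrees.  There, \<open>h\<close> must kill the cocycles of degree \<open>m + 1\<close>, which it
  maps to cocycles in \<open>E\<^sup>m\<close>.  Otherwise a nonzero value \<open>y = h v\<close> with largest annihilator has a prime
  annihilator; an \<open>s\<close> outside this prime kills \<open>H\<^sup>m\<^sup>+\<^sup>1(E)\<close> and hence \<open>H\<^sup>m\<^sup>+\<^sup>1(P)\<close>, so that \<open>s y = h (s v) = 0\<close>.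
\<close>

lemma power_no_maps_down:
  assumes k: "k < 0" shows "all_null R P (shift k E)"
proof -
  note Ek = two_term_injective_shift[OF two_term_E, of k]
  note EkC = two_term_injective_complexes[OF Ek]
  note PC = power_complexes
  show ?thesis
  proof (cases "k = - 1")
    case False
    then show ?thesis
      by (intro all_null_of_acyclic[OF Ek PC] power_high_acyclic) (use k in auto)
  next
    case True
    interpret R: cring R by (rule cring_R)
    interpret Pm: module R "obj P (m + 1)" using PC by (rule complexes_module)
    interpret Em: module R "obj E m" using E_complex by (rule complexes_module)
    interpret N: noetherian_ring R by (rule noetherian)
    show ?thesis
      unfolding all_null_def
    proof
      fix h assume h: "h \<in> chain_maps R P (shift k E)"
      have objk: "obj (shift k E) (m + 1) = obj E m" using True by simp
      have cyck: "cocycles (shift k E) (m + 1) = cocycles E m"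
        unfolding shift_cocycles[OF E_complex] using True by simp
      define ann where "ann = (\<lambda>z. {r \<in> carrier R. r \<odot>\<^bsub>obj E m\<^esub> h (m + 1) z = \<zero>\<^bsub>obj E m\<^esub>})"
      have hz: "h (m + 1) z \<in> cocycles E m" if "z \<in> cocycles P (m + 1)" for z
        using chain_map_cocycles[OF h PC EkC that] unfolding cyck .
      have hsm: "h (m + 1) (a \<odot>\<^bsub>obj P (m + 1)\<^esub> z) = a \<odot>\<^bsub>obj E m\<^esub> h (m + 1) z"
        if "a \<in> carrier R" "z \<in> cocycles P (m + 1)" for a z
        using chain_map_smult[OF h that(1) cocycles_closed[OF that(2)]] objk by simp
      have zero: "h (m + 1) z = \<zero>\<^bsub>obj E m\<^esub>" if "z \<in> cocycles P (m + 1)" for z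
      proof (rule ccontr)
        assume "h (m + 1) z \<noteq> \<zero>\<^bsub>obj E m\<^esub>"
        define Q where "Q = {z \<in> cocycles P (m + 1). h (m + 1) z \<noteq> \<zero>\<^bsub>obj E m\<^esub>}"
        have ne: "ann ` Q \<noteq> {}" using \<open>h (m + 1) z \<noteq> \<zero>\<^bsub>obj E m\<^esub>\<close> \<open>z \<in> cocycles P (m + 1)\<close> by (auto simp: Q_def)
        have id: "ann ` Q \<subseteq> {I. ideal I R}"
          using Em.annihilator_ideal[OF cocycles_closed[OF hz]] by (auto simp: Q_def ann_def)
        obtain I where I: "I \<in> ann ` Q" "\<And>I'. I' \<in> ann ` Q \<Longrightarrow> I \<subseteq> I' \<Longrightarrow> I' = I"
          by (rule N.maximal_in_ideals[OF ne id]) (rule that)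
        then obtain v where v: "v \<in> Q" "I = ann v" by blast
        define y where "y = h (m + 1) v"
        have vz: "v \<in> cocycles P (m + 1)" and y0: "y \<noteq> \<zero>\<^bsub>obj E m\<^esub>" using v(1) by (auto simp: Q_def y_def)
        have y: "y \<in> cocycles E m" unfolding y_def by (rule hz[OF vz])
        have yc: "y \<in> carrier (obj E m)" using y by simp
        have prime: "(a \<otimes>\<^bsub>R\<^esub> b) \<odot>\<^bsub>obj E m\<^esub> y \<noteq> \<zero>\<^bsub>obj E m\<^esub>"
          if ab: "a \<in> carrier R" "b \<in> carrier R" "a \<odot>\<^bsub>obj E m\<^esub> y \<noteq> \<zero>\<^bsub>obj E m\<^esub>" "b \<odot>\<^bsub>obj E m\<^esub> y \<noteq> \<zero>\<^bsub>obj E m\<^esub>" for a b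
        proof
          assume 0: "(a \<otimes>\<^bsub>R\<^esub> b) \<odot>\<^bsub>obj E m\<^esub> y = \<zero>\<^bsub>obj E m\<^esub>"
          let ?w = "b \<odot>\<^bsub>obj P (m + 1)\<^esub> v"
          have w: "?w \<in> cocycles P (m + 1)" by (rule cocycles_smult[OF PC ab(2) vz])
          have hw: "h (m + 1) ?w = b \<odot>\<^bsub>obj E m\<^esub> y" using hsm[OF ab(2) vz] by (simp add: y_def)
          have "?w \<in> Q" using w hw ab(4) by (simp add: Q_def)
          moreover have "ann v \<subseteq> ann ?w"
          proof
            fix r assume "r \<in> ann v"
            then have r: "r \<in> carrier R" "r \<odot>\<^bsub>obj E m\<^esub> y = \<zero>\<^bsub>obj E m\<^esub>" by (auto simp: ann_def y_def)
            have "r \<odot>\<^bsub>obj E m\<^esub> (b \<odot>\<^bsub>obj E m\<^esub> y) = (b \<otimes>\<^bsub>R\<^esub> r) \<odot>\<^bsub>obj E m\<^esub> y"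
              using r(1) ab(2) yc R.m_comm[OF ab(2) r(1)] by (simp add: Em.smult_assoc1)
            also have "\<dots> = \<zero>\<^bsub>obj E m\<^esub>" using r ab(2) yc by (simp add: Em.smult_assoc1)
            finally show "r \<in> ann ?w" using r(1) by (simp add: ann_def hw)
          qed
          ultimately have "ann ?w = ann v" using I(2) v(2) by blast
          moreover have "a \<in> ann ?w" using 0 ab(1,2) yc by (simp add: ann_def hw Em.smult_assoc1)
          ultimately have "a \<in> ann v" by simp
          then show False using ab(3) by (simp add: ann_def y_def)
        qed
        obtain s where s: "s \<in> carrier R" "s \<odot>\<^bsub>obj E m\<^esub> y \<noteq> \<zero>\<^bsub>obj E m\<^esub>"
            "\<And>e. e \<in> carrier (obj E (m + 1)) \<Longrightarrow> s \<odot>\<^bsub>obj E (m + 1)\<^esub> e \<in> coboundaries E (m + 1)"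
          by (rule cokernel_killed_outside_prime[OF y y0])
            ((rule prime; assumption) | (rule that; assumption))+
        have "s \<odot>\<^bsub>obj P (m + 1)\<^esub> v \<in> coboundaries P (m + 1)"
          by (rule power_cohomology_killed[OF s(1) s(3) vz]) simp
        then have b: "h (m + 1) (s \<odot>\<^bsub>obj P (m + 1)\<^esub> v) \<in> coboundaries (shift k E) (m + 1)"
          by (rule chain_map_coboundaries[OF h])
        have "m - k = m + 1" using True by simp
        with two_term_coboundaries[OF Ek] b have "h (m + 1) (s \<odot>\<^bsub>obj P (m + 1)\<^esub> v) = \<zero>\<^bsub>obj (shift k E) (m + 1)\<^esub>"
          by metis
        then show False using s(2) hsm[OF s(1) vz] objk by (simp add: y_def)
      qed
      have mk: "m - k = m + 1" using True by simp
      have "homotopic R P (shift k E) h (zero_map (shift k E))"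
        by (rule null_homotopic_two_term[OF Ek PC h]; unfold mk objk)
          (use zero power_high_acyclic[of "m + 1 + 1"] in auto)
      then show "heq R P (shift k E) h (zero_map (shift k E))" using PC EkC h by (simp add: heq_def)
    qed
  qed
qed

lemma power_in_perp: "P \<in> perp R (UNIV - {0}) C"
  unfolding perp_iff
proof (intro conjI ballI power_complexes)
  fix k :: int assume "k \<in> UNIV - {0}"
  then consider "k < 0" | "k > 0" by force
  then show "all_null R P (shift k E)"
  proof cases
    case 1
    then show ?thesis by (rule power_no_maps_down)
  next
    case 2
    then have "k \<in> {0<..}" by simp
    then show ?thesis using power_in_coaisle unfolding perp_iff by blast
  qed
qed

end

end

theorem corollary5p12:
  fixes R :: "'r ring" and C :: "('r, 'u) cochain"
  assumes "grothendieck_universe TYPE('u)"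
    and "cring R" and "noetherian_ring R" and "carrier R \<prec> (UNIV :: 'u set)"
    and "cosilting R C" and "two_term R C"
  shows "cotilting R C"
proof -
  interpret universe "TYPE('u)" by (rule universe.intro) (rule assms(1))
  have C: "C \<in> complexes R" using assms(5) by (simp add: cosilting_def)
  obtain E g m where model: "injective_model TYPE('u) R C E g m"
    by (rule injective_model_of_two_term[OF assms(2) C assms(6)])
  then have "two_term_cosilting TYPE('u) R C E g m"
    using assms(3-5) by (intro two_term_cosilting.intro two_term_cosilting_axioms.intro)
  then show ?thesis
    using assms(5) two_term_cosilting.power_in_perp unfolding cotilting_def by blast
qed

end
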